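(* Let $\bar H$ be the $C^*$-algebra of a compact quantum group, $H$ its Peter–Weyl Hopf algebra, $J$ a coideal right ideal of $H$ and $\pi:H\to C:=H/J$ the canonical surjection. Let $$P_1:=\{f\in C([0,\tfrac12],\bar H)\otimes H\mid(\mathrm{ev}_0\otimes\mathrm{id})(f)\in\Delta(H)\},$$ $$P_2:=\{f\in C([\tfrac12,1],\bar H)\otimes H\mid(\mathrm{ev}_1\otimes\mathrm{id})(f)\in\mathbb{C}\otimes H\}$$ be right and left $C$-comodules for the right and left coactions $$\rho^i_R:=(\mathrm{id}\otimes\pi)\circ\Delta_{P_i},\qquad \rho^i_L:=(\pi\otimes\mathrm{id})\circ{}_{P_i}\Delta,\qquad i=1,2,$$ respectively, where $\Delta_{P_i}:=\mathrm{id}\otimes\Delta$ and ${}_{P_i}\Delta:=(S^{-1}\otimes\mathrm{id})\circ\mathrm{flip}\circ\Delta_{P_i}$. If there exists a unital $C$-bicolinear splitting $i:C\to H$ of $\pi:H\to C$, then the pullback $C$-comodule $$P:=\{(p_1,p_2)\in P_1\times P_2\mid(\mathrm{ev}_{\frac12}\otimes\mathrm{id})(p_1)=(\mathrm{ev}_{\frac12}\otimes\mathrm{id})(p_2)\}$$ is principal.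
   Context: The ground field is $\mathbb{C}$ and $\otimes$ is the algebraic tensor product. $\bar H$ is the $C^*$-algebra of a compact quantum group in the sense of Woronowicz, and $H\subseteq\bar H$ is its dense Hopf $*$-subalgebra spanned by matrix coefficients of irreducible unitary corepresentations, with comultiplication $\Delta$, antipode $S$ (bijective). $C([a,b],\bar H)$ is the algebra of norm-continuous functions $[a,b]\to\bar H$, and $\mathrm{ev}_t$ is evaluation at $t$. $\Delta(H)\subseteq H\otimes H\subseteq\bar H\otimes H$. A coideal right ideal $J$ of $H$ is a right ideal that is also a coideal, so that $H/J$ is a quotient coalgebra. The splitting $i$ satisfies $\pi\circ i=\mathrm{id}$; unital means $i(\pi(1))=1$; bicolinear means colinear for the coactions $(\mathrm{id}\otimes\pi)\circ\Delta:H\to H\otimes C$ and $(\pi\otimes\mathrm{id})\circ\Delta:H\to C\otimes H$ on $H$ and the coactions of $C$ on itself by its comultiplication. $P$ is a unital algebra with componentwise operations and componentwise left and right $C$-coactions. Principality. For a unital algebra $P$ with a right coaction $\Delta_P:P\to P\otimes C$ of a coalgebra $C$, put $B:=P^{\mathrm{co}C}:=\{b\in P\mid\Delta_P(bp)=b\Delta_P(p)\ \forall p\in P\}$. $P$ (with its coaction) is principal if, for some group-like $e\in C$ (here $e=\pi(1)$): (i) $\mathsf{can}:P\otimes_BP\to P\otimes C$, $p\otimes_Bp'\mapsto p\Delta_P(p')$, is bijective; (ii) $\Delta_P(1)=1\otimes e$; (iii) the canonical entwining $\psi:C\otimes P\to P\otimes C$, $\psi(c\otimes p)=\mathsf{can}(\mathsf{can}^{-1}(1\otimes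 c)p)$, is bijective; (iv) there is a left $B$-linear and right $C$-colinear splitting of the multiplication map $B\otimes P\to P$. When a left coaction is also given, it is understood to be ${}_P\Delta(p)=\psi^{-1}(p\otimes e)$. *)

theory Defs
  imports "HOL-Analysis.Analysis" "HOL-Library.Function_Algebras" "HOL-Library.Poly_Mapping"
begin

section \<open>Complex vector spaces, algebras and C*-algebras\<close>

class scaleC =
  fixes scaleC :: "complex \<Rightarrow> 'a \<Rightarrow> 'a"  (infixr \<open>*\<^sub>C\<close> 75)

class complex_vector = scaleC + ab_group_add +
  assumes scaleC_add_right: "c *\<^sub>C (x + y) = c *\<^sub>C x + c *\<^sub>C y"
    and scaleC_add_left: "(c + d) *\<^sub>C x = c *\<^sub>C x + d *\<^sub>C x"
    and scaleC_scaleC [simp]: "c *\<^sub>C d *\<^sub>C x = (c * d) *\<^sub>C x"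
    and scaleC_one [simp]: "1 *\<^sub>C x = x"

global_interpretation complex_vector: vector_space "scaleC :: complex \<Rightarrow> 'a \<Rightarrow> 'a :: complex_vector"
  defines csubspace_raw_def: csubspace = complex_vector.subspace
    and cspan_raw_def: cspan = complex_vector.span
  by unfold_locales (simp_all add: scaleC_add_right scaleC_add_left)

hide_const (open) complex_vector.subspace complex_vector.span

class complex_algebra_1 = complex_vector + ring + monoid_mult +
  assumes mult_scaleC_left [simp]: "(c *\<^sub>C x) * y = c *\<^sub>C (x * y)"
    and mult_scaleC_right [simp]: "x * (c *\<^sub>C y) = c *\<^sub>C (x * y)"

class star =
  fixes star :: "'a \<Rightarrow> 'a"

class cstar_algebra = complex_algebra_1 + star + real_normed_algebra_1 + banach +
  assumes scaleR_scaleC: "r *\<^sub>R x = complex_of_real r *\<^sub>C x"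
    and norm_scaleC: "norm (c *\<^sub>C x) = cmod c * norm x"
    and star_star: "star (star x) = x"
    and star_add: "star (x + y) = star x + star y"
    and star_scaleC: "star (c *\<^sub>C x) = cnj c *\<^sub>C star x"
    and star_mult: "star (x * y) = star y * star x"
    and cstar_identity: "norm (star x * x) = (norm x)\<^sup>2"

definition clinear_on :: "'a::complex_vector set \<Rightarrow> ('a \<Rightarrow> 'b::complex_vector) \<Rightarrow> bool" where
  "clinear_on U f \<longleftrightarrow> (\<forall>x\<in>U. \<forall>y\<in>U. f (x + y) = f x + f y) \<and> (\<forall>c. \<forall>x\<in>U. f (c *\<^sub>C x) = c *\<^sub>C f x)"

definition star_hom :: "('a::cstar_algebra \<Rightarrow> 'b::cstar_algebra) \<Rightarrow> bool" where
  "star_hom f \<longleftrightarrow> clinear_on UNIV f \<and> f 1 = 1 \<and>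
     (\<forall>x y. f (x * y) = f x * f y) \<and> (\<forall>x. f (star x) = star (f x))"

definition subalgebra :: "'a::complex_algebra_1 set \<Rightarrow> bool" where
  "subalgebra A \<longleftrightarrow> csubspace A \<and> 1 \<in> A \<and> (\<forall>x\<in>A. \<forall>y\<in>A. x * y \<in> A)"

instantiation complex :: cstar_algebra
begin
definition scaleC_complex :: "complex \<Rightarrow> complex \<Rightarrow> complex" where "scaleC_complex c z = c * z"
definition star_complex :: "complex \<Rightarrow> complex" where "star_complex = cnj"
instance
proof
  fix x :: complex
  show "norm (star x * x) = (norm x)\<^sup>2"
    by (simp add: star_complex_def norm_mult power2_eq_square)
qed (simp_all add: scaleC_complex_def star_complex_def algebra_simps norm_mult scaleR_conv_of_real)
end

instantiation "fun" :: (type, complex_vector) complex_vector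
begin
definition scaleC_fun :: "complex \<Rightarrow> ('a \<Rightarrow> 'b) \<Rightarrow> 'a \<Rightarrow> 'b" where
  "scaleC_fun c f = (\<lambda>x. c *\<^sub>C f x)"
instance
  by standard (simp_all add: scaleC_fun_def fun_eq_iff scaleC_add_right scaleC_add_left)
end

instance "fun" :: (type, complex_algebra_1) complex_algebra_1
  by standard (simp_all add: scaleC_fun_def fun_eq_iff)

instantiation prod :: (complex_vector, complex_vector) complex_vector
begin
definition scaleC_prod :: "complex \<Rightarrow> 'a \<times> 'b \<Rightarrow> 'a \<times> 'b" where
  "scaleC_prod c p = (c *\<^sub>C fst p, c *\<^sub>C snd p)"
instance
  by standard (simp_all add: scaleC_prod_def prod_eq_iff scaleC_add_right scaleC_add_left)
end

instantiation prod :: (complex_algebra_1, complex_algebra_1) complex_algebra_1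
begin
definition one_prod :: "'a \<times> 'b" where "one_prod = (1, 1)"
definition times_prod :: "'a \<times> 'b \<Rightarrow> 'a \<times> 'b \<Rightarrow> 'a \<times> 'b" where
  "times_prod p q = (fst p * fst q, snd p * snd q)"
instance
  by standard (simp_all add: one_prod_def times_prod_def scaleC_prod_def prod_eq_iff algebra_simps)
end

instantiation poly_mapping :: (type, complex_vector) complex_vector
begin
lift_definition scaleC_poly_mapping :: "complex \<Rightarrow> ('a \<Rightarrow>\<^sub>0 'b) \<Rightarrow> 'a \<Rightarrow>\<^sub>0 'b"
  is "\<lambda>c f k. c *\<^sub>C f k"
  by (erule rev_finite_subset) auto
instance
  by standard (transfer; simp add: fun_eq_iff scaleC_add_right scaleC_add_left)+
end


section \<open>The algebraic tensor product\<close>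

inductive_set tensor_relations :: "(('a::complex_vector \<times> 'b::complex_vector) \<Rightarrow>\<^sub>0 complex) set" where
  add_left: "Poly_Mapping.single (a + a', b) 1 - (Poly_Mapping.single (a, b) 1 + Poly_Mapping.single (a', b) 1) \<in> tensor_relations"
| add_right: "Poly_Mapping.single (a, b + b') 1 - (Poly_Mapping.single (a, b) 1 + Poly_Mapping.single (a, b') 1) \<in> tensor_relations"
| scale_left: "Poly_Mapping.single (c *\<^sub>C a, b) 1 - c *\<^sub>C Poly_Mapping.single (a, b) 1 \<in> tensor_relations"
| scale_right: "Poly_Mapping.single (a, c *\<^sub>C b) 1 - c *\<^sub>C Poly_Mapping.single (a, b) 1 \<in> tensor_relations"

definition tensor_eq :: "(('a::complex_vector \<times> 'b::complex_vector) \<Rightarrow>\<^sub>0 complex) \<Rightarrow> (('a \<times> 'b) \<Rightarrow>\<^sub>0 complex) \<Rightarrow> bool" where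
  "tensor_eq x y \<longleftrightarrow> x - y \<in> cspan tensor_relations"

lemma equivp_tensor_eq: "equivp (tensor_eq :: (('a::complex_vector \<times> 'b::complex_vector) \<Rightarrow>\<^sub>0 complex) \<Rightarrow> _)"
proof (rule equivpI)
  show "reflp (tensor_eq :: (('a \<times> 'b) \<Rightarrow>\<^sub>0 complex) \<Rightarrow> _)"
    by (auto simp: reflp_def tensor_eq_def complex_vector.span_zero)
  show "symp (tensor_eq :: (('a \<times> 'b) \<Rightarrow>\<^sub>0 complex) \<Rightarrow> _)"
  proof (rule sympI)
    fix x y :: "('a \<times> 'b) \<Rightarrow>\<^sub>0 complex"
    assume "tensor_eq x y"
    then have "- (x - y) \<in> cspan tensor_relations"
      unfolding tensor_eq_def by (rule complex_vector.span_neg)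
    then show "tensor_eq y x" by (simp add: tensor_eq_def)
  qed
  show "transp (tensor_eq :: (('a \<times> 'b) \<Rightarrow>\<^sub>0 complex) \<Rightarrow> _)"
  proof (rule transpI)
    fix x y z :: "('a \<times> 'b) \<Rightarrow>\<^sub>0 complex"
    assume "tensor_eq x y" "tensor_eq y z"
    then show "tensor_eq x z"
      using complex_vector.span_add[of "x - y" tensor_relations "y - z"] by (simp add: tensor_eq_def)
  qed
qed

quotient_type (overloaded) ('a, 'b) tensor =
  "('a::complex_vector \<times> 'b::complex_vector) \<Rightarrow>\<^sub>0 complex" / tensor_eq
  by (rule equivp_tensor_eq)

lemma tensor_eq_add: "tensor_eq x x' \<Longrightarrow> tensor_eq y y' \<Longrightarrow> tensor_eq (x + y) (x' + y')"
  unfolding tensor_eq_def add_diff_add by (rule complex_vector.span_add)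

lemma tensor_eq_uminus: "tensor_eq x x' \<Longrightarrow> tensor_eq (- x) (- x')"
  using complex_vector.span_neg[of "x - x'" tensor_relations] by (simp add: tensor_eq_def)

lemma tensor_eq_scaleC: "tensor_eq x x' \<Longrightarrow> tensor_eq (c *\<^sub>C x) (c *\<^sub>C x')"
  unfolding tensor_eq_def complex_vector.scale_right_diff_distrib[symmetric]
  by (rule complex_vector.span_scale)

lemma tensor_eq_refl: "x = y \<Longrightarrow> tensor_eq x y"
  by (simp add: tensor_eq_def complex_vector.span_zero)

instantiation tensor :: (complex_vector, complex_vector) complex_vector
begin
lift_definition zero_tensor :: "('a, 'b) tensor" is 0 .
lift_definition plus_tensor :: "('a, 'b) tensor \<Rightarrow> ('a, 'b) tensor \<Rightarrow> ('a, 'b) tensor" is "(+)"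
  by (rule tensor_eq_add)
lift_definition uminus_tensor :: "('a, 'b) tensor \<Rightarrow> ('a, 'b) tensor" is uminus
  by (rule tensor_eq_uminus)
definition minus_tensor :: "('a, 'b) tensor \<Rightarrow> ('a, 'b) tensor \<Rightarrow> ('a, 'b) tensor" where
  "minus_tensor s t = s + (- t)"
lift_definition scaleC_tensor :: "complex \<Rightarrow> ('a, 'b) tensor \<Rightarrow> ('a, 'b) tensor" is scaleC
  by (rule tensor_eq_scaleC)
instance
proof
  fix a b c :: "('a, 'b) tensor" and r s :: complex
  show "a + b + c = a + (b + c)" by transfer (rule tensor_eq_refl, rule add.assoc)
  show "a + b = b + a" by transfer (rule tensor_eq_refl, rule add.commute)
  show "0 + a = a" by transfer (rule tensor_eq_refl, rule add_0)
  show "- a + a = 0" by transfer (rule tensor_eq_refl, rule left_minus)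
  show "a - b = a + - b" by (rule minus_tensor_def)
  show "r *\<^sub>C (a + b) = r *\<^sub>C a + r *\<^sub>C b" by transfer (rule tensor_eq_refl, rule scaleC_add_right)
  show "(r + s) *\<^sub>C a = r *\<^sub>C a + s *\<^sub>C a" by transfer (rule tensor_eq_refl, rule scaleC_add_left)
  show "r *\<^sub>C s *\<^sub>C a = (r * s) *\<^sub>C a" by transfer (rule tensor_eq_refl, rule scaleC_scaleC)
  show "1 *\<^sub>C a = a" by transfer (rule tensor_eq_refl, rule scaleC_one)
qed
end

lift_definition tensor :: "'a::complex_vector \<Rightarrow> 'b::complex_vector \<Rightarrow> ('a, 'b) tensor"  (infixr \<open>\<otimes>\<close> 73)
  is "\<lambda>a b. Poly_Mapping.single (a, b) 1" .

definition bilinear_C :: "('a::complex_vector \<Rightarrow> 'b::complex_vector \<Rightarrow> 'c::complex_vector) \<Rightarrow> bool" where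
  "bilinear_C f \<longleftrightarrow> (\<forall>b. clinear_on UNIV (\<lambda>a. f a b)) \<and> (\<forall>a. clinear_on UNIV (f a))"

definition tensor_set :: "'a::complex_vector set \<Rightarrow> 'b::complex_vector set \<Rightarrow> ('a, 'b) tensor set"  (infixr \<open>\<otimes>\<^sub>s\<close> 73) where
  "U \<otimes>\<^sub>s V = cspan {u \<otimes> v | u v. u \<in> U \<and> v \<in> V}"

text \<open>
  The universal property for subspaces \<open>U\<close>, \<open>V\<close>: if \<open>f\<close> is bilinear on \<open>U \<times> V\<close> (conjugate-bilinear is
  also fine), \<open>tensor_lift_on U V f\<close> is the map \<open>U \<otimes> V \<rightarrow> W\<close> with \<open>u \<otimes> v \<mapsto> f u v\<close>. It says nothing
  outside \<open>U \<otimes>\<^sub>s V\<close>, and \<open>f\<close> need not be linear outside \<open>U\<close>, \<open>V\<close>.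
\<close>
definition tensor_lift_on :: "'a::complex_vector set \<Rightarrow> 'b::complex_vector set \<Rightarrow>
    ('a \<Rightarrow> 'b \<Rightarrow> 'c::complex_vector) \<Rightarrow> ('a, 'b) tensor \<Rightarrow> 'c" where
  "tensor_lift_on U V f t = (THE y. \<exists>xs. set xs \<subseteq> U \<times> V \<and>
     t = (\<Sum>(u, v)\<leftarrow>xs. u \<otimes> v) \<and> y = (\<Sum>(u, v)\<leftarrow>xs. f u v))"

abbreviation tensor_lift :: "('a::complex_vector \<Rightarrow> 'b::complex_vector \<Rightarrow> 'c::complex_vector) \<Rightarrow> ('a, 'b) tensor \<Rightarrow> 'c" where
  "tensor_lift \<equiv> tensor_lift_on UNIV UNIV"

definition tensor_map_on :: "'a::complex_vector set \<Rightarrow> 'b::complex_vector set \<Rightarrow>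
    ('a \<Rightarrow> 'c::complex_vector) \<Rightarrow> ('b \<Rightarrow> 'd::complex_vector) \<Rightarrow> ('a, 'b) tensor \<Rightarrow> ('c, 'd) tensor" where
  "tensor_map_on U V f g = tensor_lift_on U V (\<lambda>u v. f u \<otimes> g v)"

abbreviation tensor_map :: "('a::complex_vector \<Rightarrow> 'c::complex_vector) \<Rightarrow> ('b::complex_vector \<Rightarrow> 'd::complex_vector) \<Rightarrow>
    ('a, 'b) tensor \<Rightarrow> ('c, 'd) tensor" where
  "tensor_map \<equiv> tensor_map_on UNIV UNIV"

definition tensor_flip :: "('a::complex_vector, 'b::complex_vector) tensor \<Rightarrow> ('b, 'a) tensor" where
  "tensor_flip = tensor_lift (\<lambda>a b. b \<otimes> a)"

definition tensor_assoc :: "('a::complex_vector, ('b::complex_vector, 'c::complex_vector) tensor) tensor \<Rightarrow> (('a, 'b) tensor, 'c) tensor" where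
  "tensor_assoc = tensor_lift (\<lambda>a. tensor_lift (\<lambda>b c. (a \<otimes> b) \<otimes> c))"

lemma tensor_add_left: "(a + a') \<otimes> b = a \<otimes> b + a' \<otimes> b"
  by transfer (unfold tensor_eq_def, rule complex_vector.span_base, rule tensor_relations.intros)

lemma tensor_add_right: "a \<otimes> (b + b') = a \<otimes> b + a \<otimes> b'"
  by transfer (unfold tensor_eq_def, rule complex_vector.span_base, rule tensor_relations.intros)

lemma tensor_scaleC_left: "(c *\<^sub>C a) \<otimes> b = c *\<^sub>C (a \<otimes> b)"
  by transfer (unfold tensor_eq_def, rule complex_vector.span_base, rule tensor_relations.intros)

lemma tensor_scaleC_right: "a \<otimes> (c *\<^sub>C b) = c *\<^sub>C (a \<otimes> b)"
  by transfer (unfold tensor_eq_def, rule complex_vector.span_base, rule tensor_relations.intros)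

lemma tensor_zero_left [simp]: "0 \<otimes> b = 0"
  using tensor_scaleC_left[of 0 0 b] by simp

lemma tensor_zero_right [simp]: "a \<otimes> 0 = 0"
  using tensor_scaleC_right[of a 0 0] by simp

lemma tensor_induct [case_names pure add]:
  assumes pure: "\<And>a b. P (a \<otimes> b)" and add: "\<And>s t. P s \<Longrightarrow> P t \<Longrightarrow> P (s + t)"
  shows "P t"
proof -
  have single: "abs_tensor (Poly_Mapping.single k c) = (c *\<^sub>C fst k) \<otimes> snd k" for k :: "'a \<times> 'b" and c
  proof -
    have "c *\<^sub>C Poly_Mapping.single k 1 = Poly_Mapping.single k c"
      by transfer (auto simp: scaleC_complex_def fun_eq_iff when_def)
    then show ?thesis
      by (metis prod.collapse scaleC_tensor.abs_eq tensor.abs_eq tensor_scaleC_left)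
  qed
  have "P (abs_tensor x)" for x :: "('a \<times> 'b) \<Rightarrow>\<^sub>0 complex"
  proof -
    have "\<forall>x. Poly_Mapping.keys x \<subseteq> K \<longrightarrow> P (abs_tensor x)" if "finite K" for K :: "('a \<times> 'b) set"
      using that
    proof (induction K rule: finite_induct)
      case empty
      have "abs_tensor (0 :: ('a \<times> 'b) \<Rightarrow>\<^sub>0 complex) = 0 \<otimes> 0"
        by (simp add: zero_tensor_def)
      then show ?case by (metis keys_eq_empty pure subset_empty)
    next
      case (insert k K)
      show ?case
      proof (intro allI impI)
        fix x :: "('a \<times> 'b) \<Rightarrow>\<^sub>0 complex"
        assume x: "Poly_Mapping.keys x \<subseteq> insert k K"
        let ?s = "Poly_Mapping.single k (Poly_Mapping.lookup x k)"
        have "Poly_Mapping.keys (x - ?s) \<subseteq> K"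
          using x by (auto simp: in_keys_iff lookup_minus lookup_single when_def split: if_splits)
        with insert.IH have "P (abs_tensor (x - ?s))" by blast
        moreover have "P (abs_tensor ?s)" by (simp add: single pure)
        ultimately have "P (abs_tensor (x - ?s) + abs_tensor ?s)" by (rule add)
        then show "P (abs_tensor x)" by (simp add: plus_tensor.abs_eq)
      qed
    qed
    then show ?thesis using finite_keys by blast
  qed
  then show ?thesis by (metis tensor.abs_induct)
qed

text \<open>The extension of \<open>f\<close> to the free vector space; auxiliary.\<close>

definition free_lift :: "('a \<Rightarrow> 'b \<Rightarrow> 'c::complex_vector) \<Rightarrow> (('a \<times> 'b) \<Rightarrow>\<^sub>0 complex) \<Rightarrow> 'c" where
  "free_lift f x = (\<Sum>k\<in>Poly_Mapping.keys x. Poly_Mapping.lookup x k *\<^sub>C f (fst k) (snd k))"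

lemma free_lift_superset:
  assumes "finite K" "Poly_Mapping.keys x \<subseteq> K"
  shows "free_lift f x = (\<Sum>k\<in>K. Poly_Mapping.lookup x k *\<^sub>C f (fst k) (snd k))"
  unfolding free_lift_def using assms
  by (intro sum.mono_neutral_left) (auto simp: in_keys_iff)

lemma free_lift_add: "free_lift f (x + y) = free_lift f x + free_lift f y"
proof -
  let ?K = "Poly_Mapping.keys x \<union> Poly_Mapping.keys y"
  have "Poly_Mapping.keys (x + y) \<subseteq> ?K" by (rule Poly_Mapping.keys_add)
  then show ?thesis
    by (simp add: free_lift_superset[of ?K] lookup_add scaleC_add_left sum.distrib)
qed

lemma lookup_scaleC [simp]: "Poly_Mapping.lookup (c *\<^sub>C x) k = c *\<^sub>C Poly_Mapping.lookup x k"
  by transfer simp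

lemma free_lift_scaleC: "free_lift f (c *\<^sub>C x) = c *\<^sub>C free_lift f x"
proof -
  have "Poly_Mapping.keys (c *\<^sub>C x) \<subseteq> Poly_Mapping.keys x"
    by (auto simp: in_keys_iff scaleC_complex_def)
  then show ?thesis
    by (simp add: free_lift_superset[of "Poly_Mapping.keys x"] scaleC_complex_def
        complex_vector.scale_sum_right)
qed

lemma free_lift_diff: "free_lift f (x - y) = free_lift f x - free_lift f y"
  using free_lift_add[of f "x - y" y] by simp

lemma free_lift_single [simp]: "free_lift f (Poly_Mapping.single (a, b) 1) = f a b"
  by (simp add: free_lift_def)

lemma free_lift_relation:
  assumes f: "bilinear_C f" and x: "x \<in> cspan tensor_relations"
  shows "free_lift f x = 0"
  using x
proof (induction rule: complex_vector.span_induct_alt)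
  case base
  show ?case by (simp add: free_lift_def)
next
  case (step c r y)
  from step(1) have "free_lift f r = 0"
    by cases (use f in \<open>simp_all add: free_lift_diff free_lift_add free_lift_scaleC bilinear_C_def clinear_on_def\<close>)
  with step(2) show ?case by (simp add: free_lift_add free_lift_scaleC)
qed

lemma tensor_lift_eqI:
  assumes "set xs \<subseteq> U \<times> V" and "t = (\<Sum>(u, v)\<leftarrow>xs. u \<otimes> v)"
    and "\<And>ys. set ys \<subseteq> U \<times> V \<Longrightarrow> t = (\<Sum>(u, v)\<leftarrow>ys. u \<otimes> v) \<Longrightarrow> (\<Sum>(u, v)\<leftarrow>ys. f u v) = L"
  shows "tensor_lift_on U V f t = L"
  unfolding tensor_lift_on_def using assms by (intro the_equality) metis+

lemma tensor_lift_eq_free_lift: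
  assumes f: "bilinear_C f"
  shows "tensor_lift f t = free_lift f (rep_tensor t)"
proof -
  have rep: "free_lift f (rep_tensor (abs_tensor x)) = free_lift f x" for x
  proof -
    have "tensor_eq (rep_tensor (abs_tensor x)) x"
      by (metis Quotient3_rep_abs Quotient3_tensor tensor_eq_refl)
    then show ?thesis
      using free_lift_relation[OF f, of "rep_tensor (abs_tensor x) - x"]
      by (simp add: tensor_eq_def free_lift_diff)
  qed
  have abs: "(\<Sum>(u, v)\<leftarrow>xs. u \<otimes> v) = abs_tensor (\<Sum>k\<leftarrow>xs. Poly_Mapping.single k 1)" for xs :: "('a \<times> 'b) list"
    by (induction xs) (auto simp: zero_tensor_def tensor.abs_eq plus_tensor.abs_eq)
  have lft: "free_lift f (\<Sum>k\<leftarrow>xs. Poly_Mapping.single k 1) = (\<Sum>(u, v)\<leftarrow>xs. f u v)" for xs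
    by (induction xs) (auto simp: free_lift_add, simp add: free_lift_def)
  have "\<exists>xs. t = (\<Sum>(u, v)\<leftarrow>xs. u \<otimes> v)"
  proof (induction t rule: tensor_induct)
    case (pure a b)
    show ?case by (rule exI[of _ "[(a, b)]"]) simp
  next
    case (add s t)
    then obtain xs ys where "s = (\<Sum>(u, v)\<leftarrow>xs. u \<otimes> v)" "t = (\<Sum>(u, v)\<leftarrow>ys. u \<otimes> v)" by blast
    then show ?case by (intro exI[of _ "xs @ ys"]) simp
  qed
  then obtain xs where "t = (\<Sum>(u, v)\<leftarrow>xs. u \<otimes> v)" by blast
  moreover have "(\<Sum>(u, v)\<leftarrow>ys. f u v) = free_lift f (rep_tensor t)" if "t = (\<Sum>(u, v)\<leftarrow>ys. u \<otimes> v)" for ys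
    unfolding that abs rep lft ..
  ultimately show ?thesis
    by (intro tensor_lift_eqI[of xs]) auto
qed

lemma tensor_lift_add: "bilinear_C f \<Longrightarrow> tensor_lift f (s + t) = tensor_lift f s + tensor_lift f t"
  and tensor_lift_scaleC: "bilinear_C f \<Longrightarrow> tensor_lift f (c *\<^sub>C t) = c *\<^sub>C tensor_lift f t"
  and tensor_lift_pure: "bilinear_C f \<Longrightarrow> tensor_lift f (a \<otimes> b) = f a b"
proof -
  assume f: "bilinear_C f"
  have rep: "free_lift f (rep_tensor (abs_tensor x)) = free_lift f x" for x
    using free_lift_relation[OF f, of "rep_tensor (abs_tensor x) - x"]
      Quotient3_rep_abs[OF Quotient3_tensor, of x]
    by (simp add: tensor_eq_def free_lift_diff complex_vector.span_zero)
  have abs: "abs_tensor (rep_tensor s) = s" for s :: "('a, 'b) tensor"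
    by (rule Quotient3_abs_rep[OF Quotient3_tensor])
  show "tensor_lift f (s + t) = tensor_lift f s + tensor_lift f t"
    using rep[of "rep_tensor s + rep_tensor t"]
    by (simp add: tensor_lift_eq_free_lift[OF f] plus_tensor.abs_eq[symmetric] abs free_lift_add)
  show "tensor_lift f (c *\<^sub>C t) = c *\<^sub>C tensor_lift f t"
    using rep[of "c *\<^sub>C rep_tensor t"]
    by (simp add: tensor_lift_eq_free_lift[OF f] scaleC_tensor.abs_eq[symmetric] abs free_lift_scaleC)
  show "tensor_lift f (a \<otimes> b) = f a b"
    by (simp add: tensor_lift_eq_free_lift[OF f] tensor.abs_eq rep)
qed

lemma subspace_projection:
  assumes "csubspace (U :: 'a::complex_vector set)"
  obtains p where "range p \<subseteq> U" "clinear_on UNIV p" "\<And>u. u \<in> U \<Longrightarrow> p u = u"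
proof -
  interpret vp: vector_space_pair "scaleC :: complex \<Rightarrow> 'a \<Rightarrow> 'a" "scaleC :: complex \<Rightarrow> 'a \<Rightarrow> 'a" ..
  have "Vector_Spaces.linear scaleC scaleC (\<lambda>x::'a. x)" by (rule complex_vector.linear_ident)
  from vp.linear_exists_left_inverse_on[OF this assms[unfolded csubspace_raw_def]]
  obtain g where "range g \<subseteq> U" "Vector_Spaces.linear scaleC scaleC g" "\<forall>v\<in>U. g v = v"
    by auto
  then show thesis
    by (intro that[of g]) (auto simp: clinear_on_def Vector_Spaces.linear_iff)
qed

lemma tensor_set_sum_list:
  assumes "csubspace U" "t \<in> U \<otimes>\<^sub>s V"
  shows "\<exists>xs. set xs \<subseteq> U \<times> V \<and> t = (\<Sum>(u, v)\<leftarrow>xs. u \<otimes> v)"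
  using assms(2) unfolding tensor_set_def
proof (induction rule: complex_vector.span_induct_alt)
  case base
  show ?case by (rule exI[of _ "[]"]) simp
next
  case (step c x y)
  then obtain u v xs where "u \<in> U" "v \<in> V" "x = u \<otimes> v" "set xs \<subseteq> U \<times> V" "y = (\<Sum>(u, v)\<leftarrow>xs. u \<otimes> v)"
    by blast
  moreover have "c *\<^sub>C u \<in> U" using assms(1) \<open>u \<in> U\<close> by (rule complex_vector.subspace_scale)
  ultimately show ?case
    by (intro exI[of _ "(c *\<^sub>C u, v) # xs"]) (simp add: tensor_scaleC_left)
qed

text \<open>On \<open>U \<otimes>\<^sub>s V\<close>, \<open>tensor_lift_on U V f\<close> is the restriction of a linear map on the whole tensor product.\<close>

lemma tensor_lift_on_extension:
  assumes U: "csubspace U" and V: "csubspace V"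
    and f: "\<And>v. v \<in> V \<Longrightarrow> clinear_on U (\<lambda>u. f u v)" "\<And>u. u \<in> U \<Longrightarrow> clinear_on V (f u)"
  obtains g where "bilinear_C g" "\<And>u v. u \<in> U \<Longrightarrow> v \<in> V \<Longrightarrow> g u v = f u v"
    "\<And>t. t \<in> U \<otimes>\<^sub>s V \<Longrightarrow> tensor_lift_on U V f t = tensor_lift g t"
proof -
  obtain p where p: "range p \<subseteq> U" "clinear_on UNIV p" "\<And>u. u \<in> U \<Longrightarrow> p u = u"
    using subspace_projection[OF U] by metis
  obtain q where q: "range q \<subseteq> V" "clinear_on UNIV q" "\<And>v. v \<in> V \<Longrightarrow> q v = v"
    using subspace_projection[OF V] by metis
  define g where "g u v = f (p u) (q v)" for u v
  have mem: "p u \<in> U" "q v \<in> V" for u v using p(1) q(1) by auto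
  have g: "bilinear_C g"
    using p(2) q(2) f mem by (auto simp: bilinear_C_def g_def clinear_on_def)
  have eq: "g u v = f u v" if "u \<in> U" "v \<in> V" for u v
    using that by (simp add: g_def p q)
  have lift: "(\<Sum>(u, v)\<leftarrow>xs. f u v) = tensor_lift g (\<Sum>(u, v)\<leftarrow>xs. u \<otimes> v)" if "set xs \<subseteq> U \<times> V" for xs
    using that
  proof (induction xs)
    case Nil
    show ?case using tensor_lift_scaleC[OF g, of 0 0] by simp
  next
    case (Cons x xs)
    then show ?case by (auto simp: tensor_lift_add[OF g] tensor_lift_pure[OF g] eq)
  qed
  show thesis
  proof (rule that[of g])
    fix t assume "t \<in> U \<otimes>\<^sub>s V"
    then obtain xs where xs: "set xs \<subseteq> U \<times> V" "t = (\<Sum>(u, v)\<leftarrow>xs. u \<otimes> v)"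
      using tensor_set_sum_list[OF U] by blast
    then show "tensor_lift_on U V f t = tensor_lift g t"
      using lift by (intro tensor_lift_eqI[of xs]) auto
  qed (use g eq in auto)
qed

lemma bilinear_C_tensor_mult:
  fixes a :: "'a::complex_algebra_1" and b :: "'b::complex_algebra_1"
  shows "bilinear_C (\<lambda>a' b'. (a * a') \<otimes> (b * b'))"
  by (simp add: bilinear_C_def clinear_on_def distrib_left tensor_add_left tensor_add_right
      tensor_scaleC_left tensor_scaleC_right)

instantiation tensor :: (complex_algebra_1, complex_algebra_1) complex_algebra_1
begin

definition one_tensor :: "('a, 'b) tensor" where "one_tensor = 1 \<otimes> 1"

definition times_tensor :: "('a, 'b) tensor \<Rightarrow> ('a, 'b) tensor \<Rightarrow> ('a, 'b) tensor" where
  "times_tensor s t = tensor_lift (\<lambda>a b. tensor_lift (\<lambda>a' b'. (a * a') \<otimes> (b * b')) t) s"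

instance
proof
  fix r s t :: "('a, 'b) tensor" and c :: complex
  note lift_inner = tensor_lift_add[OF bilinear_C_tensor_mult] tensor_lift_scaleC[OF bilinear_C_tensor_mult]
    tensor_lift_pure[OF bilinear_C_tensor_mult]
  have bil: "bilinear_C (\<lambda>a b. tensor_lift (\<lambda>a' b'. (a * a') \<otimes> (b * b')) t)" for t :: "('a, 'b) tensor"
  proof (induction t rule: tensor_induct)
    case (pure a b)
    show ?case
      by (simp add: lift_inner bilinear_C_def clinear_on_def distrib_right tensor_add_left tensor_add_right
          tensor_scaleC_left tensor_scaleC_right)
  next
    case (add s t)
    then show ?case
      by (simp add: lift_inner bilinear_C_def clinear_on_def scaleC_add_right)
  qed
  have tmul: "(a \<otimes> b) * (a' \<otimes> b') = (a * a') \<otimes> (b * b')" for a a' :: 'a and b b' :: 'b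
    unfolding times_tensor_def tensor_lift_pure[OF bil] by (simp add: lift_inner)
  show dr: "(r + s) * t = r * t + s * t" for r s t :: "('a, 'b) tensor"
    by (simp add: times_tensor_def tensor_lift_add[OF bil])
  have al: "tensor_lift (\<lambda>a b. f a b + g a b) r = tensor_lift f r + tensor_lift g r"
    if "bilinear_C f" "bilinear_C g" for f g :: "'a \<Rightarrow> 'b \<Rightarrow> ('a, 'b) tensor" and r
  proof -
    have fg: "bilinear_C (\<lambda>a b. f a b + g a b)"
      using that by (simp add: bilinear_C_def clinear_on_def scaleC_add_right)
    show ?thesis
      by (induction r rule: tensor_induct)
        (simp_all add: tensor_lift_pure tensor_lift_add fg that algebra_simps)
  qed
  show dl: "r * (s + t) = r * s + r * t" for r s t :: "('a, 'b) tensor"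
    by (simp add: times_tensor_def lift_inner al[OF bil bil])
  show "(c *\<^sub>C s) * t = c *\<^sub>C (s * t)"
    by (simp add: times_tensor_def tensor_lift_scaleC[OF bil])
  show "s * (c *\<^sub>C t) = c *\<^sub>C (s * t)"
  proof (induction s rule: tensor_induct)
    case (pure a b)
    show ?case unfolding times_tensor_def tensor_lift_pure[OF bil] by (simp add: lift_inner)
  next
    case (add s s')
    then show ?case by (simp add: dr scaleC_add_right)
  qed
  show "r * s * t = r * (s * t)"
  proof (induction r rule: tensor_induct)
    case (pure a b)
    show ?case
    proof (induction s rule: tensor_induct)
      case (pure a' b')
      show ?case
        by (induction t rule: tensor_induct) (simp_all only: tmul mult.assoc dl)
    qed (simp add: dl dr)
  qed (simp add: dr)
  show "1 * t = t"
    by (induction t rule: tensor_induct) (simp_all add: one_tensor_def tmul dl)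
  show "t * 1 = t"
    by (induction t rule: tensor_induct) (simp_all add: one_tensor_def tmul dr)
qed

end


instantiation tensor :: ("{complex_vector, star}", "{complex_vector, star}") star
begin
definition star_tensor :: "('a, 'b) tensor \<Rightarrow> ('a, 'b) tensor" where
  "star_tensor = tensor_lift (\<lambda>a b. star a \<otimes> star b)"
instance ..
end


section \<open>Coalgebras, Hopf *-algebras and quotients\<close>

definition coalgebra :: "'c::complex_vector set \<Rightarrow> ('c \<Rightarrow> ('c, 'c) tensor) \<Rightarrow> ('c \<Rightarrow> complex) \<Rightarrow> bool" where
  "coalgebra K \<delta> \<epsilon> \<longleftrightarrow> csubspace K \<and> clinear_on K \<delta> \<and> \<delta> ` K \<subseteq> K \<otimes>\<^sub>s K \<and> clinear_on K \<epsilon> \<and>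
     (\<forall>x\<in>K. tensor_map_on K K \<delta> id (\<delta> x) = tensor_assoc (tensor_map_on K K id \<delta> (\<delta> x))) \<and>
     (\<forall>x\<in>K. tensor_lift_on K K (\<lambda>y z. \<epsilon> y *\<^sub>C z) (\<delta> x) = x) \<and>
     (\<forall>x\<in>K. tensor_lift_on K K (\<lambda>y z. \<epsilon> z *\<^sub>C y) (\<delta> x) = x)"

definition group_like :: "('c::complex_vector \<Rightarrow> ('c, 'c) tensor) \<Rightarrow> ('c \<Rightarrow> complex) \<Rightarrow> 'c \<Rightarrow> bool" where
  "group_like \<delta> \<epsilon> e \<longleftrightarrow> \<delta> e = e \<otimes> e \<and> \<epsilon> e = 1"

definition hopf_star_algebra :: "'a::cstar_algebra set \<Rightarrow> ('a \<Rightarrow> ('a, 'a) tensor) \<Rightarrow> ('a \<Rightarrow> complex) \<Rightarrow> ('a \<Rightarrow> 'a) \<Rightarrow> bool" where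
  "hopf_star_algebra H \<Delta> \<epsilon> S \<longleftrightarrow> subalgebra H \<and> star ` H \<subseteq> H \<and> coalgebra H \<Delta> \<epsilon> \<and>
     \<Delta> 1 = 1 \<and> (\<forall>x\<in>H. \<forall>y\<in>H. \<Delta> (x * y) = \<Delta> x * \<Delta> y) \<and> (\<forall>x\<in>H. \<Delta> (star x) = star (\<Delta> x)) \<and>
     \<epsilon> 1 = 1 \<and> (\<forall>x\<in>H. \<forall>y\<in>H. \<epsilon> (x * y) = \<epsilon> x * \<epsilon> y) \<and>
     clinear_on H S \<and> S ` H \<subseteq> H \<and>
     (\<forall>x\<in>H. tensor_lift_on H H (\<lambda>y z. S y * z) (\<Delta> x) = \<epsilon> x *\<^sub>C 1) \<and>
     (\<forall>x\<in>H. tensor_lift_on H H (\<lambda>y z. y * S z) (\<Delta> x) = \<epsilon> x *\<^sub>C 1)"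

definition coideal_right_ideal :: "'a::complex_algebra_1 set \<Rightarrow> ('a \<Rightarrow> ('a, 'a) tensor) \<Rightarrow> ('a \<Rightarrow> complex) \<Rightarrow> 'a set \<Rightarrow> bool" where
  "coideal_right_ideal H \<Delta> \<epsilon> J \<longleftrightarrow> J \<subseteq> H \<and> csubspace J \<and> (\<forall>x\<in>J. \<forall>h\<in>H. x * h \<in> J) \<and>
     \<Delta> ` J \<subseteq> {s + t | s t. s \<in> J \<otimes>\<^sub>s H \<and> t \<in> H \<otimes>\<^sub>s J} \<and> (\<forall>x\<in>J. \<epsilon> x = 0)"

text \<open>
  A quotient space \<open>H/J\<close> is presented as a type \<open>'c\<close> with a linear surjection \<open>\<pi>\<close> from \<open>H\<close> with
  kernel \<open>J\<close>. This determines \<open>('c, \<pi>)\<close> up to unique isomorphism.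
\<close>
definition quotient_space_map :: "'a::complex_vector set \<Rightarrow> 'a set \<Rightarrow> ('a \<Rightarrow> 'c::complex_vector) \<Rightarrow> bool" where
  "quotient_space_map H J \<pi> \<longleftrightarrow> clinear_on H \<pi> \<and> \<pi> ` H = UNIV \<and> {h\<in>H. \<pi> h = 0} = J"

definition quotient_comult :: "'a::complex_vector set \<Rightarrow> ('a \<Rightarrow> ('a, 'a) tensor) \<Rightarrow> ('a \<Rightarrow> 'c::complex_vector) \<Rightarrow> 'c \<Rightarrow> ('c, 'c) tensor" where
  "quotient_comult H \<Delta> \<pi> c = tensor_map_on H H \<pi> \<pi> (\<Delta> (inv_into H \<pi> c))"

definition quotient_counit :: "'a::complex_vector set \<Rightarrow> ('a \<Rightarrow> complex) \<Rightarrow> ('a \<Rightarrow> 'c::complex_vector) \<Rightarrow> 'c \<Rightarrow> complex" where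
  "quotient_counit H \<epsilon> \<pi> c = \<epsilon> (inv_into H \<pi> c)"

definition bicolinear_unital_splitting ::
    "'a::complex_algebra_1 set \<Rightarrow> ('a \<Rightarrow> ('a, 'a) tensor) \<Rightarrow> ('a \<Rightarrow> 'c::complex_vector) \<Rightarrow> ('c \<Rightarrow> 'a) \<Rightarrow> bool" where
  "bicolinear_unital_splitting H \<Delta> \<pi> i \<longleftrightarrow> clinear_on UNIV i \<and> range i \<subseteq> H \<and>
     (\<forall>c. \<pi> (i c) = c) \<and> i (\<pi> 1) = 1 \<and>
     (\<forall>c. tensor_map_on H H id \<pi> (\<Delta> (i c)) = tensor_map i id (quotient_comult H \<Delta> \<pi> c)) \<and>
     (\<forall>c. tensor_map_on H H \<pi> id (\<Delta> (i c)) = tensor_map id i (quotient_comult H \<Delta> \<pi> c))"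


section \<open>Compact quantum groups\<close>

definition cstar_norm :: "(('a::cstar_algebra, 'b::cstar_algebra) tensor \<Rightarrow> real) \<Rightarrow> bool" where
  "cstar_norm N \<longleftrightarrow> (\<forall>t. N t \<ge> 0 \<and> (N t = 0 \<longleftrightarrow> t = 0)) \<and> (\<forall>s t. N (s + t) \<le> N s + N t) \<and>
     (\<forall>c t. N (c *\<^sub>C t) = cmod c * N t) \<and> (\<forall>s t. N (s * t) \<le> N s * N t) \<and>
     (\<forall>t. N (star t * t) = (N t)\<^sup>2)"

text \<open>The least C*-norm on the algebraic tensor product (Takesaki: it exists, and is the spatial norm).\<close>

definition minimal_norm :: "('a::cstar_algebra, 'b::cstar_algebra) tensor \<Rightarrow> real" where
  "minimal_norm t = (INF N\<in>Collect cstar_norm. N t)"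

text \<open>\<open>j\<close> exhibits the C*-algebra \<open>'t\<close> as the completion of the algebraic tensor product in the minimal norm.\<close>

definition minimal_tensor_product :: "(('a::cstar_algebra, 'b::cstar_algebra) tensor \<Rightarrow> 't::cstar_algebra) \<Rightarrow> bool" where
  "minimal_tensor_product j \<longleftrightarrow> clinear_on UNIV j \<and> (\<forall>s t. j (s * t) = j s * j t) \<and>
     (\<forall>t. j (star t) = star (j t)) \<and> (\<forall>t. norm (j t) = minimal_norm t) \<and> closure (range j) = UNIV"

text \<open>
  Woronowicz's definition. The minimal tensor square and cube of \<open>'a\<close> are the types \<open>'t\<close> and \<open>'u\<close>;
  \<open>jl\<close> and \<open>jr\<close> are the two bracketings of the cube. \<open>F\<close> and \<open>G\<close> are the (unique) extensions
  \<open>\<Phi> \<otimes> id\<close> and \<open>id \<otimes> \<Phi>\<close> to the completed tensor square.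
\<close>
definition compact_quantum_group ::
    "(('a::cstar_algebra, 'a) tensor \<Rightarrow> 't::cstar_algebra) \<Rightarrow> (('t, 'a) tensor \<Rightarrow> 'u::cstar_algebra) \<Rightarrow>
     (('a, 't) tensor \<Rightarrow> 'u) \<Rightarrow> ('a \<Rightarrow> 't) \<Rightarrow> bool" where
  "compact_quantum_group j jl jr \<Phi> \<longleftrightarrow>
     minimal_tensor_product j \<and> minimal_tensor_product jl \<and> minimal_tensor_product jr \<and>
     (\<forall>a b c. jl (j (a \<otimes> b) \<otimes> c) = jr (a \<otimes> j (b \<otimes> c))) \<and>
     star_hom \<Phi> \<and>
     (\<exists>F G. star_hom F \<and> star_hom G \<and> (\<forall>a b. F (j (a \<otimes> b)) = jl (\<Phi> a \<otimes> b)) \<and>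
        (\<forall>a b. G (j (a \<otimes> b)) = jr (a \<otimes> \<Phi> b)) \<and> (\<forall>a. F (\<Phi> a) = G (\<Phi> a))) \<and>
     closure (cspan {j (a \<otimes> 1) * \<Phi> b | a b. True}) = UNIV \<and>
     closure (cspan {j (1 \<otimes> a) * \<Phi> b | a b. True}) = UNIV"

definition unitary_corep :: "(('a::cstar_algebra, 'a) tensor \<Rightarrow> 't::cstar_algebra) \<Rightarrow> ('a \<Rightarrow> 't) \<Rightarrow> nat \<Rightarrow> (nat \<Rightarrow> nat \<Rightarrow> 'a) \<Rightarrow> bool" where
  "unitary_corep j \<Phi> n u \<longleftrightarrow>
     (\<forall>p<n. \<forall>q<n. \<Phi> (u p q) = j (\<Sum>k<n. u p k \<otimes> u k q)) \<and>
     (\<forall>p<n. \<forall>q<n. (\<Sum>k<n. u p k * star (u q k)) = (if p = q then 1 else 0)) \<and>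
     (\<forall>p<n. \<forall>q<n. (\<Sum>k<n. star (u k p) * u k q) = (if p = q then 1 else 0))"

definition coord_space :: "nat \<Rightarrow> (nat \<Rightarrow> complex) set" where
  "coord_space n = {w. \<forall>k\<ge>n. w k = 0}"

definition coord_vec :: "nat \<Rightarrow> nat \<Rightarrow> complex" where
  "coord_vec p = (\<lambda>k. if k = p then 1 else 0)"

text \<open>The matrix \<open>u\<close> coacts on \<open>\<complex>\<^sup>n\<close> by \<open>e\<^sub>q \<mapsto> \<Sum>p. e\<^sub>p \<otimes> u\<^sub>p\<^sub>q\<close>; irreducible means: no invariant subspaces.\<close>

definition irreducible_corep :: "nat \<Rightarrow> (nat \<Rightarrow> nat \<Rightarrow> 'a::cstar_algebra) \<Rightarrow> bool" where
  "irreducible_corep n u \<longleftrightarrow> n > 0 \<and>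
     (\<forall>W. csubspace W \<and> W \<subseteq> coord_space n \<and>
          (\<forall>w\<in>W. (\<Sum>q<n. \<Sum>p<n. w q *\<^sub>C (coord_vec p \<otimes> u p q)) \<in> W \<otimes>\<^sub>s UNIV)
        \<longrightarrow> W = {0} \<or> W = coord_space n)"

definition matrix_coefficients :: "(('a::cstar_algebra, 'a) tensor \<Rightarrow> 't::cstar_algebra) \<Rightarrow> ('a \<Rightarrow> 't) \<Rightarrow> 'a set" where
  "matrix_coefficients j \<Phi> = cspan {u p q | n u p q. unitary_corep j \<Phi> n u \<and> irreducible_corep n u \<and> p < n \<and> q < n}"

definition peter_weyl_hopf_algebra ::
    "(('a::cstar_algebra, 'a) tensor \<Rightarrow> 't::cstar_algebra) \<Rightarrow> ('a \<Rightarrow> 't) \<Rightarrow>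
     'a set \<Rightarrow> ('a \<Rightarrow> ('a, 'a) tensor) \<Rightarrow> ('a \<Rightarrow> complex) \<Rightarrow> ('a \<Rightarrow> 'a) \<Rightarrow> bool" where
  "peter_weyl_hopf_algebra j \<Phi> H \<Delta> \<epsilon> S \<longleftrightarrow> H = matrix_coefficients j \<Phi> \<and> closure H = UNIV \<and>
     hopf_star_algebra H \<Delta> \<epsilon> S \<and> bij_betw S H H \<and> (\<forall>h\<in>H. j (\<Delta> h) = \<Phi> h)"


section \<open>Principal comodules\<close>

definition right_coaction :: "'p::complex_vector set \<Rightarrow> ('c::complex_vector \<Rightarrow> ('c, 'c) tensor) \<Rightarrow> ('c \<Rightarrow> complex) \<Rightarrow>
    ('p \<Rightarrow> ('p, 'c) tensor) \<Rightarrow> bool" where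
  "right_coaction P \<delta> \<epsilon> \<rho> \<longleftrightarrow> csubspace P \<and> clinear_on P \<rho> \<and> \<rho> ` P \<subseteq> P \<otimes>\<^sub>s UNIV \<and>
     (\<forall>p\<in>P. tensor_map_on P UNIV \<rho> id (\<rho> p) = tensor_assoc (tensor_map_on P UNIV id \<delta> (\<rho> p))) \<and>
     (\<forall>p\<in>P. tensor_lift_on P UNIV (\<lambda>q c. \<epsilon> c *\<^sub>C q) (\<rho> p) = p)"

definition coinvariants :: "'p::complex_algebra_1 set \<Rightarrow> ('p \<Rightarrow> ('p, 'c::complex_vector) tensor) \<Rightarrow> 'p set" where
  "coinvariants P \<rho> = {b\<in>P. \<forall>p\<in>P. \<rho> (b * p) = tensor_map (\<lambda>q. b * q) id (\<rho> p)}"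

definition balanced_eq :: "'p::complex_algebra_1 set \<Rightarrow> 'p set \<Rightarrow> (('p, 'p) tensor \<times> ('p, 'p) tensor) set" where
  "balanced_eq P B = {(s, t). s \<in> P \<otimes>\<^sub>s P \<and> t \<in> P \<otimes>\<^sub>s P \<and>
     s - t \<in> cspan {(p * b) \<otimes> q - p \<otimes> (b * q) | p q b. p \<in> P \<and> q \<in> P \<and> b \<in> B}}"

text \<open>\<open>P \<otimes>\<^sub>B P\<close>, as a set of classes of elements of \<open>P \<otimes> P\<close>.\<close>

definition balanced_tensor :: "'p::complex_algebra_1 set \<Rightarrow> 'p set \<Rightarrow> ('p, 'p) tensor set set" where
  "balanced_tensor P B = (P \<otimes>\<^sub>s P) // balanced_eq P B"

definition balanced_rmult :: "'p::complex_algebra_1 set \<Rightarrow> 'p set \<Rightarrow> ('p, 'p) tensor set \<Rightarrow> 'p \<Rightarrow> ('p, 'p) tensor set" where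
  "balanced_rmult P B X p = balanced_eq P B `` (tensor_map id (\<lambda>q. q * p) ` X)"

definition can_map :: "'p::complex_algebra_1 set \<Rightarrow> ('p \<Rightarrow> ('p, 'c::complex_vector) tensor) \<Rightarrow> ('p, 'p) tensor set \<Rightarrow> ('p, 'c) tensor" where
  "can_map P \<rho> X = the_elem (tensor_lift_on P P (\<lambda>p q. tensor_map (\<lambda>r. p * r) id (\<rho> q)) ` X)"

definition entwining :: "'p::complex_algebra_1 set \<Rightarrow> ('p \<Rightarrow> ('p, 'c::complex_vector) tensor) \<Rightarrow> ('c, 'p) tensor \<Rightarrow> ('p, 'c) tensor" where
  "entwining P \<rho> = (let B = coinvariants P \<rho> in
     tensor_lift_on UNIV P (\<lambda>c p.
       can_map P \<rho> (balanced_rmult P B (inv_into (balanced_tensor P B) (can_map P \<rho>) (1 \<otimes> c)) p)))"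

definition strong_splitting :: "'p::complex_algebra_1 set \<Rightarrow> ('p \<Rightarrow> ('p, 'c::complex_vector) tensor) \<Rightarrow> ('p \<Rightarrow> ('p, 'p) tensor) \<Rightarrow> bool" where
  "strong_splitting P \<rho> s \<longleftrightarrow> (let B = coinvariants P \<rho> in
     clinear_on P s \<and> s ` P \<subseteq> B \<otimes>\<^sub>s P \<and>
     (\<forall>p\<in>P. tensor_lift_on B P (*) (s p) = p) \<and>
     (\<forall>b\<in>B. \<forall>p\<in>P. s (b * p) = tensor_map (\<lambda>q. b * q) id (s p)) \<and>
     (\<forall>p\<in>P. tensor_assoc (tensor_map_on B P id \<rho> (s p)) = tensor_map_on P UNIV s id (\<rho> p)))"

definition principal_comodule :: "'p::complex_algebra_1 set \<Rightarrow> ('c::complex_vector \<Rightarrow> ('c, 'c) tensor) \<Rightarrow> ('c \<Rightarrow> complex) \<Rightarrow>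
    ('p \<Rightarrow> ('p, 'c) tensor) \<Rightarrow> 'c \<Rightarrow> bool" where
  "principal_comodule P \<delta> \<epsilon> \<rho> e \<longleftrightarrow>
     subalgebra P \<and> coalgebra UNIV \<delta> \<epsilon> \<and> right_coaction P \<delta> \<epsilon> \<rho> \<and> group_like \<delta> \<epsilon> e \<and>
     bij_betw (can_map P \<rho>) (balanced_tensor P (coinvariants P \<rho>)) (P \<otimes>\<^sub>s UNIV) \<and>
     \<rho> 1 = 1 \<otimes> e \<and>
     bij_betw (entwining P \<rho>) (UNIV \<otimes>\<^sub>s P) (P \<otimes>\<^sub>s UNIV) \<and>
     (\<exists>s. strong_splitting P \<rho> s)"

definition induced_left_coaction :: "'p::complex_algebra_1 set \<Rightarrow> ('p \<Rightarrow> ('p, 'c::complex_vector) tensor) \<Rightarrow> 'c \<Rightarrow> 'p \<Rightarrow> ('c, 'p) tensor" where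
  "induced_left_coaction P \<rho> e p = inv_into (UNIV \<otimes>\<^sub>s P) (entwining P \<rho>) (p \<otimes> e)"


section \<open>The pullback comodule\<close>

text \<open>
  The two halves of the unit interval are types, so that \<open>C([a,b])\<close> is a unital subalgebra of the
  algebra of all functions on the half.
\<close>
typedef left_half = "{0..1/2::real}" by (rule exI[of _ 0]) simp
typedef right_half = "{1/2..1::real}" by (rule exI[of _ 1]) simp

definition C_left :: "(left_half \<Rightarrow> 'a::cstar_algebra) set" where
  "C_left = {f. continuous_on {0..1/2} (\<lambda>t. f (Abs_left_half t))}"

definition C_right :: "(right_half \<Rightarrow> 'a::cstar_algebra) set" where
  "C_right = {f. continuous_on {1/2..1} (\<lambda>t. f (Abs_right_half t))}"

definition ev_left :: "real \<Rightarrow> (left_half \<Rightarrow> 'a) \<Rightarrow> 'a" where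
  "ev_left t f = f (Abs_left_half t)"

definition ev_right :: "real \<Rightarrow> (right_half \<Rightarrow> 'a) \<Rightarrow> 'a" where
  "ev_right t f = f (Abs_right_half t)"

definition P_left :: "'a::cstar_algebra set \<Rightarrow> ('a \<Rightarrow> ('a, 'a) tensor) \<Rightarrow> (left_half \<Rightarrow> 'a, 'a) tensor set" where
  "P_left H \<Delta> = {f \<in> C_left \<otimes>\<^sub>s H. tensor_map (ev_left 0) id f \<in> \<Delta> ` H}"

definition P_right :: "'a::cstar_algebra set \<Rightarrow> (right_half \<Rightarrow> 'a, 'a) tensor set" where
  "P_right H = {f \<in> C_right \<otimes>\<^sub>s H. tensor_map (ev_right 1) id f \<in> range (\<lambda>z. z *\<^sub>C 1) \<otimes>\<^sub>s H}"

definition P_pullback :: "'a::cstar_algebra set \<Rightarrow> ('a \<Rightarrow> ('a, 'a) tensor) \<Rightarrow>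
    ((left_half \<Rightarrow> 'a, 'a) tensor \<times> (right_half \<Rightarrow> 'a, 'a) tensor) set" where
  "P_pullback H \<Delta> = {(p, q) \<in> P_left H \<Delta> \<times> P_right H.
     tensor_map (ev_left (1/2)) id p = tensor_map (ev_right (1/2)) id q}"

text \<open>In the following four definitions \<open>F\<close> is \<open>C_left\<close> or \<open>C_right\<close>.\<close>

definition right_H_coaction :: "'f::complex_vector set \<Rightarrow> 'a::complex_vector set \<Rightarrow> ('a \<Rightarrow> ('a, 'a) tensor) \<Rightarrow>
    ('f, 'a) tensor \<Rightarrow> (('f, 'a) tensor, 'a) tensor" where
  "right_H_coaction F H \<Delta> f = tensor_assoc (tensor_map_on F H id \<Delta> f)"

definition left_H_coaction :: "'f::complex_vector set \<Rightarrow> 'a::complex_vector set \<Rightarrow> ('a \<Rightarrow> ('a, 'a) tensor) \<Rightarrow> ('a \<Rightarrow> 'a) \<Rightarrow>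
    ('f, 'a) tensor \<Rightarrow> ('a, ('f, 'a) tensor) tensor" where
  "left_H_coaction F H \<Delta> S f =
     tensor_map_on H (F \<otimes>\<^sub>s H) (inv_into H S) id (tensor_flip (right_H_coaction F H \<Delta> f))"

definition rho_R :: "'f::complex_vector set \<Rightarrow> 'a::complex_vector set \<Rightarrow> ('a \<Rightarrow> ('a, 'a) tensor) \<Rightarrow>
    ('a \<Rightarrow> 'c::complex_vector) \<Rightarrow> ('f, 'a) tensor \<Rightarrow> (('f, 'a) tensor, 'c) tensor" where
  "rho_R F H \<Delta> \<pi> f = tensor_map_on (F \<otimes>\<^sub>s H) H id \<pi> (right_H_coaction F H \<Delta> f)"

definition rho_L :: "'f::complex_vector set \<Rightarrow> 'a::complex_vector set \<Rightarrow> ('a \<Rightarrow> ('a, 'a) tensor) \<Rightarrow> ('a \<Rightarrow> 'a) \<Rightarrow>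
    ('a \<Rightarrow> 'c::complex_vector) \<Rightarrow> ('f, 'a) tensor \<Rightarrow> ('c, ('f, 'a) tensor) tensor" where
  "rho_L F H \<Delta> S \<pi> f = tensor_map_on H (F \<otimes>\<^sub>s H) \<pi> id (left_H_coaction F H \<Delta> S f)"

text \<open>
  The componentwise coactions, via \<open>(T\<^sub>1 \<otimes> C) \<times> (T\<^sub>2 \<otimes> C) \<cong> (T\<^sub>1 \<times> T\<^sub>2) \<otimes> C\<close>
  and \<open>(C \<otimes> T\<^sub>1) \<times> (C \<otimes> T\<^sub>2) \<cong> C \<otimes> (T\<^sub>1 \<times> T\<^sub>2)\<close>.
\<close>
definition pullback_rho_R :: "'a::cstar_algebra set \<Rightarrow> ('a \<Rightarrow> ('a, 'a) tensor) \<Rightarrow> ('a \<Rightarrow> 'c::complex_vector) \<Rightarrow>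
    (left_half \<Rightarrow> 'a, 'a) tensor \<times> (right_half \<Rightarrow> 'a, 'a) tensor \<Rightarrow>
    ((left_half \<Rightarrow> 'a, 'a) tensor \<times> (right_half \<Rightarrow> 'a, 'a) tensor, 'c) tensor" where
  "pullback_rho_R H \<Delta> \<pi> p =
     tensor_map (\<lambda>x. (x, 0)) id (rho_R C_left H \<Delta> \<pi> (fst p)) +
     tensor_map (\<lambda>y. (0, y)) id (rho_R C_right H \<Delta> \<pi> (snd p))"

definition pullback_rho_L :: "'a::cstar_algebra set \<Rightarrow> ('a \<Rightarrow> ('a, 'a) tensor) \<Rightarrow> ('a \<Rightarrow> 'a) \<Rightarrow> ('a \<Rightarrow> 'c::complex_vector) \<Rightarrow>
    (left_half \<Rightarrow> 'a, 'a) tensor \<times> (right_half \<Rightarrow> 'a, 'a) tensor \<Rightarrow>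
    ('c, (left_half \<Rightarrow> 'a, 'a) tensor \<times> (right_half \<Rightarrow> 'a, 'a) tensor) tensor" where
  "pullback_rho_L H \<Delta> S \<pi> p =
     tensor_map id (\<lambda>x. (x, 0)) (rho_L C_left H \<Delta> S \<pi> (fst p)) +
     tensor_map id (\<lambda>y. (0, y)) (rho_L C_right H \<Delta> S \<pi> (snd p))"

end

theory Submission
  imports Defs
begin

text \<open>
  Only the Hopf algebra \<open>H\<close> matters. If an \<open>H\<close>-comodule algebra \<open>P\<close> carries a strong connection,
  i.e. a bicolinear map \<open>L : H \<rightarrow> P \<otimes> P\<close> with \<open>m \<circ> L = \<epsilon>\<close>, then \<open>\<ell> = L \<circ> i : C \<rightarrow> P \<otimes> P\<close> is a bicolinear
  strong connection for \<open>C\<close>. It inverts the canonical map by \<open>p \<otimes> c \<mapsto> p \<ell>(c)\<close>, it splits the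
  multiplication by \<open>p \<mapsto> p\<^sub>0 \<ell>(\<pi>(p\<^sub>1))\<close>, and it identifies the entwining with \<open>\<pi>(h) \<otimes> p \<mapsto> p\<^sub>0 \<otimes> \<pi>(h p\<^sub>1)\<close>,
  which is inverted using \<open>S\<^sup>-\<^sup>1\<close>.

  For the pullback, \<open>\<Delta>\<close> (as constant functions) on the left half and \<open>1 \<otimes> h\<close> on the right half are colinear
  algebra maps. Joining each of them linearly to the other one over the opposite half gives two colinear maps
  \<open>G\<^sub>1, G\<^sub>2 : H \<rightarrow> P\<close>; \<open>G\<^sub>1\<close> is multiplicative on the left half and \<open>G\<^sub>2\<close> on the right half, so the defects
  \<open>\<epsilon> - (G\<^sub>k \<circ> S) * G\<^sub>k\<close> have convolution product \<open>0\<close>, which is what one needs to combine them into a strong connection.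
\<close>

text \<open>Since \<open>J\<close> is only a right ideal, \<open>C\<close> has no product and the
  \<open>C\<close>-coaction on \<open>P\<close> cannot be multiplicative. What survives is a right
  action of \<open>H\<close> on \<open>C\<close>, written \<open>\<pi> (i c * h)\<close> throughout;
  multiplicative arguments are made with the \<open>H\<close>-coaction \<open>R\<close> and
  projected to \<open>C\<close> at the end. The two halves of bicolinearity of \<open>i\<close> have
  separate tasks: right colinearity makes the splitting of the multiplication right
  \<open>C\<close>-colinear, left colinearity puts its first leg into the coinvariants. On the
  pullback the obstacle is that the algebra maps natural at the two ends, \<Delta> at
  \<open>0\<close> and \<open>h \<mapsto> 1 \<otimes> h\<close> at \<open>1\<close>, need not agree
  at the gluing point. Linear interpolation repairs this and keeps colinearity, because its
  coefficients sit in the function leg, which the coaction does not touch; the price is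
  multiplicativity on one half. Each defect therefore lives on a single half, and the two halves are
  different, so that products of the defects vanish in the product algebra.\<close>

abbreviation clinear :: "('a::complex_vector \<Rightarrow> 'b::complex_vector) \<Rightarrow> bool" where
  "clinear \<equiv> clinear_on UNIV"

section \<open>Linear maps and tensor products of subspaces\<close>

lemma clinearI:
  assumes "\<And>x y. f (x + y) = f x + f y" "\<And>c x. f (c *\<^sub>C x) = c *\<^sub>C f x"
  shows "clinear f"
  using assms by (simp add: clinear_on_def)

lemma
  assumes "clinear f"
  shows clinear_add: "f (x + y) = f x + f y"
    and clinear_scaleC: "f (c *\<^sub>C x) = c *\<^sub>C f x"
    and clinear_zero: "f 0 = 0"
    and clinear_diff: "f (x - y) = f x - f y"
proof -
  show a: "f (x + y) = f x + f y" and s: "f (c *\<^sub>C x) = c *\<^sub>C f x" for x y c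
    using assms by (auto simp: clinear_on_def)
  show "f 0 = 0" using s[of 0 0] by simp
  show "f (x - y) = f x - f y" using a[of "x - y" y] by simp
qed

lemma clinear_sum_list: "clinear f \<Longrightarrow> f (sum_list xs) = (\<Sum>x\<leftarrow>xs. f x)"
  by (induction xs) (simp_all add: clinear_zero clinear_add)

lemma bilinear_CI:
  assumes "\<And>x x' y. f (x + x') y = f x y + f x' y" "\<And>c x y. f (c *\<^sub>C x) y = c *\<^sub>C f x y"
    and "\<And>x y y'. f x (y + y') = f x y + f x y'" "\<And>c x y. f x (c *\<^sub>C y) = c *\<^sub>C f x y"
  shows "bilinear_C f"
  using assms by (simp add: bilinear_C_def clinear_on_def)

lemma tensor_diff_left: "(a - a') \<otimes> b = a \<otimes> b - a' \<otimes> b"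
  using clinear_diff[of "\<lambda>x. x \<otimes> b"] by (simp add: clinear_on_def tensor_add_left tensor_scaleC_left)

lemma clinear_tensor_lift: "bilinear_C f \<Longrightarrow> clinear (tensor_lift f)"
  by (simp add: clinear_on_def tensor_lift_add tensor_lift_scaleC)

lemma tensor_eqI:
  assumes "clinear f" "clinear g" "\<And>a b. f (a \<otimes> b) = g (a \<otimes> b)"
  shows "f t = g t"
  by (induction t rule: tensor_induct) (simp_all add: assms clinear_add)

lemma tensor_map_pure [simp]: "clinear f \<Longrightarrow> clinear g \<Longrightarrow> tensor_map f g (a \<otimes> b) = f a \<otimes> g b"
  unfolding tensor_map_on_def
  by (rule tensor_lift_pure) (simp add: bilinear_C_def clinear_on_def tensor_add_left tensor_add_right
      tensor_scaleC_left tensor_scaleC_right)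

lemma clinear_tensor_map: "clinear f \<Longrightarrow> clinear g \<Longrightarrow> clinear (tensor_map f g)"
  unfolding tensor_map_on_def
  by (rule clinear_tensor_lift) (simp add: bilinear_C_def clinear_on_def tensor_add_left tensor_add_right
      tensor_scaleC_left tensor_scaleC_right)

lemma csubspace_tensor_set: "csubspace (U \<otimes>\<^sub>s V)"
  by (simp add: tensor_set_def complex_vector.subspace_span)

lemma tensor_mem: "u \<in> U \<Longrightarrow> v \<in> V \<Longrightarrow> u \<otimes> v \<in> U \<otimes>\<^sub>s V"
  unfolding tensor_set_def by (rule complex_vector.span_base) blast

lemma csubspace_sum_list: "csubspace U \<Longrightarrow> set xs \<subseteq> U \<Longrightarrow> sum_list xs \<in> U"
  by (induction xs) (auto intro: complex_vector.subspace_0 complex_vector.subspace_add)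

lemma clinear_image_tensor_set:
  assumes f: "clinear f" and t: "t \<in> U \<otimes>\<^sub>s V"
    and W: "csubspace W" "\<And>u v. u \<in> U \<Longrightarrow> v \<in> V \<Longrightarrow> f (u \<otimes> v) \<in> W"
  shows "f t \<in> W"
  using t unfolding tensor_set_def
proof (induction rule: complex_vector.span_induct_alt)
  case base
  show ?case using W(1) by (simp add: clinear_zero[OF f] complex_vector.subspace_0)
next
  case (step c x y)
  then show ?case
    using W by (auto simp: clinear_add[OF f] clinear_scaleC[OF f]
        intro!: complex_vector.subspace_add complex_vector.subspace_scale)
qed

text \<open>The difference of the two maps sends every generator into the zero subspace.\<close>

lemma tensor_set_eqI:
  assumes "clinear f" "clinear g" "\<And>u v. u \<in> U \<Longrightarrow> v \<in> V \<Longrightarrow> f (u \<otimes> v) = g (u \<otimes> v)" "t \<in> U \<otimes>\<^sub>s V"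
  shows "f t = g t"
proof -
  have "f t - g t \<in> {0}"
    by (rule clinear_image_tensor_set[of "\<lambda>t. f t - g t", OF _ assms(4)])
      (use assms(1-3) in \<open>simp_all add: clinear_on_def complex_vector.scale_right_diff_distrib\<close>)
  then show ?thesis by simp
qed

lemma tensor_set_mono: "U \<subseteq> U' \<Longrightarrow> V \<subseteq> V' \<Longrightarrow> U \<otimes>\<^sub>s V \<subseteq> U' \<otimes>\<^sub>s V'"
  unfolding tensor_set_def by (rule complex_vector.span_mono) blast

lemma tensor_set_UNIV [simp]: "UNIV \<otimes>\<^sub>s UNIV = UNIV"
proof -
  have "t \<in> UNIV \<otimes>\<^sub>s UNIV" for t :: "('a, 'b) tensor"
    by (induction t rule: tensor_induct)
      (auto intro: tensor_mem complex_vector.subspace_add[OF csubspace_tensor_set])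
  then show ?thesis by auto
qed

section \<open>Minimal representations of tensors\<close>

abbreviation pure_sum :: "('a::complex_vector \<times> 'b::complex_vector) list \<Rightarrow> ('a, 'b) tensor" where
  "pure_sum xs \<equiv> (\<Sum>(u, v)\<leftarrow>xs. u \<otimes> v)"

text \<open>Shortest possible list: minimal length forces the legs on each side to be linearly
  independent, and this is what turns them into slices of \<open>t\<close>.\<close>

definition tensor_rep :: "('a::complex_vector, 'b::complex_vector) tensor \<Rightarrow> ('a \<times> 'b) list" where
  "tensor_rep t = arg_min length (\<lambda>xs. t = pure_sum xs)"

lemma tensor_rep: "t = pure_sum (tensor_rep t)"
  and tensor_rep_minimal: "t = pure_sum xs \<Longrightarrow> length (tensor_rep t) \<le> length xs"
proof -
  have "\<exists>xs. t = pure_sum xs"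
    using tensor_set_sum_list[of UNIV t UNIV] by (auto simp: complex_vector.subspace_UNIV)
  then obtain ys where "t = pure_sum ys" by blast
  then show "t = pure_sum (tensor_rep t)"
    unfolding tensor_rep_def by (rule arg_min_natI)
  show "t = pure_sum xs \<Longrightarrow> length (tensor_rep t) \<le> length xs"
    unfolding tensor_rep_def by (rule arg_min_nat_le)
qed

text \<open>A basis of \<open>W\<close> stays independent when \<open>v\<close> is added, so a
  functional can be prescribed as \<open>1\<close> at \<open>v\<close> and \<open>0\<close> on the
  basis.\<close>

lemma functional_separating:
  fixes v :: "'a::complex_vector"
  assumes W: "csubspace W" and v: "v \<notin> W"
  obtains \<phi> :: "'a \<Rightarrow> complex" where "clinear \<phi>" "\<phi> v = 1" "\<And>w. w \<in> W \<Longrightarrow> \<phi> w = 0"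
proof -
  interpret vp: vector_space_pair "scaleC :: complex \<Rightarrow> 'a \<Rightarrow> 'a" "scaleC :: complex \<Rightarrow> complex \<Rightarrow> complex" ..
  obtain Bs where Bs: "Bs \<subseteq> W" "complex_vector.independent Bs" "W \<subseteq> cspan Bs"
    using complex_vector.maximal_independent_subset[of W] by (metis cspan_raw_def)
  have sp: "cspan Bs = W"
    using Bs W by (metis complex_vector.span_subspace csubspace_raw_def cspan_raw_def)
  have ind: "complex_vector.independent (insert v Bs)"
    using Bs(2) v sp by (metis complex_vector.independent_insertI cspan_raw_def)
  obtain \<phi> :: "'a \<Rightarrow> complex" where \<phi>: "Vector_Spaces.linear scaleC scaleC \<phi>" "\<forall>x\<in>insert v Bs. \<phi> x = (if x = v then 1 else 0)"
    using vp.linear_independent_extend[OF ind, of "\<lambda>x. if x = v then 1 else 0"] by blast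
  have lin: "clinear \<phi>" using \<phi>(1) by (simp add: clinear_on_def Vector_Spaces.linear_iff)
  have "\<phi> w = 0" if "w \<in> W" for w
    using that unfolding sp[symmetric]
  proof (induction rule: complex_vector.span_induct_alt)
    case base
    show ?case by (rule clinear_zero[OF lin])
  next
    case (step c x y)
    have "x \<noteq> v" using step(1) Bs(1) v by blast
    with step \<phi>(2) show ?case by (auto simp: clinear_add[OF lin] clinear_scaleC[OF lin])
  qed
  with lin \<phi>(2) show thesis by (intro that[of \<phi>]) auto
qed

text \<open>A second leg that depends on those already present needs no term of its own: expand
  \<open>v\<close> in them and add the corresponding multiples of \<open>u\<close> to the first
  legs. Hence a list with dependent second legs is not minimal.\<close>

lemma pure_sum_absorb:
  assumes "v \<in> cspan (snd ` set xs)"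
  shows "\<exists>ys. length ys = length xs \<and> pure_sum ys = u \<otimes> v + pure_sum xs"
  using assms
proof (induction xs arbitrary: v)
  case Nil
  then show ?case by simp
next
  case (Cons x xs)
  obtain a b where x: "x = (a, b)" by (cases x)
  from Cons.prems obtain k where k: "v - k *\<^sub>C b \<in> cspan (snd ` set xs)"
    using complex_vector.span_breakdown_eq[of v b "snd ` set xs"] x by auto
  from Cons.IH[OF k] obtain ys where
    ys: "length ys = length xs" "pure_sum ys = u \<otimes> (v - k *\<^sub>C b) + pure_sum xs" by blast
  have "u \<otimes> v = u \<otimes> (v - k *\<^sub>C b) + (k *\<^sub>C u) \<otimes> b"
    by (simp add: tensor_scaleC_left flip: tensor_scaleC_right tensor_add_right)
  with ys x show ?case
    by (intro exI[of _ "(a + k *\<^sub>C u, b) # ys"]) (simp add: tensor_add_left algebra_simps)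
qed

text \<open>The slice map \<open>id \<otimes> \<phi>\<close>, with values in the first factor;
  \<open>slice_right\<close> is \<open>\<phi> \<otimes> id\<close>.\<close>

definition slice_left :: "('b \<Rightarrow> complex) \<Rightarrow> ('a::complex_vector, 'b::complex_vector) tensor \<Rightarrow> 'a" where
  "slice_left \<phi> = tensor_lift (\<lambda>a b. \<phi> b *\<^sub>C a)"

definition slice_right :: "('a \<Rightarrow> complex) \<Rightarrow> ('a::complex_vector, 'b::complex_vector) tensor \<Rightarrow> 'b" where
  "slice_right \<phi> = tensor_lift (\<lambda>a b. \<phi> a *\<^sub>C b)"

lemma
  fixes a :: "'a::complex_vector" and b :: "'b::complex_vector"
  assumes \<phi>: "clinear \<phi>"
  shows clinear_slice_left: "clinear (slice_left \<phi> :: ('a, 'b) tensor \<Rightarrow> 'a)"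
    and slice_left_pure: "slice_left \<phi> (a \<otimes> b) = \<phi> b *\<^sub>C a"
proof -
  have "bilinear_C (\<lambda>(a::'a) b. \<phi> b *\<^sub>C a)"
    by (rule bilinear_CI) (simp_all add: clinear_add[OF \<phi>] clinear_scaleC[OF \<phi>] scaleC_add_left scaleC_add_right
      scaleC_complex_def mult.commute)
  then show "clinear (slice_left \<phi> :: ('a, 'b) tensor \<Rightarrow> 'a)" "slice_left \<phi> (a \<otimes> b) = \<phi> b *\<^sub>C a"
    by (auto simp: slice_left_def clinear_tensor_lift tensor_lift_pure)
qed

lemma
  fixes a :: "'a::complex_vector" and b :: "'b::complex_vector"
  assumes \<phi>: "clinear \<phi>"
  shows clinear_slice_right: "clinear (slice_right \<phi> :: ('a, 'b) tensor \<Rightarrow> 'b)"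
    and slice_right_pure: "slice_right \<phi> (a \<otimes> b) = \<phi> a *\<^sub>C b"
proof -
  have "bilinear_C (\<lambda>a (b::'b). \<phi> a *\<^sub>C b)"
    by (rule bilinear_CI) (simp_all add: clinear_add[OF \<phi>] clinear_scaleC[OF \<phi>] scaleC_add_left scaleC_add_right
      scaleC_complex_def mult.commute)
  then show "clinear (slice_right \<phi> :: ('a, 'b) tensor \<Rightarrow> 'b)" "slice_right \<phi> (a \<otimes> b) = \<phi> a *\<^sub>C b"
    by (auto simp: slice_right_def clinear_tensor_lift tensor_lift_pure)
qed

text \<open>By minimality \<open>v\<close> is outside the span of the other second legs, since
  otherwise its term could be absorbed into a shorter list. A functional that is \<open>1\<close> at
  \<open>v\<close> and vanishes on that span isolates \<open>u\<close>.\<close>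

lemma tensor_rep_left_slice:
  assumes "(u, v) \<in> set (tensor_rep t)"
  obtains \<phi> where "clinear \<phi>" "u = slice_left \<phi> t"
proof -
  obtain ys zs where sp: "tensor_rep t = ys @ (u, v) # zs" using split_list[OF assms] by blast
  have t: "t = u \<otimes> v + pure_sum (ys @ zs)" using tensor_rep[of t] by (simp add: sp)
  have nv: "v \<notin> cspan (snd ` set (ys @ zs))"
  proof
    assume "v \<in> cspan (snd ` set (ys @ zs))"
    then obtain xs where "length xs = length (ys @ zs)" "pure_sum xs = u \<otimes> v + pure_sum (ys @ zs)"
      using pure_sum_absorb by blast
    then show False using tensor_rep_minimal[of t xs] t sp by (metis length_append list.size(4) One_nat_def add_Suc_right not_less_eq_eq order_refl plus_1_eq_Suc add.commute)
  qed
  obtain \<phi> :: "_ \<Rightarrow> complex" where \<phi>: "clinear \<phi>" "\<phi> v = 1" "\<And>w. w \<in> cspan (snd ` set (ys @ zs)) \<Longrightarrow> \<phi> w = 0"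
    by (rule functional_separating[OF complex_vector.subspace_span nv]) blast
  have "slice_left \<phi> (pure_sum xs) = 0" if "set xs \<subseteq> set (ys @ zs)" for xs
    using that
  proof (induction xs)
    case (Cons x xs)
    then have "\<phi> (snd x) = 0"
      by (intro \<phi>(3)) (auto intro!: complex_vector.span_base rev_image_eqI[of x])
    with Cons show ?case
      by (simp add: clinear_add[OF clinear_slice_left[OF \<phi>(1)]] slice_left_pure[OF \<phi>(1)] case_prod_beta)
  qed (simp add: clinear_zero[OF clinear_slice_left[OF \<phi>(1)]])
  then have "slice_left \<phi> t = u"
    by (subst t) (simp only: clinear_add[OF clinear_slice_left[OF \<phi>(1)]] slice_left_pure[OF \<phi>(1)] \<phi>(2)
        order_refl scaleC_one add_0_right)
  with \<phi>(1) show thesis using that by blast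
qed

lemma bilinear_C_flip: "bilinear_C (\<lambda>a b. b \<otimes> a)"
  by (rule bilinear_CI) (rule tensor_add_left tensor_scaleC_left tensor_add_right tensor_scaleC_right)+

lemma tensor_flip_pure [simp]: "tensor_flip (a \<otimes> b) = b \<otimes> a"
  by (simp add: tensor_flip_def tensor_lift_pure bilinear_C_flip)

lemma clinear_tensor_flip: "clinear tensor_flip"
  by (simp add: tensor_flip_def clinear_tensor_lift bilinear_C_flip)

text \<open>Mirror image of the previous argument: a dependent first leg is absorbed after flipping
  the tensor, and flipping back contradicts minimality.\<close>

lemma tensor_rep_right_slice:
  assumes "(u, v) \<in> set (tensor_rep t)"
  obtains \<phi> where "clinear \<phi>" "v = slice_right \<phi> t"
proof -
  obtain ys zs where sp: "tensor_rep t = ys @ (u, v) # zs" using split_list[OF assms] by blast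
  have fl: "tensor_flip (pure_sum xs) = pure_sum (map prod.swap xs)" for xs :: "('x::complex_vector \<times> 'y::complex_vector) list"
    by (induction xs) (auto simp: clinear_add[OF clinear_tensor_flip] clinear_zero[OF clinear_tensor_flip])
  have t: "t = u \<otimes> v + pure_sum (ys @ zs)" using tensor_rep[of t] by (simp add: sp)
  have nu: "u \<notin> cspan (snd ` set (map prod.swap (ys @ zs)))"
  proof
    assume "u \<in> cspan (snd ` set (map prod.swap (ys @ zs)))"
    then obtain xs where xs: "length xs = length (ys @ zs)"
      "pure_sum xs = v \<otimes> u + pure_sum (map prod.swap (ys @ zs))"
      using pure_sum_absorb by fastforce
    have "t = tensor_flip (pure_sum xs)"
      unfolding xs(2) clinear_add[OF clinear_tensor_flip] fl tensor_flip_pure by (subst t) (simp add: comp_def)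
    then have "t = pure_sum (map prod.swap xs)" by (simp only: fl)
    then have "length (tensor_rep t) \<le> length (map prod.swap xs)" by (rule tensor_rep_minimal)
    then show False using xs(1) sp by simp
  qed
  obtain \<phi> :: "_ \<Rightarrow> complex" where \<phi>: "clinear \<phi>" "\<phi> u = 1" "\<And>w. w \<in> cspan (snd ` set (map prod.swap (ys @ zs))) \<Longrightarrow> \<phi> w = 0"
    by (rule functional_separating[OF complex_vector.subspace_span nu]) blast
  have "slice_right \<phi> (pure_sum xs) = 0" if "set xs \<subseteq> set (ys @ zs)" for xs
    using that
  proof (induction xs)
    case (Cons x xs)
    then have "\<phi> (fst x) = 0"
      by (intro \<phi>(3)) (force intro!: complex_vector.span_base)
    with Cons show ?case
      by (simp add: clinear_add[OF clinear_slice_right[OF \<phi>(1)]] slice_right_pure[OF \<phi>(1)] case_prod_beta)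
  qed (simp add: clinear_zero[OF clinear_slice_right[OF \<phi>(1)]])
  then have "slice_right \<phi> t = v"
    by (subst t) (simp only: clinear_add[OF clinear_slice_right[OF \<phi>(1)]] slice_right_pure[OF \<phi>(1)] \<phi>(2)
        order_refl scaleC_one add_0_right)
  with \<phi>(1) show thesis using that by blast
qed

text \<open>Legs of a minimal representation are slices of \<open>t\<close>, and a slice of an
  element of \<open>U \<otimes>\<^sub>s V\<close> is a combination of elements of \<open>U\<close>
  or of \<open>V\<close>.\<close>

lemma tensor_rep_legs:
  assumes "csubspace U" "csubspace V" "t \<in> U \<otimes>\<^sub>s V"
  shows "set (tensor_rep t) \<subseteq> U \<times> V"
proof (intro subsetI, clarify)
  fix u v assume uv: "(u, v) \<in> set (tensor_rep t)"
  obtain \<phi> where \<phi>: "clinear \<phi>" "u = slice_left \<phi> t" using tensor_rep_left_slice[OF uv] .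
  obtain \<xi> where \<xi>: "clinear \<xi>" "v = slice_right \<xi> t" using tensor_rep_right_slice[OF uv] .
  have "slice_left \<phi> t \<in> U"
    by (rule clinear_image_tensor_set[OF clinear_slice_left[OF \<phi>(1)] assms(3,1)])
      (simp add: slice_left_pure[OF \<phi>(1)] complex_vector.subspace_scale[OF assms(1)])
  moreover have "slice_right \<xi> t \<in> V"
    by (rule clinear_image_tensor_set[OF clinear_slice_right[OF \<xi>(1)] assms(3,2)])
      (simp add: slice_right_pure[OF \<xi>(1)] complex_vector.subspace_scale[OF assms(2)])
  ultimately show "u \<in> U \<and> v \<in> V" using \<phi>(2) \<xi>(2) by simp
qed

lemma pure_sum_mem: "set xs \<subseteq> U \<times> V \<Longrightarrow> pure_sum xs \<in> U \<otimes>\<^sub>s V"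
  by (rule csubspace_sum_list[OF csubspace_tensor_set]) (auto intro: tensor_mem)

text \<open>The first legs of a minimal representation are slices. The criterion serves for sets
  \<open>U\<close> cut out by equations, where the equations can be tested on slices but no
  convenient generators are at hand.\<close>

lemma tensor_set_slices:
  assumes "\<And>\<phi>. clinear \<phi> \<Longrightarrow> slice_left \<phi> t \<in> U" and "csubspace V" and "t \<in> UNIV \<otimes>\<^sub>s V"
  shows "t \<in> U \<otimes>\<^sub>s V"
proof -
  have "set (tensor_rep t) \<subseteq> U \<times> V"
  proof (intro subsetI, clarify)
    fix u v assume uv: "(u, v) \<in> set (tensor_rep t)"
    then have "v \<in> V" using tensor_rep_legs[OF complex_vector.subspace_UNIV assms(2,3)] by blast
    moreover obtain \<phi> where "clinear \<phi>" "u = slice_left \<phi> t" using tensor_rep_left_slice[OF uv] .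
    ultimately show "u \<in> U \<and> v \<in> V" using assms(1) by blast
  qed
  then show ?thesis using pure_sum_mem tensor_rep by metis
qed

text \<open>Tensoring over a field is exact, so the kernel of \<open>g \<otimes> id\<close> is the
  kernel of \<open>g\<close> tensored with \<open>V\<close>. Here it follows because slicing the
  second leg commutes with \<open>g\<close>.\<close>

lemma tensor_set_kernel:
  assumes "csubspace U" "csubspace V" "t \<in> U \<otimes>\<^sub>s V" "clinear g" "tensor_map g id t = 0"
  shows "t \<in> {u\<in>U. g u = 0} \<otimes>\<^sub>s V"
proof (rule tensor_set_slices)
  fix \<phi> :: "'b \<Rightarrow> complex" assume \<phi>: "clinear \<phi>"
  have id: "clinear (id :: 'b \<Rightarrow> 'b)" by (simp add: clinear_on_def)
  have "g (slice_left \<phi> t) = slice_left \<phi> (tensor_map g id t)"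
    by (rule tensor_eqI[of "\<lambda>t. g (slice_left \<phi> t)" "\<lambda>t. slice_left \<phi> (tensor_map g id t)"])
      (simp_all add: clinear_on_def clinear_add[OF assms(4)] clinear_scaleC[OF assms(4)]
        clinear_add[OF clinear_slice_left[OF \<phi>]] clinear_scaleC[OF clinear_slice_left[OF \<phi>]]
        clinear_add[OF clinear_tensor_map[OF assms(4) id]] clinear_scaleC[OF clinear_tensor_map[OF assms(4) id]]
        tensor_map_pure[OF assms(4) id] slice_left_pure[OF \<phi>])
  moreover have "slice_left \<phi> t \<in> U"
    by (rule clinear_image_tensor_set[OF clinear_slice_left[OF \<phi>] assms(3,1)])
      (simp add: slice_left_pure[OF \<phi>] complex_vector.subspace_scale[OF assms(1)])
  ultimately show "slice_left \<phi> t \<in> {u\<in>U. g u = 0}"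
    by (simp add: assms(5) clinear_zero[OF clinear_slice_left[OF \<phi>]])
next
  show "t \<in> UNIV \<otimes>\<^sub>s V" using assms(3) tensor_set_mono[of U UNIV V V] by blast
qed (fact assms)

section \<open>Sweedler sums\<close>

text \<open>
  \<open>tsum t f\<close> is Sweedler's \<open>\<Sum> f(t\<^sub>1, t\<^sub>2)\<close>, taken over a fixed minimal representation of \<open>t\<close>.
  For bilinear \<open>f\<close> it does not depend on the representation; being a sum, it commutes
  with linear maps and other sums for every \<open>f\<close>. By minimality its legs lie in \<open>U\<close> and \<open>V\<close> whenever
  \<open>t \<in> U \<otimes>\<^sub>s V\<close>.
\<close>
definition tsum :: "('a::complex_vector, 'b::complex_vector) tensor \<Rightarrow> ('a \<Rightarrow> 'b \<Rightarrow> 'c::complex_vector) \<Rightarrow> 'c" where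
  "tsum t f = (\<Sum>(u, v)\<leftarrow>tensor_rep t. f u v)"

lemma tsum_eq_lift: "bilinear_C f \<Longrightarrow> tensor_lift f t = tsum t f"
proof -
  assume f: "bilinear_C f"
  have "tensor_lift f (pure_sum xs) = (\<Sum>(u, v)\<leftarrow>xs. f u v)" for xs
    by (induction xs)
      (auto simp: tensor_lift_add[OF f] tensor_lift_pure[OF f] clinear_zero[OF clinear_tensor_lift[OF f]])
  then show ?thesis by (metis tensor_rep tsum_def)
qed

lemma tsum_cong:
  assumes "csubspace U" "csubspace V" "t \<in> U \<otimes>\<^sub>s V" "\<And>x y. x \<in> U \<Longrightarrow> y \<in> V \<Longrightarrow> f x y = g x y"
  shows "tsum t f = tsum t g"
  unfolding tsum_def using tensor_rep_legs[OF assms(1-3)] assms(4)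
  by (intro arg_cong[where f=sum_list] map_cong) auto

lemma tsum_mem:
  assumes "csubspace U" "csubspace V" "t \<in> U \<otimes>\<^sub>s V" "csubspace W" "\<And>x y. x \<in> U \<Longrightarrow> y \<in> V \<Longrightarrow> f x y \<in> W"
  shows "tsum t f \<in> W"
  unfolding tsum_def using tensor_rep_legs[OF assms(1-3)] assms(5)
  by (intro csubspace_sum_list[OF assms(4)]) auto

text \<open>Bridge from lifts defined by unique choice to Sweedler sums: extend \<open>f\<close> to
  a bilinear map on the full spaces, and use that the chosen legs of \<open>t\<close> stay in
  \<open>U\<close> and \<open>V\<close>, where the extension agrees with \<open>f\<close>.\<close>

lemma tensor_lift_on_eq_tsum:
  assumes "csubspace U" "csubspace V" "t \<in> U \<otimes>\<^sub>s V"
    and "\<And>v. v \<in> V \<Longrightarrow> clinear_on U (\<lambda>u. f u v)" "\<And>u. u \<in> U \<Longrightarrow> clinear_on V (f u)"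
  shows "tensor_lift_on U V f t = tsum t f"
proof -
  obtain g where g: "bilinear_C g" "\<And>u v. u \<in> U \<Longrightarrow> v \<in> V \<Longrightarrow> g u v = f u v"
      "\<And>t. t \<in> U \<otimes>\<^sub>s V \<Longrightarrow> tensor_lift_on U V f t = tensor_lift g t"
    using tensor_lift_on_extension[OF assms(1,2,4,5)] by metis
  then show ?thesis using assms(3) tsum_cong[OF assms(1-3), of f g] by (simp add: tsum_eq_lift)
qed

lemma tsum_push: "clinear g \<Longrightarrow> g (tsum t f) = tsum t (\<lambda>x y. g (f x y))"
  unfolding tsum_def case_prod_beta by (simp add: clinear_sum_list comp_def)

lemma tsum_add_fun: "tsum t (\<lambda>x y. f x y + g x y) = tsum t f + tsum t g"
  unfolding tsum_def case_prod_beta by (rule sum_list_addf)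

lemma tsum_scaleC_fun: "tsum t (\<lambda>x y. c *\<^sub>C f x y) = c *\<^sub>C tsum t f"
  by (rule tsum_push[symmetric]) (simp add: clinear_on_def scaleC_add_right mult.commute)

lemma tsum_diff_fun: "tsum t (\<lambda>x y. f x y - g x y) = tsum t f - tsum t g"
  unfolding tsum_def case_prod_beta by (rule sum_list_subtractf)

lemma tsum_zero_fun [simp]: "tsum t (\<lambda>x y. 0) = 0"
  unfolding tsum_def case_prod_beta by (rule sum_list_0)

lemma tsum_mult_left: "tsum t (\<lambda>x y. c * f x y) = c * tsum t (f :: _ \<Rightarrow> _ \<Rightarrow> 'd::complex_algebra_1)"
  by (rule tsum_push[symmetric]) (simp add: clinear_on_def distrib_left)

lemma tsum_mult_right: "tsum t (\<lambda>x y. f x y * c) = tsum t (f :: _ \<Rightarrow> _ \<Rightarrow> 'd::complex_algebra_1) * c"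
  by (rule tsum_push[symmetric, of "\<lambda>x. x * c"]) (simp add: clinear_on_def distrib_right)

lemma tsum_tensor_left: "tsum t (\<lambda>x y. c \<otimes> f x y) = c \<otimes> tsum t f"
  by (rule tsum_push[symmetric]) (simp add: clinear_on_def tensor_add_right tensor_scaleC_right)

lemma tsum_tensor_right: "tsum t (\<lambda>x y. f x y \<otimes> c) = tsum t f \<otimes> c"
  by (rule tsum_push[symmetric, of "\<lambda>x. x \<otimes> c"]) (simp add: clinear_on_def tensor_add_left tensor_scaleC_left)

lemma sum_list_commute:
  fixes f :: "'x \<Rightarrow> 'y \<Rightarrow> 'z::comm_monoid_add"
  shows "(\<Sum>x\<leftarrow>xs. \<Sum>y\<leftarrow>ys. f x y) = (\<Sum>y\<leftarrow>ys. \<Sum>x\<leftarrow>xs. f x y)"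
  by (induction xs) (simp_all add: sum_list_addf)

lemma tsum_commute: "tsum t (\<lambda>x y. tsum s (\<lambda>a b. f x y a b)) = tsum s (\<lambda>a b. tsum t (\<lambda>x y. f x y a b))"
  unfolding tsum_def case_prod_beta by (rule sum_list_commute)

lemma tsum_pure: "bilinear_C f \<Longrightarrow> tsum (a \<otimes> b) f = f a b"
  by (simp add: tensor_lift_pure flip: tsum_eq_lift)

lemma tsum_add: "bilinear_C f \<Longrightarrow> tsum (s + t) f = tsum s f + tsum t f"
  by (simp add: tensor_lift_add flip: tsum_eq_lift)

lemma tsum_scaleC: "bilinear_C f \<Longrightarrow> tsum (c *\<^sub>C t) f = c *\<^sub>C tsum t f"
  by (simp add: tensor_lift_scaleC flip: tsum_eq_lift)

lemma tsum_zero: "bilinear_C f \<Longrightarrow> tsum 0 f = 0"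
  using clinear_zero[OF clinear_tensor_lift, of f] by (simp add: tsum_eq_lift)

text \<open>The chosen representation of \<open>tsum t g\<close> is unrelated to those of the
  summands; bilinearity of \<open>f\<close> makes the sum independent of the choice. With
  \<open>tsum_pure\<close> this is the substitution rule of all Sweedler computations.\<close>

lemma tsum_tsum: "bilinear_C f \<Longrightarrow> tsum (tsum t g) f = tsum t (\<lambda>x y. tsum (g x y) f)"
  using tsum_push[OF clinear_tensor_lift, of f t g] by (simp add: tsum_eq_lift)

lemma tsum_tensor [simp]: "tsum t (\<lambda>x y. x \<otimes> y) = t"
  using tensor_rep[of t] by (simp add: tsum_def)

text \<open>The curried forms are needed because the simplifier eta-contracts the summands of \<^const>\<open>tsum\<close>.\<close>

lemma curried_linearity:
  "(\<otimes>) (a + a') = (\<lambda>b. a \<otimes> b + a' \<otimes> b)"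
  "(\<otimes>) (c *\<^sub>C a) = (\<lambda>b. c *\<^sub>C (a \<otimes> b))"
  "(\<otimes>) 0 = (\<lambda>b. 0)"
  "(*) (r + r' :: 'r::complex_algebra_1) = (\<lambda>s. r * s + r' * s)"
  "(*) (c *\<^sub>C r) = (\<lambda>s. c *\<^sub>C (r * s))"
  by (simp_all add: fun_eq_iff tensor_add_left tensor_scaleC_left distrib_right)

lemmas linearity_simps = curried_linearity distrib_left distrib_right tensor_add_left tensor_add_right
  tensor_scaleC_left tensor_scaleC_right scaleC_add_left scaleC_add_right scaleC_complex_def
  tsum_add_fun tsum_scaleC_fun tsum_add tsum_scaleC bilinear_C_def clinear_on_def mult.assoc mult.commute[of _ "_::complex"]

lemma tensor_map_eq_tsum: "clinear f \<Longrightarrow> clinear g \<Longrightarrow> tensor_map f g t = tsum t (\<lambda>x y. f x \<otimes> g y)"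
  unfolding tensor_map_on_def
  by (rule tsum_eq_lift) (simp add: linearity_simps)

lemma times_tensor_eq_tsum: "s * t = tsum s (\<lambda>a b. tsum t (\<lambda>a' b'. (a * a') \<otimes> (b * b')))"
  unfolding times_tensor_def
  by (simp add: tsum_eq_lift bilinear_C_tensor_mult) (rule tsum_eq_lift, simp add: linearity_simps)

lemma tensor_mult_pure [simp]: "(a \<otimes> b) * (c \<otimes> d) = (a * c) \<otimes> (b * d)"
  by (simp add: times_tensor_eq_tsum tsum_pure linearity_simps)

lemma tensor_flip_eq_tsum: "tensor_flip t = tsum t (\<lambda>x y. y \<otimes> x)"
  unfolding tensor_flip_def by (rule tsum_eq_lift) (simp add: linearity_simps)

lemma tensor_assoc_eq_tsum:
  fixes t :: "('a::complex_vector, ('b::complex_vector, 'c::complex_vector) tensor) tensor"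
  shows "tensor_assoc t = tsum t (\<lambda>a u. tsum u (\<lambda>b c. (a \<otimes> b) \<otimes> c))"
proof -
  have "tensor_lift (\<lambda>(b::'b) (c::'c). (a \<otimes> b) \<otimes> c) = (\<lambda>u. tsum u (\<lambda>b c. (a \<otimes> b) \<otimes> c))" for a :: 'a
    by (rule ext, rule tsum_eq_lift) (simp add: linearity_simps)
  then show ?thesis
    unfolding tensor_assoc_def by (subst tsum_eq_lift) (simp_all add: linearity_simps)
qed

text \<open>In the applications \<open>f\<close> is built from maps that are linear only on
  \<open>U\<close> and \<open>V\<close>, and \<open>g\<close> from total linear maps with the same
  values there.\<close>

lemma tensor_lift_on_eq:
  assumes "csubspace U" "csubspace V" "t \<in> U \<otimes>\<^sub>s V" "bilinear_C g"
    and "\<And>u v. u \<in> U \<Longrightarrow> v \<in> V \<Longrightarrow> f u v = g u v"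
  shows "tensor_lift_on U V f t = tsum t g"
proof -
  have "tensor_lift_on U V f t = tsum t f"
    by (rule tensor_lift_on_eq_tsum[OF assms(1-3)])
      (use assms(1,2,4,5) in \<open>auto simp: bilinear_C_def clinear_on_def complex_vector.subspace_add complex_vector.subspace_scale\<close>)
  also have "\<dots> = tsum t g" by (rule tsum_cong[OF assms(1-3,5)])
  finally show ?thesis .
qed

section \<open>Hopf algebras with bijective antipode\<close>

text \<open>The two conditions are the ones under which the inner sums in the two nestings of an
  iterated coproduct do not depend on representations.\<close>

definition trilinear :: "('a::complex_vector \<Rightarrow> 'b::complex_vector \<Rightarrow> 'c::complex_vector \<Rightarrow> 'd::complex_vector) \<Rightarrow> bool" where
  "trilinear f \<longleftrightarrow> (\<forall>x. bilinear_C (f x)) \<and> (\<forall>z. bilinear_C (\<lambda>x y. f x y z))"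

lemma subalgebraD:
  assumes "subalgebra A"
  shows "csubspace A" "1 \<in> A" "\<And>x y. x \<in> A \<Longrightarrow> y \<in> A \<Longrightarrow> x * y \<in> A"
    "\<And>x y. x \<in> A \<Longrightarrow> y \<in> A \<Longrightarrow> x + y \<in> A" "\<And>c x. x \<in> A \<Longrightarrow> c *\<^sub>C x \<in> A" "0 \<in> A"
    "\<And>x y. x \<in> A \<Longrightarrow> y \<in> A \<Longrightarrow> x - y \<in> A"
  using assms by (auto simp: subalgebra_def intro: complex_vector.subspace_add complex_vector.subspace_scale
      complex_vector.subspace_0 complex_vector.subspace_diff)

lemma subalgebra_tensor_set:
  assumes A: "subalgebra A" and B: "subalgebra B"
  shows "subalgebra (A \<otimes>\<^sub>s B)"
proof -
  have "s * t \<in> A \<otimes>\<^sub>s B" if s: "s \<in> A \<otimes>\<^sub>s B" and t: "t \<in> A \<otimes>\<^sub>s B" for s t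
  proof (rule clinear_image_tensor_set[of "\<lambda>s. s * t", OF _ s csubspace_tensor_set])
    fix a b assume ab: "a \<in> A" "b \<in> B"
    show "(a \<otimes> b) * t \<in> A \<otimes>\<^sub>s B"
      by (rule clinear_image_tensor_set[OF _ t csubspace_tensor_set])
        (use ab A B in \<open>auto simp: linearity_simps intro!: tensor_mem dest: subalgebraD\<close>)
  qed (simp add: linearity_simps)
  moreover have "1 \<in> A \<otimes>\<^sub>s B"
    unfolding one_tensor_def using A B by (intro tensor_mem subalgebraD)
  ultimately show ?thesis by (simp add: subalgebra_def csubspace_tensor_set)
qed

text \<open>
  The structure maps are total linear maps, of which only the values on \<open>H\<close> matter; they arise from maps on \<open>H\<close>
  by composition with a linear projection onto \<open>H\<close>.
\<close>
locale hopf =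
  fixes H :: "'a::complex_algebra_1 set"
    and \<Delta> :: "'a \<Rightarrow> ('a, 'a) tensor" and \<epsilon> :: "'a \<Rightarrow> complex" and S Si :: "'a \<Rightarrow> 'a"
  assumes subalg: "subalgebra H"
    and lin: "clinear \<Delta>" "clinear \<epsilon>" "clinear S" "clinear Si"
    and \<Delta>_mem: "h \<in> H \<Longrightarrow> \<Delta> h \<in> H \<otimes>\<^sub>s H"
    and coassoc_map: "h \<in> H \<Longrightarrow> tensor_map \<Delta> id (\<Delta> h) = tensor_assoc (tensor_map id \<Delta> (\<Delta> h))"
    and counit_l: "h \<in> H \<Longrightarrow> tsum (\<Delta> h) (\<lambda>x y. \<epsilon> x *\<^sub>C y) = h"
    and counit_r: "h \<in> H \<Longrightarrow> tsum (\<Delta> h) (\<lambda>x y. \<epsilon> y *\<^sub>C x) = h"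
    and \<Delta>_1: "\<Delta> 1 = 1" and \<Delta>_mult: "x \<in> H \<Longrightarrow> y \<in> H \<Longrightarrow> \<Delta> (x * y) = \<Delta> x * \<Delta> y"
    and \<epsilon>_1: "\<epsilon> 1 = 1" and \<epsilon>_mult: "x \<in> H \<Longrightarrow> y \<in> H \<Longrightarrow> \<epsilon> (x * y) = \<epsilon> x * \<epsilon> y"
    and S_mem: "h \<in> H \<Longrightarrow> S h \<in> H" and Si_mem: "h \<in> H \<Longrightarrow> Si h \<in> H"
    and antipode_l: "h \<in> H \<Longrightarrow> tsum (\<Delta> h) (\<lambda>x y. S x * y) = \<epsilon> h *\<^sub>C 1"
    and antipode_r: "h \<in> H \<Longrightarrow> tsum (\<Delta> h) (\<lambda>x y. x * S y) = \<epsilon> h *\<^sub>C 1"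
    and S_Si: "h \<in> H \<Longrightarrow> S (Si h) = h" and Si_S: "h \<in> H \<Longrightarrow> Si (S h) = h"
begin

lemmas H_rules = subalgebraD[OF subalg] S_mem Si_mem

lemmas hlin = lin[THEN clinear_add] lin[THEN clinear_scaleC]

lemma \<Delta>_cong:
  assumes "h \<in> H" "\<And>x y. x \<in> H \<Longrightarrow> y \<in> H \<Longrightarrow> f x y = g x y"
  shows "tsum (\<Delta> h) f = tsum (\<Delta> h) g"
  by (rule tsum_cong[OF H_rules(1) H_rules(1) \<Delta>_mem]) (use assms in auto)

text \<open>The identity of tensors is turned into an identity of iterated sums by evaluating
  \<open>f\<close> on the three legs of both sides.\<close>

lemma coassoc:
  assumes h: "h \<in> H" and f: "trilinear f"
  shows "tsum (\<Delta> h) (\<lambda>x z. tsum (\<Delta> x) (\<lambda>a b. f a b z)) = tsum (\<Delta> h) (\<lambda>a y. tsum (\<Delta> y) (\<lambda>b z. f a b z))"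
proof -
  have f1: "bilinear_C (f x)" and f2: "bilinear_C (\<lambda>x y. f x y z)" for x z
    using f by (auto simp: trilinear_def)
  note fl = f1[unfolded bilinear_C_def clinear_on_def, simplified] f2[unfolded bilinear_C_def clinear_on_def, simplified]
  \<comment> \<open>Evaluation of \<open>f\<close> on a tensor bracketed to the left.\<close>
  define G where "G = (\<lambda>t. tsum t (\<lambda>u z. tsum u (\<lambda>a b. f a b z)))"
  have bil: "bilinear_C (\<lambda>u z. tsum u (\<lambda>a b. f a b z))"
    by (rule bilinear_CI) (simp_all add: tsum_add tsum_scaleC f2 fl tsum_add_fun tsum_scaleC_fun)
  have "G (tensor_map \<Delta> id (\<Delta> h)) = tsum (\<Delta> h) (\<lambda>x z. tsum (\<Delta> x) (\<lambda>a b. f a b z))"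
    unfolding G_def tensor_map_eq_tsum[OF lin(1) clinearI[of id, simplified]]
    by (simp add: tsum_tsum[OF bil] tsum_pure[OF bil])
  moreover have "G (tensor_assoc (tensor_map id \<Delta> (\<Delta> h))) = tsum (\<Delta> h) (\<lambda>a y. tsum (\<Delta> y) (\<lambda>b z. f a b z))"
    unfolding G_def tensor_assoc_eq_tsum tensor_map_eq_tsum[OF clinearI[of id, simplified] lin(1)]
    by (simp add: tsum_tsum tsum_pure bil f1 f2 linearity_simps)
  ultimately show ?thesis by (simp add: coassoc_map[OF h])
qed

lemma counit_left: "h \<in> H \<Longrightarrow> clinear g \<Longrightarrow> tsum (\<Delta> h) (\<lambda>x y. \<epsilon> x *\<^sub>C g y) = g h"
  using tsum_push[of g "\<Delta> h" "\<lambda>x y. \<epsilon> x *\<^sub>C y"] by (simp add: counit_l clinear_scaleC)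

lemma counit_right: "h \<in> H \<Longrightarrow> clinear g \<Longrightarrow> tsum (\<Delta> h) (\<lambda>x y. \<epsilon> y *\<^sub>C g x) = g h"
  using tsum_push[of g "\<Delta> h" "\<lambda>x y. \<epsilon> y *\<^sub>C x"] by (simp add: counit_r clinear_scaleC)

text \<open>In the convolution algebra a left and a right inverse of \<open>K\<close> coincide:
  \<open>F = F * (K * G) = (F * K) * G = G\<close>, with \<epsilon> as unit.\<close>

lemma convolution_inverse_unique:
  fixes F G K :: "'a \<Rightarrow> 'b::complex_algebra_1"
  assumes lin': "clinear F" "clinear K" "clinear G"
    and l: "\<And>h. h \<in> H \<Longrightarrow> tsum (\<Delta> h) (\<lambda>x y. F x * K y) = \<epsilon> h *\<^sub>C 1"
    and r: "\<And>h. h \<in> H \<Longrightarrow> tsum (\<Delta> h) (\<lambda>x y. K x * G y) = \<epsilon> h *\<^sub>C 1"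
    and h: "h \<in> H"
  shows "F h = G h"
proof -
  note L = lin'[THEN clinear_add] lin'[THEN clinear_scaleC]
  have "F h = tsum (\<Delta> h) (\<lambda>x y. F x * (\<epsilon> y *\<^sub>C 1))"
    by (simp add: counit_right[OF h lin'(1)])
  also have "\<dots> = tsum (\<Delta> h) (\<lambda>x y. F x * tsum (\<Delta> y) (\<lambda>a b. K a * G b))"
    by (rule \<Delta>_cong[OF h]) (simp add: r)
  also have "\<dots> = tsum (\<Delta> h) (\<lambda>x y. tsum (\<Delta> y) (\<lambda>a b. F x * K a * G b))"
    by (simp add: mult.assoc tsum_mult_left)
  also have "\<dots> = tsum (\<Delta> h) (\<lambda>x y. tsum (\<Delta> x) (\<lambda>a b. F a * K b * G y))"
    by (rule coassoc[OF h, symmetric]) (simp add: trilinear_def linearity_simps L)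
  also have "\<dots> = tsum (\<Delta> h) (\<lambda>x y. tsum (\<Delta> x) (\<lambda>a b. F a * K b) * G y)"
    by (simp add: tsum_mult_right)
  also have "\<dots> = tsum (\<Delta> h) (\<lambda>x y. (\<epsilon> x *\<^sub>C 1) * G y)"
    by (rule \<Delta>_cong[OF h]) (simp add: l)
  also have "\<dots> = G h"
    by (simp add: counit_left[OF h lin'(3)])
  finally show ?thesis .
qed

text \<open>Both sides are convolution inverses of \<Delta> as a map into
  \<open>H \<otimes> H\<close>: the left side because \<Delta> is multiplicative, the right side
  because two antipode cancellations occur one inside the other.\<close>

lemma \<Delta>_S:
  assumes "h \<in> H"
  shows "\<Delta> (S h) = tsum (\<Delta> h) (\<lambda>x y. S y \<otimes> S x)"
proof (rule convolution_inverse_unique[of "\<lambda>h. \<Delta> (S h)" \<Delta> "\<lambda>h. tsum (\<Delta> h) (\<lambda>x y. S y \<otimes> S x)", OF _ _ _ _ _ assms])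
  fix h assume h: "h \<in> H"
  have "tsum (\<Delta> h) (\<lambda>x y. \<Delta> (S x) * \<Delta> y) = tsum (\<Delta> h) (\<lambda>x y. \<Delta> (S x * y))"
    by (rule \<Delta>_cong[OF h]) (simp add: \<Delta>_mult H_rules)
  also have "\<dots> = \<Delta> (tsum (\<Delta> h) (\<lambda>x y. S x * y))"
    by (rule tsum_push[OF lin(1), symmetric])
  finally show "tsum (\<Delta> h) (\<lambda>x y. \<Delta> (S x) * \<Delta> y) = \<epsilon> h *\<^sub>C 1"
    by (simp add: antipode_l[OF h] hlin \<Delta>_1)
  have "tsum (\<Delta> h) (\<lambda>x y. \<Delta> x * tsum (\<Delta> y) (\<lambda>c d. S d \<otimes> S c)) =
      tsum (\<Delta> h) (\<lambda>x y. tsum (\<Delta> x) (\<lambda>a b. tsum (\<Delta> y) (\<lambda>c d. (a * S d) \<otimes> (b * S c))))"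
    by (simp add: times_tensor_eq_tsum tsum_tsum tsum_pure linearity_simps hlin)
  also have "\<dots> = tsum (\<Delta> h) (\<lambda>a r. tsum (\<Delta> r) (\<lambda>b y. tsum (\<Delta> y) (\<lambda>c d. (a * S d) \<otimes> (b * S c))))"
    by (rule coassoc[OF h]) (simp add: trilinear_def linearity_simps hlin)
  also have "\<dots> = tsum (\<Delta> h) (\<lambda>a r. (a * S r) \<otimes> 1)"
  proof (rule \<Delta>_cong[OF h])
    \<comment> \<open>The inner legs \<open>b\<close> and \<open>c\<close> are brought into one
      coproduct, where \<open>b * S c\<close> cancels; \<open>a * S r\<close> remains for the second
      cancellation.\<close>
    fix a r assume r: "r \<in> H"
    have "tsum (\<Delta> r) (\<lambda>b y. tsum (\<Delta> y) (\<lambda>c d. (a * S d) \<otimes> (b * S c))) =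
        tsum (\<Delta> r) (\<lambda>w d. tsum (\<Delta> w) (\<lambda>b c. (a * S d) \<otimes> (b * S c)))"
      by (rule coassoc[OF r, symmetric]) (simp add: trilinear_def linearity_simps hlin)
    also have "\<dots> = tsum (\<Delta> r) (\<lambda>w d. \<epsilon> w *\<^sub>C ((a * S d) \<otimes> 1))"
      by (rule \<Delta>_cong[OF r]) (simp add: tsum_tensor_left antipode_r tensor_scaleC_right)
    also have "\<dots> = (a * S r) \<otimes> 1"
      by (rule counit_left[OF r]) (simp add: linearity_simps hlin)
    finally show "tsum (\<Delta> r) (\<lambda>b y. tsum (\<Delta> y) (\<lambda>c d. (a * S d) \<otimes> (b * S c))) = (a * S r) \<otimes> 1" .
  qed
  also have "\<dots> = \<epsilon> h *\<^sub>C 1"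
    by (simp add: tsum_tensor_right antipode_r[OF h] one_tensor_def tensor_scaleC_left)
  finally show "tsum (\<Delta> h) (\<lambda>x y. \<Delta> x * tsum (\<Delta> y) (\<lambda>c d. S d \<otimes> S c)) = \<epsilon> h *\<^sub>C 1" .
qed (simp_all add: linearity_simps hlin)

lemma S_1: "S 1 = 1"
  using antipode_l[of 1] by (simp add: H_rules \<Delta>_1 \<epsilon>_1 one_tensor_def tsum_pure linearity_simps hlin)

lemma \<Delta>_mult_sum:
  assumes "x \<in> H" "y \<in> H" "bilinear_C f"
  shows "tsum (\<Delta> (x * y)) f = tsum (\<Delta> x) (\<lambda>a b. tsum (\<Delta> y) (\<lambda>c d. f (a * c) (b * d)))"
  by (simp add: \<Delta>_mult assms times_tensor_eq_tsum tsum_tsum tsum_pure)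

text \<open>Uniqueness of the convolution inverse of multiplication on \<open>H \<otimes> H\<close>,
  written out: in Sweedler notation \<open>S (x * y)\<close> is the sum of
  \<open>S(x1 y1) x2 y2 S(y3) S(x3)\<close>, which collapses from the front to
  \<open>S y * S x\<close>.\<close>

lemma S_mult:
  assumes x: "x \<in> H" and y: "y \<in> H"
  shows "S (x * y) = S y * S x"
proof -
  \<comment> \<open>Collapse of the tail: \<open>c * S d\<close> cancels between \<open>a\<close>
    and \<open>S b\<close>, and then \<open>a * S b\<close> does.\<close>
  have e: "tsum (\<Delta> X) (\<lambda>a b. tsum (\<Delta> Y) (\<lambda>c d. a * c * S d * S b)) = (\<epsilon> X * \<epsilon> Y) *\<^sub>C 1"
    if X: "X \<in> H" and Y: "Y \<in> H" for X Y
  proof -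
    have "tsum (\<Delta> X) (\<lambda>a b. tsum (\<Delta> Y) (\<lambda>c d. a * c * S d * S b)) =
        tsum (\<Delta> X) (\<lambda>a b. a * tsum (\<Delta> Y) (\<lambda>c d. c * S d) * S b)"
      by (simp add: mult.assoc flip: tsum_mult_left tsum_mult_right)
    then show ?thesis by (simp add: antipode_r[OF X] antipode_r[OF Y] tsum_scaleC_fun mult.commute)
  qed
  have e': "tsum (\<Delta> X) (\<lambda>a b. tsum (\<Delta> Y) (\<lambda>c d. S (a * c) * (b * d))) = (\<epsilon> X * \<epsilon> Y) *\<^sub>C 1"
    if X: "X \<in> H" and Y: "Y \<in> H" for X Y
    using antipode_l[of "X * Y"] \<Delta>_mult_sum[OF X Y, of "\<lambda>x y. S x * y"]
    by (simp add: X Y H_rules \<epsilon>_mult linearity_simps hlin)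
  have 1: "tsum (\<Delta> y) (\<lambda>c d. (\<epsilon> b * \<epsilon> d) *\<^sub>C S (a * c)) = \<epsilon> b *\<^sub>C S (a * y)" for a b
  proof -
    have "tsum (\<Delta> y) (\<lambda>c d. (\<epsilon> b * \<epsilon> d) *\<^sub>C S (a * c)) = \<epsilon> b *\<^sub>C tsum (\<Delta> y) (\<lambda>c d. \<epsilon> d *\<^sub>C S (a * c))"
      unfolding tsum_scaleC_fun[symmetric] by simp
    also have "tsum (\<Delta> y) (\<lambda>c d. \<epsilon> d *\<^sub>C S (a * c)) = S (a * y)"
      by (rule counit_right[OF y, of "\<lambda>c. S (a * c)"]) (simp add: linearity_simps hlin)
    finally show ?thesis .
  qed
  have 2: "tsum (\<Delta> y) (\<lambda>Y s. (\<epsilon> X * \<epsilon> Y) *\<^sub>C (S s * S q)) = \<epsilon> X *\<^sub>C (S y * S q)" for X q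
  proof -
    have "tsum (\<Delta> y) (\<lambda>Y s. (\<epsilon> X * \<epsilon> Y) *\<^sub>C (S s * S q)) = \<epsilon> X *\<^sub>C tsum (\<Delta> y) (\<lambda>Y s. \<epsilon> Y *\<^sub>C (S s * S q))"
      unfolding tsum_scaleC_fun[symmetric] by simp
    also have "tsum (\<Delta> y) (\<lambda>Y s. \<epsilon> Y *\<^sub>C (S s * S q)) = S y * S q"
      by (rule counit_left[OF y, of "\<lambda>s. S s * S q"]) (simp add: linearity_simps hlin)
    finally show ?thesis .
  qed
  have "S (x * y) = tsum (\<Delta> x) (\<lambda>a b. \<epsilon> b *\<^sub>C S (a * y))"
    by (rule counit_right[OF x, of "\<lambda>a. S (a * y)", symmetric]) (simp add: linearity_simps hlin)
  also have "\<dots> = tsum (\<Delta> x) (\<lambda>a b. tsum (\<Delta> y) (\<lambda>c d. S (a * c) * ((\<epsilon> b * \<epsilon> d) *\<^sub>C 1)))"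
    by (simp add: 1)
  \<comment> \<open>The counits of \<open>b\<close> and \<open>d\<close> are expanded into the tail
    product, read from right to left.\<close>
  also have "\<dots> = tsum (\<Delta> x) (\<lambda>a b. tsum (\<Delta> y) (\<lambda>c d.
      S (a * c) * tsum (\<Delta> b) (\<lambda>p q. tsum (\<Delta> d) (\<lambda>r s. p * r * S s * S q))))"
    by (intro \<Delta>_cong x y) (simp add: e)
  also have "\<dots> = tsum (\<Delta> x) (\<lambda>a b. tsum (\<Delta> b) (\<lambda>p q. tsum (\<Delta> y) (\<lambda>c d. tsum (\<Delta> d) (\<lambda>r s.
      S (a * c) * (p * r) * S s * S q))))"
  proof (rule \<Delta>_cong[OF x])
    fix a b
    show "tsum (\<Delta> y) (\<lambda>c d. S (a * c) * tsum (\<Delta> b) (\<lambda>p q. tsum (\<Delta> d) (\<lambda>r s. p * r * S s * S q))) =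
        tsum (\<Delta> b) (\<lambda>p q. tsum (\<Delta> y) (\<lambda>c d. tsum (\<Delta> d) (\<lambda>r s. S (a * c) * (p * r) * S s * S q)))"
      unfolding tsum_mult_left[symmetric] mult.assoc by (rule tsum_commute)
  qed
  \<comment> \<open>Coassociativity in \<open>x\<close> and then in \<open>y\<close> groups
    \<open>p * r\<close> with \<open>S (a * c)\<close>, so that the front of the product can
    collapse.\<close>
  also have "\<dots> = tsum (\<Delta> x) (\<lambda>X q. tsum (\<Delta> X) (\<lambda>a p. tsum (\<Delta> y) (\<lambda>c d. tsum (\<Delta> d) (\<lambda>r s.
      S (a * c) * (p * r) * S s * S q))))"
    by (rule coassoc[OF x, symmetric]) (simp add: trilinear_def linearity_simps hlin)
  also have "\<dots> = tsum (\<Delta> x) (\<lambda>X q. tsum (\<Delta> X) (\<lambda>a p. tsum (\<Delta> y) (\<lambda>Y s. tsum (\<Delta> Y) (\<lambda>c r.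
      S (a * c) * (p * r) * S s * S q))))"
    by (rule \<Delta>_cong[OF x], erule \<Delta>_cong, rule coassoc[OF y, symmetric]) (simp add: trilinear_def linearity_simps hlin)
  also have "\<dots> = tsum (\<Delta> x) (\<lambda>X q. tsum (\<Delta> y) (\<lambda>Y s. tsum (\<Delta> X) (\<lambda>a p. tsum (\<Delta> Y) (\<lambda>c r.
      S (a * c) * (p * r) * S s * S q))))"
    by (subst tsum_commute) (rule refl)
  also have "\<dots> = tsum (\<Delta> x) (\<lambda>X q. tsum (\<Delta> y) (\<lambda>Y s. tsum (\<Delta> X) (\<lambda>a p. tsum (\<Delta> Y) (\<lambda>c r.
      S (a * c) * (p * r))) * (S s * S q)))"
    unfolding tsum_mult_right[symmetric] mult.assoc ..
  also have "\<dots> = tsum (\<Delta> x) (\<lambda>X q. tsum (\<Delta> y) (\<lambda>Y s. (\<epsilon> X * \<epsilon> Y) *\<^sub>C (S s * S q)))"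
    by (intro \<Delta>_cong x y) (simp add: e')
  also have "\<dots> = tsum (\<Delta> x) (\<lambda>X q. \<epsilon> X *\<^sub>C (S y * S q))"
    by (simp only: 2)
  also have "\<dots> = S y * S x"
    by (rule counit_left[OF x]) (simp add: linearity_simps hlin)
  finally show ?thesis .
qed

lemma S_inj: "x \<in> H \<Longrightarrow> y \<in> H \<Longrightarrow> S x = S y \<Longrightarrow> x = y"
  by (metis Si_S)

lemma \<Delta>_sum_mem:
  assumes "h \<in> H" "csubspace W" "\<And>x y. x \<in> H \<Longrightarrow> y \<in> H \<Longrightarrow> f x y \<in> W"
  shows "tsum (\<Delta> h) f \<in> W"
  by (rule tsum_mem[OF H_rules(1) H_rules(1) \<Delta>_mem[OF assms(1)] assms(2)]) (use assms in auto)

text \<open>\<open>S\<close> is injective and reverses products, and it sends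
  \<open>Si y * x\<close> to \<open>S x * y\<close>. Note the order of the legs: these identities
  for \<open>Si\<close> are what inverts the entwining.\<close>

lemma antipode_inv_l:
  assumes h: "h \<in> H"
  shows "tsum (\<Delta> h) (\<lambda>x y. Si y * x) = \<epsilon> h *\<^sub>C 1"
proof (rule S_inj)
  have "S (tsum (\<Delta> h) (\<lambda>x y. Si y * x)) = tsum (\<Delta> h) (\<lambda>x y. S (Si y * x))"
    by (rule tsum_push[OF lin(3)])
  also have "\<dots> = tsum (\<Delta> h) (\<lambda>x y. S x * y)"
    by (rule \<Delta>_cong[OF h]) (simp add: S_mult Si_mem S_Si)
  finally show "S (tsum (\<Delta> h) (\<lambda>x y. Si y * x)) = S (\<epsilon> h *\<^sub>C 1)"
    by (simp add: antipode_l[OF h] hlin S_1)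
qed (use h H_rules in \<open>auto intro!: \<Delta>_sum_mem\<close>)

lemma antipode_inv_r:
  assumes h: "h \<in> H"
  shows "tsum (\<Delta> h) (\<lambda>x y. y * Si x) = \<epsilon> h *\<^sub>C 1"
proof (rule S_inj)
  have "S (tsum (\<Delta> h) (\<lambda>x y. y * Si x)) = tsum (\<Delta> h) (\<lambda>x y. S (y * Si x))"
    by (rule tsum_push[OF lin(3)])
  also have "\<dots> = tsum (\<Delta> h) (\<lambda>x y. x * S y)"
    by (rule \<Delta>_cong[OF h]) (simp add: S_mult Si_mem S_Si)
  finally show "S (tsum (\<Delta> h) (\<lambda>x y. y * Si x)) = S (\<epsilon> h *\<^sub>C 1)"
    by (simp add: antipode_r[OF h] hlin S_1)
qed (use h H_rules in \<open>auto intro!: \<Delta>_sum_mem\<close>)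

end

section \<open>Quotient coalgebras with a bicolinear splitting\<close>

text \<open>\<open>C\<close> is a whole type. \<open>\<pi>_mult\<close> says that
  \<open>\<pi> (i c * k)\<close> is a right action of \<open>H\<close> on \<open>C\<close>
  compatible with \<pi>, the trace left by a right ideal; \<open>\<pi>_counit\<close> says that
  \<epsilon> descends. The colinearity laws are stated at \<open>\<pi> h\<close>, so that the
  comultiplication of \<open>C\<close> can be written through that of \<open>h\<close>.\<close>

locale hopf_quotient = hopf H \<Delta> \<epsilon> S Si
  for H :: "'a::complex_algebra_1 set" and \<Delta> \<epsilon> S Si +
  fixes \<pi> :: "'a \<Rightarrow> 'c::complex_vector" and i :: "'c \<Rightarrow> 'a"
  assumes lin_\<pi>: "clinear \<pi>" "clinear i"
    and i_mem: "i c \<in> H" and \<pi>_i: "\<pi> (i c) = c"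
    and \<pi>_mult: "h \<in> H \<Longrightarrow> k \<in> H \<Longrightarrow> \<pi> (i (\<pi> h) * k) = \<pi> (h * k)"
    and \<pi>_counit: "h \<in> H \<Longrightarrow> \<epsilon> (i (\<pi> h)) = \<epsilon> h"
    and colinear_right_map: "h \<in> H \<Longrightarrow> tsum (\<Delta> (i (\<pi> h))) (\<lambda>x y. x \<otimes> \<pi> y) = tsum (\<Delta> h) (\<lambda>x y. i (\<pi> x) \<otimes> \<pi> y)"
    and colinear_left_map: "h \<in> H \<Longrightarrow> tsum (\<Delta> (i (\<pi> h))) (\<lambda>x y. \<pi> x \<otimes> y) = tsum (\<Delta> h) (\<lambda>x y. \<pi> x \<otimes> i (\<pi> y))"
begin

lemmas qlin = hlin lin_\<pi>[THEN clinear_add] lin_\<pi>[THEN clinear_scaleC]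

lemma colinear_right:
  assumes "h \<in> H" "bilinear_C f"
  shows "tsum (\<Delta> (i (\<pi> h))) (\<lambda>x y. f x (\<pi> y)) = tsum (\<Delta> h) (\<lambda>x y. f (i (\<pi> x)) (\<pi> y))"
  using arg_cong[OF colinear_right_map[OF assms(1)], of "\<lambda>t. tsum t f"]
  by (simp add: tsum_tsum tsum_pure assms)

lemma colinear_left:
  assumes "h \<in> H" "bilinear_C f"
  shows "tsum (\<Delta> (i (\<pi> h))) (\<lambda>x y. f (\<pi> x) y) = tsum (\<Delta> h) (\<lambda>x y. f (\<pi> x) (i (\<pi> y)))"
  using arg_cong[OF colinear_left_map[OF assms(1)], of "\<lambda>t. tsum t f"]
  by (simp add: tsum_tsum tsum_pure assms)

definition \<delta> :: "'c \<Rightarrow> ('c, 'c) tensor" where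
  "\<delta> c = tsum (\<Delta> (i c)) (\<lambda>x y. \<pi> x \<otimes> \<pi> y)"

text \<open>Independence of the representative: right colinearity of \<open>i\<close> replaces the
  coproduct of \<open>i (\<pi> h)\<close> by that of \<open>h\<close>, and the surplus
  \<open>i\<close> is cancelled by \<pi>.\<close>

lemma \<delta>_\<pi>: "h \<in> H \<Longrightarrow> \<delta> (\<pi> h) = tsum (\<Delta> h) (\<lambda>x y. \<pi> x \<otimes> \<pi> y)"
  unfolding \<delta>_def by (subst colinear_right) (simp_all add: \<pi>_i linearity_simps qlin)

lemma coalgebra_quotient: "coalgebra UNIV \<delta> (\<lambda>c. \<epsilon> (i c))"
proof -
  have l\<delta>: "clinear \<delta>" by (simp add: \<delta>_def linearity_simps qlin)
  note L = qlin clinear_add[OF l\<delta>] clinear_scaleC[OF l\<delta>]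
  have lid: "clinear id" by (simp add: clinear_on_def)
  have ca: "tensor_map \<delta> id (\<delta> c) = tensor_assoc (tensor_map id \<delta> (\<delta> c))" for c
  proof -
    have "tensor_map \<delta> id (\<delta> c) = tsum (\<Delta> (i c)) (\<lambda>x y. \<delta> (\<pi> x) \<otimes> \<pi> y)"
      by (simp add: \<delta>_def[of c] tensor_map_eq_tsum l\<delta> lid tsum_tsum tsum_pure linearity_simps L)
    also have "\<dots> = tsum (\<Delta> (i c)) (\<lambda>x y. tsum (\<Delta> x) (\<lambda>a b. (\<pi> a \<otimes> \<pi> b) \<otimes> \<pi> y))"
      by (rule \<Delta>_cong[OF i_mem]) (simp add: \<delta>_\<pi> tsum_tensor_right)
    also have "\<dots> = tsum (\<Delta> (i c)) (\<lambda>x y. tsum (\<Delta> y) (\<lambda>a b. (\<pi> x \<otimes> \<pi> a) \<otimes> \<pi> b))"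
      by (rule coassoc[OF i_mem]) (simp add: trilinear_def linearity_simps L)
    also have "\<dots> = tsum (\<Delta> (i c)) (\<lambda>x y. tsum (\<delta> (\<pi> y)) (\<lambda>a b. (\<pi> x \<otimes> a) \<otimes> b))"
      by (rule \<Delta>_cong[OF i_mem]) (simp add: \<delta>_\<pi> tsum_tsum tsum_pure linearity_simps)
    also have "\<dots> = tensor_assoc (tensor_map id \<delta> (\<delta> c))"
      by (simp add: \<delta>_def[of c] tensor_map_eq_tsum tensor_assoc_eq_tsum l\<delta> lid tsum_tsum tsum_pure linearity_simps L)
    finally show ?thesis .
  qed
  have "tensor_lift (\<lambda>y z. \<epsilon> (i y) *\<^sub>C z) (\<delta> c) = c" for c
  proof -
    have "tensor_lift (\<lambda>y z. \<epsilon> (i y) *\<^sub>C z) (\<delta> c) = tsum (\<Delta> (i c)) (\<lambda>x y. \<epsilon> (i (\<pi> x)) *\<^sub>C \<pi> y)"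
      by (simp add: tsum_eq_lift linearity_simps L \<delta>_def tsum_tsum tsum_pure)
    also have "\<dots> = tsum (\<Delta> (i c)) (\<lambda>x y. \<epsilon> x *\<^sub>C \<pi> y)"
      by (rule \<Delta>_cong[OF i_mem]) (simp add: \<pi>_counit)
    finally show ?thesis by (simp add: counit_left[OF i_mem lin_\<pi>(1)] \<pi>_i)
  qed
  moreover have "tensor_lift (\<lambda>y z. \<epsilon> (i z) *\<^sub>C y) (\<delta> c) = c" for c
  proof -
    have "tensor_lift (\<lambda>y z. \<epsilon> (i z) *\<^sub>C y) (\<delta> c) = tsum (\<Delta> (i c)) (\<lambda>x y. \<epsilon> (i (\<pi> y)) *\<^sub>C \<pi> x)"
      by (simp add: tsum_eq_lift linearity_simps L \<delta>_def tsum_tsum tsum_pure)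
    also have "\<dots> = tsum (\<Delta> (i c)) (\<lambda>x y. \<epsilon> y *\<^sub>C \<pi> x)"
      by (rule \<Delta>_cong[OF i_mem]) (simp add: \<pi>_counit)
    finally show ?thesis by (simp add: counit_right[OF i_mem lin_\<pi>(1)] \<pi>_i)
  qed
  ultimately show ?thesis
    unfolding coalgebra_def using l\<delta> ca
    by (simp add: linearity_simps L complex_vector.subspace_UNIV)
qed

lemma group_like_quotient: "group_like \<delta> (\<lambda>c. \<epsilon> (i c)) (\<pi> 1)"
  unfolding group_like_def
  by (simp add: \<delta>_\<pi> \<pi>_counit H_rules \<Delta>_1 \<epsilon>_1 one_tensor_def tsum_pure linearity_simps qlin)

end

section \<open>Comodule algebras with a strong connection\<close>

text \<open>The coaction of \<open>H\<close> is the primitive datum, because multiplicativity can be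
  stated for it; the coaction \<rho> of \<open>C\<close> is derived from it.\<close>

locale comodule_algebra = hopf_quotient H \<Delta> \<epsilon> S Si \<pi> i
  for H :: "'a::complex_algebra_1 set" and \<Delta> \<epsilon> S Si and \<pi> :: "'a \<Rightarrow> 'c::complex_vector" and i +
  fixes P :: "'p::complex_algebra_1 set" and R :: "'p \<Rightarrow> ('p, 'a) tensor"
  assumes subalg_P: "subalgebra P" and lin_R: "clinear R"
    and R_mem: "p \<in> P \<Longrightarrow> R p \<in> P \<otimes>\<^sub>s H"
    and R_coassoc_map: "p \<in> P \<Longrightarrow> tensor_map R id (R p) = tensor_assoc (tensor_map id \<Delta> (R p))"
    and R_counit: "p \<in> P \<Longrightarrow> tsum (R p) (\<lambda>q h. \<epsilon> h *\<^sub>C q) = p"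
    and R_mult: "p \<in> P \<Longrightarrow> q \<in> P \<Longrightarrow> R (p * q) = R p * R q" and R_1: "R 1 = 1"
begin

lemmas P_rules = subalgebraD[OF subalg_P]

lemmas plin = qlin clinear_add[OF lin_R] clinear_scaleC[OF lin_R]

lemma R_cong:
  assumes "p \<in> P" "\<And>q h. q \<in> P \<Longrightarrow> h \<in> H \<Longrightarrow> f q h = g q h"
  shows "tsum (R p) f = tsum (R p) g"
  by (rule tsum_cong[OF P_rules(1) H_rules(1) R_mem]) (use assms in auto)

lemma R_coassoc:
  assumes p: "p \<in> P" and f: "trilinear f"
  shows "tsum (R p) (\<lambda>x z. tsum (R x) (\<lambda>a b. f a b z)) = tsum (R p) (\<lambda>a y. tsum (\<Delta> y) (\<lambda>b z. f a b z))"
proof -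
  have f1: "bilinear_C (f x)" and f2: "bilinear_C (\<lambda>x y. f x y z)" for x z
    using f by (auto simp: trilinear_def)
  note fl = f1[unfolded bilinear_C_def clinear_on_def, simplified] f2[unfolded bilinear_C_def clinear_on_def, simplified]
  define G where "G = (\<lambda>t. tsum t (\<lambda>u z. tsum u (\<lambda>a b. f a b z)))"
  have bil: "bilinear_C (\<lambda>u z. tsum u (\<lambda>a b. f a b z))"
    by (rule bilinear_CI) (simp_all add: tsum_add tsum_scaleC f2 fl tsum_add_fun tsum_scaleC_fun)
  have "G (tensor_map R id (R p)) = tsum (R p) (\<lambda>x z. tsum (R x) (\<lambda>a b. f a b z))"
    unfolding G_def tensor_map_eq_tsum[OF lin_R clinearI[of id, simplified]]
    by (simp add: tsum_tsum[OF bil] tsum_pure[OF bil])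
  moreover have "G (tensor_assoc (tensor_map id \<Delta> (R p))) = tsum (R p) (\<lambda>a y. tsum (\<Delta> y) (\<lambda>b z. f a b z))"
    unfolding G_def tensor_assoc_eq_tsum tensor_map_eq_tsum[OF clinearI[of id, simplified] lin(1)]
    by (simp add: tsum_tsum tsum_pure bil f1 f2 linearity_simps)
  ultimately show ?thesis by (simp add: R_coassoc_map[OF p])
qed

lemma R_counit_sum: "p \<in> P \<Longrightarrow> clinear g \<Longrightarrow> tsum (R p) (\<lambda>q h. \<epsilon> h *\<^sub>C g q) = g p"
  using tsum_push[of g "R p" "\<lambda>q h. \<epsilon> h *\<^sub>C q"] by (simp add: R_counit clinear_scaleC)

lemma R_mult_sum:
  assumes "p \<in> P" "q \<in> P" "bilinear_C f"
  shows "tsum (R (p * q)) f = tsum (R p) (\<lambda>a h. tsum (R q) (\<lambda>b k. f (a * b) (h * k)))"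
  by (simp add: R_mult assms times_tensor_eq_tsum tsum_tsum tsum_pure)

definition \<rho> :: "'p \<Rightarrow> ('p, 'c) tensor" where
  "\<rho> p = tsum (R p) (\<lambda>q h. q \<otimes> \<pi> h)"

lemma clinear_\<rho>: "clinear \<rho>"
  by (simp add: \<rho>_def linearity_simps plin)

lemma \<rho>_mem: "p \<in> P \<Longrightarrow> \<rho> p \<in> P \<otimes>\<^sub>s UNIV"
  unfolding \<rho>_def
  by (rule tsum_mem[OF P_rules(1) H_rules(1) R_mem csubspace_tensor_set]) (auto intro: tensor_mem)

lemma \<rho>_1: "\<rho> 1 = 1 \<otimes> \<pi> 1"
  by (simp add: \<rho>_def R_1 one_tensor_def tsum_pure linearity_simps plin)

lemma \<rho>_coassoc:
  assumes p: "p \<in> P"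
  shows "tsum (\<rho> p) (\<lambda>q c. \<rho> q \<otimes> c) = tensor_assoc (tsum (\<rho> p) (\<lambda>q c. q \<otimes> \<delta> c))"
proof -
  have bil: "bilinear_C (\<lambda>q c. \<rho> q \<otimes> c)" "bilinear_C (\<lambda>q c. q \<otimes> \<delta> c)"
    by (simp_all add: linearity_simps clinear_add[OF clinear_\<rho>] clinear_scaleC[OF clinear_\<rho>] \<delta>_def plin)
  have "tsum (\<rho> p) (\<lambda>q c. \<rho> q \<otimes> c) = tsum (R p) (\<lambda>q h. \<rho> q \<otimes> \<pi> h)"
    by (subst \<rho>_def) (simp add: tsum_tsum bil tsum_pure)
  also have "\<dots> = tsum (R p) (\<lambda>q h. tsum (R q) (\<lambda>r k. (r \<otimes> \<pi> k) \<otimes> \<pi> h))"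
    by (simp add: \<rho>_def tsum_tensor_right)
  also have "\<dots> = tsum (R p) (\<lambda>q h. tsum (\<Delta> h) (\<lambda>k l. (q \<otimes> \<pi> k) \<otimes> \<pi> l))"
    by (rule R_coassoc[OF p]) (simp add: trilinear_def linearity_simps plin)
  also have "\<dots> = tsum (R p) (\<lambda>q h. tsum (\<delta> (\<pi> h)) (\<lambda>k l. (q \<otimes> k) \<otimes> l))"
    by (rule R_cong[OF p]) (simp add: \<delta>_\<pi> tsum_tsum tsum_pure linearity_simps)
  also have "\<dots> = tensor_assoc (tsum (\<rho> p) (\<lambda>q c. q \<otimes> \<delta> c))"
    by (simp add: \<rho>_def tensor_assoc_eq_tsum bil tsum_tsum tsum_pure linearity_simps plin)
  finally show ?thesis .
qed

lemma right_coaction_\<rho>: "right_coaction P \<delta> (\<lambda>c. \<epsilon> (i c)) \<rho>"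
  unfolding right_coaction_def
proof (intro conjI ballI)
  show "csubspace P" by (rule P_rules)
  show "clinear_on P \<rho>" using clinear_\<rho> by (simp add: clinear_on_def)
  show "\<rho> ` P \<subseteq> P \<otimes>\<^sub>s UNIV" using \<rho>_mem by blast
next
  fix p assume p: "p \<in> P"
  note L = linearity_simps clinear_add[OF clinear_\<rho>] clinear_scaleC[OF clinear_\<rho>] \<delta>_def plin
  have "tensor_map_on P UNIV \<rho> id (\<rho> p) = tsum (\<rho> p) (\<lambda>q c. \<rho> q \<otimes> c)"
    unfolding tensor_map_on_def
    by (rule tensor_lift_on_eq[OF P_rules(1) complex_vector.subspace_UNIV \<rho>_mem[OF p]]) (simp_all add: L)
  moreover have "tensor_map_on P UNIV id \<delta> (\<rho> p) = tsum (\<rho> p) (\<lambda>q c. q \<otimes> \<delta> c)"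
    unfolding tensor_map_on_def
    by (rule tensor_lift_on_eq[OF P_rules(1) complex_vector.subspace_UNIV \<rho>_mem[OF p]]) (simp_all add: L)
  ultimately show "tensor_map_on P UNIV \<rho> id (\<rho> p) = tensor_assoc (tensor_map_on P UNIV id \<delta> (\<rho> p))"
    using \<rho>_coassoc[OF p] by simp
  have "tensor_lift_on P UNIV (\<lambda>q c. \<epsilon> (i c) *\<^sub>C q) (\<rho> p) = tsum (\<rho> p) (\<lambda>q c. \<epsilon> (i c) *\<^sub>C q)"
    by (rule tensor_lift_on_eq[OF P_rules(1) complex_vector.subspace_UNIV \<rho>_mem[OF p]]) (simp_all add: L)
  also have "\<dots> = tsum (R p) (\<lambda>q h. \<epsilon> (i (\<pi> h)) *\<^sub>C q)"
    by (simp add: \<rho>_def tsum_tsum tsum_pure L)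
  also have "\<dots> = tsum (R p) (\<lambda>q h. \<epsilon> h *\<^sub>C q)"
    by (rule R_cong[OF p]) (simp add: \<pi>_counit)
  finally show "tensor_lift_on P UNIV (\<lambda>q c. \<epsilon> (i c) *\<^sub>C q) (\<rho> p) = p"
    by (simp add: R_counit[OF p])
qed

abbreviation "B \<equiv> coinvariants P \<rho>"

text \<open>\<rho> retains only the class of \<open>k\<close>, but \<open>\<pi> (k * h)\<close>
  depends on no more than that class. Hence \<open>R p\<close> acts on the \<open>C\<close>-leg of
  \<open>\<rho> b\<close>.\<close>

lemma \<rho>_mult:
  assumes b: "b \<in> P" and p: "p \<in> P"
  shows "\<rho> (b * p) = tsum (\<rho> b) (\<lambda>a c. tsum (R p) (\<lambda>q h. (a * q) \<otimes> \<pi> (i c * h)))"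
proof -
  have "\<rho> (b * p) = tsum (R b) (\<lambda>a k. tsum (R p) (\<lambda>q h. (a * q) \<otimes> \<pi> (k * h)))"
    unfolding \<rho>_def by (rule R_mult_sum[OF b p]) (simp add: linearity_simps plin)
  also have "\<dots> = tsum (R b) (\<lambda>a k. tsum (R p) (\<lambda>q h. (a * q) \<otimes> \<pi> (i (\<pi> k) * h)))"
    by (intro R_cong b p) (simp add: \<pi>_mult)
  also have "\<dots> = tsum (\<rho> b) (\<lambda>a c. tsum (R p) (\<lambda>q h. (a * q) \<otimes> \<pi> (i c * h)))"
    by (simp add: \<rho>_def tsum_tsum tsum_pure linearity_simps plin)
  finally show ?thesis .
qed

lemma tensor_map_mult_left: "tensor_map (\<lambda>q. b * q :: 'p) id t = tsum t (\<lambda>q c. (b * q) \<otimes> c)"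
  by (subst tensor_map_eq_tsum) (simp_all add: linearity_simps)

text \<open>Membership in \<open>B\<close> quantifies over all \<open>p\<close>; by the product
  formula for \<rho> the behaviour at \<open>1\<close> decides it, since \<open>\<pi> 1\<close>
  acted on by \<open>h\<close> gives \<open>\<pi> h\<close>.\<close>

lemma coinvariantI:
  assumes b: "b \<in> P" "\<rho> b = b \<otimes> \<pi> 1"
  shows "b \<in> B"
  unfolding coinvariants_def
proof (intro CollectI conjI ballI)
  fix p assume p: "p \<in> P"
  have "\<rho> (b * p) = tsum (R p) (\<lambda>q h. (b * q) \<otimes> \<pi> (i (\<pi> 1) * h))"
    by (simp add: \<rho>_mult[OF b(1) p] b(2) tsum_pure linearity_simps plin)
  also have "\<dots> = tsum (R p) (\<lambda>q h. (b * q) \<otimes> \<pi> h)"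
    by (rule R_cong[OF p]) (simp add: \<pi>_mult H_rules)
  also have "\<dots> = tensor_map (\<lambda>q. b * q) id (\<rho> p)"
    by (simp add: tensor_map_mult_left \<rho>_def tsum_tsum tsum_pure linearity_simps plin)
  finally show "\<rho> (b * p) = tensor_map (\<lambda>q. b * q) id (\<rho> p)" .
qed fact

lemma coinvariantD:
  assumes "b \<in> B"
  shows "b \<in> P" "p \<in> P \<Longrightarrow> \<rho> (b * p) = tsum (\<rho> p) (\<lambda>q c. (b * q) \<otimes> c)"
  using assms by (auto simp: coinvariants_def tensor_map_mult_left)

lemma csubspace_B: "csubspace B"
  unfolding complex_vector.subspace_def
  by (auto simp: coinvariants_def P_rules tensor_map_mult_left linearity_simps
      clinear_add[OF clinear_\<rho>] clinear_scaleC[OF clinear_\<rho>] clinear_zero[OF clinear_\<rho>])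

end

text \<open>Left colinearity is expressed by applying the right coaction \<open>R\<close> to the
  first leg of \<open>L h\<close>. This is why \<open>S x\<close> appears, and it spares a left
  \<open>H\<close>-coaction on \<open>P\<close>.\<close>

locale strong_connection = comodule_algebra H \<Delta> \<epsilon> S Si \<pi> i P R
  for H :: "'a::complex_algebra_1 set" and \<Delta> \<epsilon> S Si and \<pi> :: "'a \<Rightarrow> 'c::complex_vector" and i
    and P :: "'p::complex_algebra_1 set" and R +
  fixes L :: "'a \<Rightarrow> ('p, 'p) tensor"
  assumes lin_L: "clinear L" and L_mem: "h \<in> H \<Longrightarrow> L h \<in> P \<otimes>\<^sub>s P"
    and L_split: "h \<in> H \<Longrightarrow> tsum (L h) (*) = \<epsilon> h *\<^sub>C 1"
    and L_right_map: "h \<in> H \<Longrightarrow> tsum (L h) (\<lambda>p q. p \<otimes> R q) = tsum (\<Delta> h) (\<lambda>x y. tsum (L x) (\<lambda>p q. p \<otimes> (q \<otimes> y)))"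
    and L_left_map: "h \<in> H \<Longrightarrow> tsum (L h) (\<lambda>p q. R p \<otimes> q) = tsum (\<Delta> h) (\<lambda>x y. tsum (L y) (\<lambda>p q. (p \<otimes> S x) \<otimes> q))"
begin

lemmas slin = plin clinear_add[OF lin_L] clinear_scaleC[OF lin_L]

lemma L_cong:
  assumes "h \<in> H" "\<And>p q. p \<in> P \<Longrightarrow> q \<in> P \<Longrightarrow> f p q = g p q"
  shows "tsum (L h) f = tsum (L h) g"
  by (rule tsum_cong[OF P_rules(1) P_rules(1) L_mem]) (use assms in auto)

lemma L_right:
  assumes h: "h \<in> H" and f: "trilinear f"
  shows "tsum (L h) (\<lambda>p q. tsum (R q) (\<lambda>a k. f p a k)) = tsum (\<Delta> h) (\<lambda>x y. tsum (L x) (\<lambda>p q. f p q y))"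
proof -
  have f1: "bilinear_C (f x)" and f2: "bilinear_C (\<lambda>x y. f x y z)" for x z
    using f by (auto simp: trilinear_def)
  note fl = f1[unfolded bilinear_C_def clinear_on_def, simplified] f2[unfolded bilinear_C_def clinear_on_def, simplified]
  have bil: "bilinear_C (\<lambda>p u. tsum u (\<lambda>a k. f p a k))"
    by (rule bilinear_CI) (simp_all add: tsum_add tsum_scaleC f1 fl tsum_add_fun tsum_scaleC_fun)
  show ?thesis
    using arg_cong[OF L_right_map[OF h], of "\<lambda>t. tsum t (\<lambda>p u. tsum u (\<lambda>a k. f p a k))"]
    by (simp add: tsum_tsum tsum_pure bil f1)
qed

lemma L_left:
  assumes h: "h \<in> H" and f: "trilinear f"
  shows "tsum (L h) (\<lambda>p q. tsum (R p) (\<lambda>a k. f a k q)) = tsum (\<Delta> h) (\<lambda>x y. tsum (L y) (\<lambda>p q. f p (S x) q))"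
proof -
  have f1: "bilinear_C (f x)" and f2: "bilinear_C (\<lambda>x y. f x y z)" for x z
    using f by (auto simp: trilinear_def)
  note fl = f1[unfolded bilinear_C_def clinear_on_def, simplified] f2[unfolded bilinear_C_def clinear_on_def, simplified]
  have bil: "bilinear_C (\<lambda>u q. tsum u (\<lambda>a k. f a k q))"
    by (rule bilinear_CI) (simp_all add: tsum_add tsum_scaleC f2 fl tsum_add_fun tsum_scaleC_fun)
  show ?thesis
    using arg_cong[OF L_left_map[OF h], of "\<lambda>t. tsum t (\<lambda>u q. tsum u (\<lambda>a k. f a k q))"]
    by (simp add: tsum_tsum tsum_pure bil f2)
qed

section \<open>The canonical map on representatives and the splitting\<close>

definition can0 :: "('p, 'p) tensor \<Rightarrow> ('p, 'c) tensor" where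
  "can0 t = tsum t (\<lambda>p q. tsum (R q) (\<lambda>a h. (p * a) \<otimes> \<pi> h))"

definition can_inv :: "('p, 'c) tensor \<Rightarrow> ('p, 'p) tensor" where
  "can_inv t = tsum t (\<lambda>p c. tsum (L (i c)) (\<lambda>a b. (p * a) \<otimes> b))"

definition splitting :: "'p \<Rightarrow> ('p, 'p) tensor" where
  "splitting p = tsum (R p) (\<lambda>q h. tsum (L (i (\<pi> h))) (\<lambda>a b. (q * a) \<otimes> b))"

lemma clinear_can0: "clinear can0" and clinear_can_inv: "clinear can_inv" and clinear_splitting: "clinear splitting"
  by (simp_all add: can0_def can_inv_def splitting_def linearity_simps slin)

lemmas clin = clinear_can0[THEN clinear_add] clinear_can0[THEN clinear_scaleC]
  clinear_can_inv[THEN clinear_add] clinear_can_inv[THEN clinear_scaleC]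
  clinear_splitting[THEN clinear_add] clinear_splitting[THEN clinear_scaleC]
  clinear_\<rho>[THEN clinear_add] clinear_\<rho>[THEN clinear_scaleC]

lemma can0_pure: "can0 (p \<otimes> q) = tsum (\<rho> q) (\<lambda>a c. (p * a) \<otimes> c)"
  by (simp add: can0_def \<rho>_def tsum_tsum tsum_pure linearity_simps slin)

lemma can0_mem: "t \<in> P \<otimes>\<^sub>s P \<Longrightarrow> can0 t \<in> P \<otimes>\<^sub>s UNIV"
proof (rule clinear_image_tensor_set[OF clinear_can0 _ csubspace_tensor_set])
  fix p q assume "p \<in> P" "q \<in> P"
  then show "can0 (p \<otimes> q) \<in> P \<otimes>\<^sub>s UNIV"
    unfolding can0_pure
    by (intro tsum_mem[OF P_rules(1) complex_vector.subspace_UNIV \<rho>_mem csubspace_tensor_set])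
      (auto intro: tensor_mem P_rules)
qed

lemma can_inv_mem: "t \<in> P \<otimes>\<^sub>s UNIV \<Longrightarrow> can_inv t \<in> P \<otimes>\<^sub>s P"
proof (rule clinear_image_tensor_set[OF clinear_can_inv _ csubspace_tensor_set])
  fix p c assume p: "p \<in> P"
  have "can_inv (p \<otimes> c) = tsum (L (i c)) (\<lambda>a b. (p * a) \<otimes> b)"
    by (simp add: can_inv_def tsum_pure linearity_simps slin)
  also have "\<dots> \<in> P \<otimes>\<^sub>s P"
    by (intro tsum_mem[OF P_rules(1) P_rules(1) L_mem[OF i_mem] csubspace_tensor_set])
      (auto intro: tensor_mem P_rules p)
  finally show "can_inv (p \<otimes> c) \<in> P \<otimes>\<^sub>s P" .
qed

text \<open>Right colinearity moves the coaction from the second leg of the connection to the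
  coproduct of \<open>i c\<close>; then the two legs multiply to a counit, which leaves
  \<open>c\<close>.\<close>

lemma can0_can_inv: "can0 (can_inv t) = t"
proof (rule tensor_eqI[of "\<lambda>t. can0 (can_inv t)" "\<lambda>t. t"])
  fix p c
  have "can0 (can_inv (p \<otimes> c)) = tsum (L (i c)) (\<lambda>a b. tsum (R b) (\<lambda>q h. (p * a * q) \<otimes> \<pi> h))"
    by (simp add: can0_def can_inv_def tsum_tsum tsum_pure linearity_simps slin)
  also have "\<dots> = tsum (\<Delta> (i c)) (\<lambda>x y. tsum (L x) (\<lambda>a b. (p * a * b) \<otimes> \<pi> y))"
    by (rule L_right[OF i_mem]) (simp add: trilinear_def linearity_simps slin)
  also have "\<dots> = tsum (\<Delta> (i c)) (\<lambda>x y. (p * tsum (L x) (*)) \<otimes> \<pi> y)"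
    by (simp add: tsum_tensor_right tsum_mult_left mult.assoc)
  also have "\<dots> = tsum (\<Delta> (i c)) (\<lambda>x y. \<epsilon> x *\<^sub>C (p \<otimes> \<pi> y))"
    by (rule \<Delta>_cong[OF i_mem]) (simp add: L_split tensor_scaleC_left)
  also have "\<dots> = p \<otimes> c"
    using counit_left[OF i_mem, of "\<lambda>y. p \<otimes> \<pi> y"] by (simp add: \<pi>_i linearity_simps slin)
  finally show "can0 (can_inv (p \<otimes> c)) = p \<otimes> c" .
qed (simp_all add: clinear_on_def clin)

lemma splitting_eq: "splitting p = can_inv (\<rho> p)"
  by (simp add: splitting_def can_inv_def \<rho>_def tsum_tsum tsum_pure linearity_simps slin)

text \<open>This round trip is the identity only modulo \<open>B\<close>: it replaces
  \<open>q\<close> by its splitting, whose first leg may cross the tensor sign once it is known to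
  lie in \<open>B\<close>.\<close>

lemma can_inv_can0: "can_inv (can0 (p \<otimes> q)) = tsum (splitting q) (\<lambda>a b. (p * a) \<otimes> b)"
  by (simp add: can0_def can_inv_def splitting_def tsum_tsum tsum_pure linearity_simps slin)

lemma splitting_mult:
  assumes p: "p \<in> P"
  shows "tsum (splitting p) (*) = p"
proof -
  have "tsum (splitting p) (*) = tsum (R p) (\<lambda>q h. q * tsum (L (i (\<pi> h))) (*))"
    by (simp add: splitting_def tsum_tsum tsum_pure linearity_simps slin flip: tsum_mult_left)
  also have "\<dots> = tsum (R p) (\<lambda>q h. \<epsilon> h *\<^sub>C q)"
    by (rule R_cong[OF p]) (simp add: L_split i_mem \<pi>_counit)
  finally show ?thesis by (simp add: R_counit[OF p])
qed

text \<open>The first leg of the splitting is coinvariant: the second factor \<open>S x\<close> produced by left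
  colinearity of the connection cancels against the coaction on \<open>p\<close>, because \<open>i \<circ> \<pi>\<close> is left colinear.\<close>

lemma splitting_coinvariant:
  assumes p: "p \<in> P"
  shows "tensor_map \<rho> id (splitting p) = tensor_map (\<lambda>q. q \<otimes> \<pi> 1) id (splitting p)"
proof -
  have lid: "clinear id" by (simp add: clinear_on_def)
  have inner: "tsum (\<Delta> w) (\<lambda>k h. tsum (\<Delta> (i (\<pi> h))) (\<lambda>x y. tsum (L y) (\<lambda>a b. ((r * a) \<otimes> \<pi> (k * S x)) \<otimes> b))) =
      tsum (L (i (\<pi> w))) (\<lambda>a b. ((r * a) \<otimes> \<pi> 1) \<otimes> b)" if w: "w \<in> H" for w r
  proof -
    \<comment> \<open>The first argument is taken in \<open>C\<close>, as the right action allows,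
      so that left colinearity of \<open>i\<close> can be applied to the whole expression.\<close>
    define F where "F c u = tsum (\<Delta> u) (\<lambda>x y. tsum (L y) (\<lambda>a b. ((r * a) \<otimes> \<pi> (i c * S x)) \<otimes> b))" for c u
    have bil: "bilinear_C F"
      by (simp add: F_def linearity_simps slin)
    have F_\<pi>: "F (\<pi> k) u = tsum (\<Delta> u) (\<lambda>x y. tsum (L y) (\<lambda>a b. ((r * a) \<otimes> \<pi> (k * S x)) \<otimes> b))"
      if "k \<in> H" "u \<in> H" for k u
      unfolding F_def by (rule \<Delta>_cong) (simp_all add: that \<pi>_mult H_rules)
    have "tsum (\<Delta> w) (\<lambda>k h. tsum (\<Delta> (i (\<pi> h))) (\<lambda>x y. tsum (L y) (\<lambda>a b. ((r * a) \<otimes> \<pi> (k * S x)) \<otimes> b))) =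
        tsum (\<Delta> w) (\<lambda>k h. F (\<pi> k) (i (\<pi> h)))"
      by (rule \<Delta>_cong[OF w]) (simp add: F_\<pi> i_mem)
    also have "\<dots> = tsum (\<Delta> (i (\<pi> w))) (\<lambda>k u. F (\<pi> k) u)"
      by (rule colinear_left[OF w bil, symmetric])
    also have "\<dots> = tsum (\<Delta> (i (\<pi> w))) (\<lambda>k u. tsum (\<Delta> u) (\<lambda>x y. tsum (L y) (\<lambda>a b. ((r * a) \<otimes> \<pi> (k * S x)) \<otimes> b)))"
      by (rule \<Delta>_cong[OF i_mem]) (simp add: F_\<pi>)
    \<comment> \<open>Now \<open>k\<close> and \<open>x\<close> are legs of one coproduct, and
      \<open>k * S x\<close> cancels.\<close>
    also have "\<dots> = tsum (\<Delta> (i (\<pi> w))) (\<lambda>z y. tsum (\<Delta> z) (\<lambda>k x. tsum (L y) (\<lambda>a b. ((r * a) \<otimes> \<pi> (k * S x)) \<otimes> b)))"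
      by (rule coassoc[OF i_mem, symmetric]) (simp add: trilinear_def linearity_simps slin)
    also have "\<dots> = tsum (\<Delta> (i (\<pi> w))) (\<lambda>z y. tsum (L y) (\<lambda>a b. ((r * a) \<otimes> \<pi> (tsum (\<Delta> z) (\<lambda>k x. k * S x))) \<otimes> b))"
      by (simp add: tsum_push[OF lin_\<pi>(1)] flip: tsum_tensor_left tsum_tensor_right) (subst tsum_commute, rule refl)
    also have "\<dots> = tsum (\<Delta> (i (\<pi> w))) (\<lambda>z y. \<epsilon> z *\<^sub>C tsum (L y) (\<lambda>a b. ((r * a) \<otimes> \<pi> 1) \<otimes> b))"
      by (rule \<Delta>_cong[OF i_mem])
        (simp add: antipode_r clinear_scaleC[OF lin_\<pi>(1)] tensor_scaleC_left tensor_scaleC_right tsum_scaleC_fun)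
    also have "\<dots> = tsum (L (i (\<pi> w))) (\<lambda>a b. ((r * a) \<otimes> \<pi> 1) \<otimes> b)"
      by (rule counit_left[OF i_mem]) (simp add: linearity_simps slin)
    finally show ?thesis .
  qed
  have "tensor_map \<rho> id (splitting p) = tsum (R p) (\<lambda>r h. tsum (L (i (\<pi> h))) (\<lambda>a b. \<rho> (r * a) \<otimes> b))"
    by (simp add: tensor_map_eq_tsum clinear_\<rho> lid splitting_def tsum_tsum tsum_pure linearity_simps clin)
  also have "\<dots> = tsum (R p) (\<lambda>r h. tsum (L (i (\<pi> h))) (\<lambda>a b.
      tsum (R r) (\<lambda>s k. tsum (R a) (\<lambda>c m. ((s * c) \<otimes> \<pi> (k * m)) \<otimes> b))))"
    unfolding \<rho>_def
    by (intro R_cong[OF p] L_cong[OF i_mem], subst R_mult_sum) (simp_all add: tsum_tensor_right linearity_simps slin)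
  also have "\<dots> = tsum (R p) (\<lambda>r h. tsum (R r) (\<lambda>s k. tsum (L (i (\<pi> h))) (\<lambda>a b.
      tsum (R a) (\<lambda>c m. ((s * c) \<otimes> \<pi> (k * m)) \<otimes> b))))"
    by (subst tsum_commute) (rule refl)
  also have "\<dots> = tsum (R p) (\<lambda>r h. tsum (R r) (\<lambda>s k. tsum (\<Delta> (i (\<pi> h))) (\<lambda>x y. tsum (L y) (\<lambda>a b.
      ((s * a) \<otimes> \<pi> (k * S x)) \<otimes> b))))"
    by (subst L_left[OF i_mem]) (simp_all add: trilinear_def linearity_simps slin)
  also have "\<dots> = tsum (R p) (\<lambda>r w. tsum (\<Delta> w) (\<lambda>k h. tsum (\<Delta> (i (\<pi> h))) (\<lambda>x y. tsum (L y) (\<lambda>a b.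
      ((r * a) \<otimes> \<pi> (k * S x)) \<otimes> b))))"
    by (rule R_coassoc[OF p]) (simp add: trilinear_def linearity_simps slin)
  also have "\<dots> = tsum (R p) (\<lambda>r w. tsum (L (i (\<pi> w))) (\<lambda>a b. ((r * a) \<otimes> \<pi> 1) \<otimes> b))"
    by (rule R_cong[OF p]) (simp only: inner)
  also have "\<dots> = tensor_map (\<lambda>q. q \<otimes> \<pi> 1) id (splitting p)"
    by (simp add: tensor_map_eq_tsum lid splitting_def tsum_tsum tsum_pure linearity_simps)
  finally show ?thesis .
qed

text \<open>Coinvariance of the first leg says that \<open>splitting p\<close> is killed by
  \<open>g \<otimes> id\<close> with \<open>g q = \<rho> q - q \<otimes> \<pi> 1\<close>. The kernel
  of this map in \<open>P \<otimes> P\<close> is the kernel of \<open>g\<close> in \<open>P\<close>,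
  a subset of \<open>B\<close>, tensored with \<open>P\<close>.\<close>

lemma splitting_mem:
  assumes p: "p \<in> P"
  shows "splitting p \<in> B \<otimes>\<^sub>s P"
proof -
  define g where "g q = \<rho> q - q \<otimes> \<pi> 1" for q
  have g: "clinear g"
    by (rule clinearI) (simp_all add: g_def clin linearity_simps complex_vector.scale_right_diff_distrib)
  have lid: "clinear id" and e: "clinear (\<lambda>q. q \<otimes> \<pi> 1)" by (simp_all add: linearity_simps)
  have "tensor_map g id (splitting p) = tensor_map \<rho> id (splitting p) - tensor_map (\<lambda>q. q \<otimes> \<pi> 1) id (splitting p)"
    unfolding tensor_map_eq_tsum[OF g lid] tensor_map_eq_tsum[OF clinear_\<rho> lid] tensor_map_eq_tsum[OF e lid] g_def
    by (simp add: tensor_diff_left tsum_diff_fun)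
  then have "splitting p \<in> {q\<in>P. g q = 0} \<otimes>\<^sub>s P"
    using can_inv_mem[OF \<rho>_mem[OF p]] splitting_coinvariant[OF p]
    by (intro tensor_set_kernel[OF P_rules(1) P_rules(1) _ g]) (simp_all add: splitting_eq)
  moreover have "{q\<in>P. g q = 0} \<subseteq> B" by (auto simp: g_def intro: coinvariantI)
  ultimately show ?thesis using tensor_set_mono[of _ B P P] by blast
qed

end

section \<open>Bijectivity of the canonical map over the coinvariants\<close>

context strong_connection begin

definition N :: "('p, 'p) tensor set" where
  "N = cspan {(p * b) \<otimes> q - p \<otimes> (b * q) | p q b. p \<in> P \<and> q \<in> P \<and> b \<in> B}"

lemma csubspace_N: "csubspace N"
  by (simp add: N_def complex_vector.subspace_span)

lemma clinear_image_N:
  assumes f: "clinear f" and W: "csubspace W"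
    and "\<And>p q b. p \<in> P \<Longrightarrow> q \<in> P \<Longrightarrow> b \<in> B \<Longrightarrow> f ((p * b) \<otimes> q - p \<otimes> (b * q)) \<in> W" and t: "t \<in> N"
  shows "f t \<in> W"
  using t unfolding N_def
proof (induction rule: complex_vector.span_induct_alt)
  case base
  show ?case using W by (simp add: clinear_zero[OF f] complex_vector.subspace_0)
next
  case (step c x y)
  then show ?case
    using assms(3) by (auto simp: clinear_add[OF f] clinear_scaleC[OF f]
        intro!: complex_vector.subspace_add[OF W] complex_vector.subspace_scale[OF W])
qed

lemma can0_N: "t \<in> N \<Longrightarrow> can0 t = 0"
proof -
  assume t: "t \<in> N"
  have "can0 t \<in> {0}"
  proof (rule clinear_image_N[OF clinear_can0 _ _ t])
    fix p q b assume p: "p \<in> P" and q: "q \<in> P" and b: "b \<in> B"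
    have "can0 (p \<otimes> (b * q)) = can0 ((p * b) \<otimes> q)"
      by (simp add: can0_pure coinvariantD(2)[OF b q] tsum_tsum tsum_pure linearity_simps)
    then show "can0 ((p * b) \<otimes> q - p \<otimes> (b * q)) \<in> {0}"
      by (simp add: clinear_diff[OF clinear_can0])
  qed simp
  then show ?thesis by simp
qed

text \<open>On a pure tensor of \<open>B \<otimes>\<^sub>s P\<close> this is one of the generating
  relations; both terms are linear in \<open>t\<close>.\<close>

lemma N_balance:
  assumes p: "p \<in> P" and t: "t \<in> B \<otimes>\<^sub>s P"
  shows "tsum t (\<lambda>a b. (p * a) \<otimes> b) - p \<otimes> tsum t (*) \<in> N"
proof (rule clinear_image_tensor_set[OF _ t csubspace_N])
  show "clinear (\<lambda>t. tsum t (\<lambda>a b. (p * a) \<otimes> b) - p \<otimes> tsum t (*))"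
    by (rule clinearI) (simp_all add: linearity_simps complex_vector.scale_right_diff_distrib)
  fix a b assume "a \<in> B" "b \<in> P"
  then have "(p * a) \<otimes> b - p \<otimes> (a * b) \<in> N"
    unfolding N_def using p by (intro complex_vector.span_base) blast
  then show "tsum (a \<otimes> b) (\<lambda>a b. (p * a) \<otimes> b) - p \<otimes> tsum (a \<otimes> b) (*) \<in> N"
    by (simp add: tsum_pure linearity_simps)
qed

lemma can_inv_can0_N: "t \<in> P \<otimes>\<^sub>s P \<Longrightarrow> can_inv (can0 t) - t \<in> N"
proof (rule clinear_image_tensor_set[of "\<lambda>t. can_inv (can0 t) - t", OF _ _ csubspace_N])
  show "clinear (\<lambda>t. can_inv (can0 t) - t)"
    by (rule clinearI) (simp_all add: clin complex_vector.scale_right_diff_distrib)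
  fix p q assume p: "p \<in> P" and q: "q \<in> P"
  then show "can_inv (can0 (p \<otimes> q)) - p \<otimes> q \<in> N"
    using N_balance[OF p splitting_mem[OF q]] by (simp add: can_inv_can0 splitting_mult)
qed

abbreviation "E \<equiv> balanced_eq P B"

lemma balanced_eq_iff: "(s, t) \<in> E \<longleftrightarrow> s \<in> P \<otimes>\<^sub>s P \<and> t \<in> P \<otimes>\<^sub>s P \<and> s - t \<in> N"
  by (simp add: balanced_eq_def N_def)

lemma equiv_E: "equiv (P \<otimes>\<^sub>s P) E"
proof (rule equivI)
  show "refl_on (P \<otimes>\<^sub>s P) E"
    by (auto simp: refl_on_def balanced_eq_iff complex_vector.subspace_0[OF csubspace_N])
  show "sym E"
    using complex_vector.subspace_neg[OF csubspace_N] by (fastforce simp: sym_def balanced_eq_iff)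
  show "trans E"
  proof (rule transI)
    fix r s t assume "(r, s) \<in> E" "(s, t) \<in> E"
    then show "(r, t) \<in> E"
      using complex_vector.subspace_add[OF csubspace_N, of "r - s" "s - t"] by (simp add: balanced_eq_iff)
  qed
  show "E \<subseteq> (P \<otimes>\<^sub>s P) \<times> (P \<otimes>\<^sub>s P)"
    by (auto simp: balanced_eq_iff)
qed

text \<open>\<open>can0\<close> vanishes on the relations, hence is constant on the class; its image
  is a singleton, as \<open>the_elem\<close> requires.\<close>

lemma can_map_class:
  assumes t: "t \<in> P \<otimes>\<^sub>s P"
  shows "can_map P \<rho> (E `` {t}) = can0 t"
proof -
  have "tensor_lift_on P P (\<lambda>p q. tensor_map (\<lambda>r. p * r) id (\<rho> q)) s = can0 t" if "s \<in> E `` {t}" for s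
  proof -
    have s: "s \<in> P \<otimes>\<^sub>s P" "t - s \<in> N" using that by (auto simp: balanced_eq_iff)
    have "tensor_lift_on P P (\<lambda>p q. tensor_map (\<lambda>r. p * r) id (\<rho> q)) s = can0 s"
      unfolding can0_def
      by (rule tensor_lift_on_eq[OF P_rules(1) P_rules(1) s(1)])
        (simp_all add: tensor_map_mult_left \<rho>_def tsum_tsum tsum_pure linearity_simps slin)
    also have "\<dots> = can0 t"
      using can0_N[OF s(2)] by (simp add: clinear_diff[OF clinear_can0])
    finally show ?thesis .
  qed
  moreover have "t \<in> E `` {t}"
    using equiv_E t by (rule equiv_class_self)
  ultimately have "tensor_lift_on P P (\<lambda>p q. tensor_map (\<lambda>r. p * r) id (\<rho> q)) ` (E `` {t}) = {can0 t}"
    by (auto intro!: image_eqI[of _ _ t])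
  then show ?thesis by (simp add: can_map_def)
qed

text \<open>\<open>can_inv\<close> is a right inverse of \<open>can0\<close> exactly and a left
  inverse modulo \<open>N\<close>, which gives surjectivity and injectivity on classes.\<close>

lemma can_bij: "bij_betw (can_map P \<rho>) (balanced_tensor P B) (P \<otimes>\<^sub>s UNIV)"
proof (rule bij_betw_imageI)
  show "inj_on (can_map P \<rho>) (balanced_tensor P B)"
  proof (rule inj_onI)
    fix X Y assume X: "X \<in> balanced_tensor P B" and Y: "Y \<in> balanced_tensor P B"
      and eq: "can_map P \<rho> X = can_map P \<rho> Y"
    obtain s t where st: "X = E `` {s}" "Y = E `` {t}" "s \<in> P \<otimes>\<^sub>s P" "t \<in> P \<otimes>\<^sub>s P"
      using X Y by (auto simp: balanced_tensor_def elim!: quotientE)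
    have "can0 s = can0 t" using eq by (simp add: st can_map_class)
    \<comment> \<open>Equal values under \<open>can0\<close> make the difference of representatives
      a difference of two round-trip errors, each in \<open>N\<close>.\<close>
    then have "s - t = (can_inv (can0 t) - t) - (can_inv (can0 s) - s)" by simp
    also have "\<dots> \<in> N" by (intro complex_vector.subspace_diff csubspace_N can_inv_can0_N st)
    finally have "(s, t) \<in> E" using st by (simp add: balanced_eq_iff)
    then show "X = Y" unfolding st by (rule equiv_class_eq[OF equiv_E])
  qed
  show "can_map P \<rho> ` balanced_tensor P B = P \<otimes>\<^sub>s UNIV"
  proof (intro equalityI subsetI)
    fix z assume "z \<in> can_map P \<rho> ` balanced_tensor P B"
    then show "z \<in> P \<otimes>\<^sub>s UNIV"
      by (auto simp: balanced_tensor_def can_map_class can0_mem elim!: quotientE)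
  next
    fix z :: "('p, 'c) tensor" assume "z \<in> P \<otimes>\<^sub>s UNIV"
    then have t: "can_inv z \<in> P \<otimes>\<^sub>s P" by (rule can_inv_mem)
    then have "can_map P \<rho> (E `` {can_inv z}) = z" by (simp add: can_map_class can0_can_inv)
    then show "z \<in> can_map P \<rho> ` balanced_tensor P B"
      using t by (metis balanced_tensor_def imageI quotientI)
  qed
qed

lemma can_map_inv: "z \<in> P \<otimes>\<^sub>s UNIV \<Longrightarrow> inv_into (balanced_tensor P B) (can_map P \<rho>) z = E `` {can_inv z}"
  using can_bij can_map_class[OF can_inv_mem, of z] can0_can_inv[of z] can_inv_mem[of z]
  by (intro inv_into_f_eq) (auto simp: bij_betw_def balanced_tensor_def intro: quotientI)

lemma balanced_rmult_class:
  assumes t: "t \<in> P \<otimes>\<^sub>s P" and p: "p \<in> P"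
  shows "balanced_rmult P B (E `` {t}) p = E `` {tensor_map id (\<lambda>q. q * p) t}"
proof -
  define f :: "('p, 'p) tensor \<Rightarrow> ('p, 'p) tensor" where "f = tensor_map id (\<lambda>q. q * p)"
  have f: "clinear f" unfolding f_def by (rule clinear_tensor_map) (simp_all add: linearity_simps)
  have f_pure: "f (a \<otimes> b) = a \<otimes> (b * p)" for a b
    unfolding f_def by (subst tensor_map_pure) (simp_all add: linearity_simps)
  have f_mem: "f s \<in> P \<otimes>\<^sub>s P" if "s \<in> P \<otimes>\<^sub>s P" for s
    by (rule clinear_image_tensor_set[OF f that csubspace_tensor_set])
      (auto simp: f_pure intro!: tensor_mem P_rules p)
  have f_N: "f s \<in> N" if "s \<in> N" for s
  proof (rule clinear_image_N[OF f csubspace_N _ that])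
    fix a q b assume "a \<in> P" "q \<in> P" "b \<in> B"
    then have "(a * b) \<otimes> (q * p) - a \<otimes> (b * (q * p)) \<in> N"
      unfolding N_def using P_rules(3)[OF _ p] by (intro complex_vector.span_base) blast
    then show "f ((a * b) \<otimes> q - a \<otimes> (b * q)) \<in> N"
      by (simp add: clinear_diff[OF f] f_pure mult.assoc)
  qed
  have "E `` {f s} = E `` {f t}" if "s \<in> E `` {t}" for s
    using that f_N[of "t - s"] f_mem[of s] f_mem[of t]
    by (intro equiv_class_eq[OF equiv_E]) (auto simp: balanced_eq_iff clinear_diff[OF f]
        intro: complex_vector.subspace_neg[OF csubspace_N, of "f t - f s", simplified])
  moreover have "t \<in> E `` {t}"
    using equiv_E t by (rule equiv_class_self)
  ultimately have "E `` (f ` (E `` {t})) = E `` {f t}" by blast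
  then show ?thesis by (simp add: balanced_rmult_def f_def)
qed

section \<open>The entwining map\<close>

definition entw :: "('c, 'p) tensor \<Rightarrow> ('p, 'c) tensor" where
  "entw t = tsum t (\<lambda>c p. tsum (R p) (\<lambda>q k. q \<otimes> \<pi> (i c * k)))"

text \<open>In both composites with \<open>entw\<close> the later leg of a coproduct stands to the
  left of the earlier one; the cancellation is then the one of \<open>Si\<close>, not of
  \<open>S\<close>.\<close>

definition entw_inv :: "('p, 'c) tensor \<Rightarrow> ('c, 'p) tensor" where
  "entw_inv t = tsum t (\<lambda>p c. tsum (R p) (\<lambda>q k. \<pi> (i c * Si k) \<otimes> q))"

text \<open>The preimage of \<open>1 \<otimes> c\<close> is the class of \<open>L (i c)\<close>.
  After multiplying by \<open>p\<close>, multiplicativity of \<open>R\<close> and right colinearity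
  of \<open>L\<close> separate the legs, and the legs of the connection multiply to a
  counit.\<close>

lemma entwining_pure:
  assumes p: "p \<in> P"
  shows "can_map P \<rho> (balanced_rmult P B (inv_into (balanced_tensor P B) (can_map P \<rho>) (1 \<otimes> c)) p) =
    tsum (R p) (\<lambda>q k. q \<otimes> \<pi> (i c * k))"
proof -
  have 1: "1 \<otimes> c \<in> P \<otimes>\<^sub>s UNIV" by (intro tensor_mem) (simp_all add: P_rules)
  define f where "f = tensor_map (id :: 'p \<Rightarrow> 'p) (\<lambda>q. q * p)"
  have fe: "f t = tsum t (\<lambda>a b. a \<otimes> (b * p))" for t
    unfolding f_def by (subst tensor_map_eq_tsum) (simp_all add: linearity_simps)
  have fm: "f (can_inv (1 \<otimes> c)) \<in> P \<otimes>\<^sub>s P"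
    unfolding fe by (rule tsum_mem[OF P_rules(1) P_rules(1) can_inv_mem[OF 1] csubspace_tensor_set])
      (auto intro!: tensor_mem P_rules p)
  have "can_map P \<rho> (balanced_rmult P B (inv_into (balanced_tensor P B) (can_map P \<rho>) (1 \<otimes> c)) p) =
      can0 (f (can_inv (1 \<otimes> c)))"
    using fm by (simp add: can_map_inv[OF 1] balanced_rmult_class[OF can_inv_mem[OF 1] p] can_map_class f_def)
  also have "\<dots> = tsum (L (i c)) (\<lambda>a b. tsum (R (b * p)) (\<lambda>q k. (a * q) \<otimes> \<pi> k))"
    by (simp add: fe can_inv_def can0_def tsum_tsum tsum_pure linearity_simps slin)
  also have "\<dots> = tsum (L (i c)) (\<lambda>a b. tsum (R b) (\<lambda>r h. tsum (R p) (\<lambda>q k. (a * (r * q)) \<otimes> \<pi> (h * k))))"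
    by (rule L_cong[OF i_mem], subst R_mult_sum) (simp_all add: p linearity_simps slin)
  also have "\<dots> = tsum (\<Delta> (i c)) (\<lambda>x y. tsum (L x) (\<lambda>a b. tsum (R p) (\<lambda>q k. (a * (b * q)) \<otimes> \<pi> (y * k))))"
    by (rule L_right[OF i_mem]) (simp add: trilinear_def linearity_simps slin)
  also have "\<dots> = tsum (\<Delta> (i c)) (\<lambda>x y. tsum (R p) (\<lambda>q k. (tsum (L x) (*) * q) \<otimes> \<pi> (y * k)))"
    by (subst tsum_commute) (simp add: tsum_tensor_right flip: tsum_mult_right mult.assoc)
  also have "\<dots> = tsum (\<Delta> (i c)) (\<lambda>x y. \<epsilon> x *\<^sub>C tsum (R p) (\<lambda>q k. q \<otimes> \<pi> (y * k)))"
    by (rule \<Delta>_cong[OF i_mem]) (simp add: L_split tensor_scaleC_left tsum_scaleC_fun)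
  also have "\<dots> = tsum (R p) (\<lambda>q k. q \<otimes> \<pi> (i c * k))"
    by (rule counit_left[OF i_mem]) (simp add: linearity_simps slin)
  finally show ?thesis .
qed

lemma entwining_eq:
  assumes t: "t \<in> UNIV \<otimes>\<^sub>s P"
  shows "entwining P \<rho> t = entw t"
  unfolding entwining_def Let_def entw_def
  by (rule tensor_lift_on_eq[OF complex_vector.subspace_UNIV P_rules(1) t])
    (simp_all add: entwining_pure linearity_simps slin)

lemma clinear_entw: "clinear entw" and clinear_entw_inv: "clinear entw_inv"
  by (simp_all add: entw_def entw_inv_def linearity_simps slin)

lemma entw_inv_entw:
  assumes t: "t \<in> UNIV \<otimes>\<^sub>s P"
  shows "entw_inv (entw t) = t"
proof (rule tensor_set_eqI[of "\<lambda>t. entw_inv (entw t)" "\<lambda>t. t", OF _ _ _ t])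
  fix c p assume p: "p \<in> P"
  have "entw_inv (entw (c \<otimes> p)) = tsum (R p) (\<lambda>q k. tsum (R q) (\<lambda>r m. \<pi> (i (\<pi> (i c * k)) * Si m) \<otimes> r))"
    by (simp add: entw_def entw_inv_def tsum_tsum tsum_pure linearity_simps slin)
  also have "\<dots> = tsum (R p) (\<lambda>q k. tsum (R q) (\<lambda>r m. \<pi> (i c * (k * Si m)) \<otimes> r))"
    by (intro R_cong p) (simp_all add: \<pi>_mult H_rules i_mem mult.assoc)
  also have "\<dots> = tsum (R p) (\<lambda>r w. tsum (\<Delta> w) (\<lambda>m k. \<pi> (i c * (k * Si m)) \<otimes> r))"
    by (rule R_coassoc[OF p]) (simp add: trilinear_def linearity_simps slin)
  also have "\<dots> = tsum (R p) (\<lambda>r w. \<pi> (i c * tsum (\<Delta> w) (\<lambda>m k. k * Si m)) \<otimes> r)"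
    by (simp add: tsum_push[OF lin_\<pi>(1)] flip: tsum_tensor_right tsum_mult_left)
  also have "\<dots> = tsum (R p) (\<lambda>r w. \<epsilon> w *\<^sub>C (c \<otimes> r))"
    by (rule R_cong[OF p]) (simp add: antipode_inv_r slin \<pi>_i tensor_scaleC_left)
  also have "\<dots> = c \<otimes> p"
    by (rule R_counit_sum[OF p]) (simp add: linearity_simps)
  finally show "entw_inv (entw (c \<otimes> p)) = c \<otimes> p" .
qed (use clinear_entw clinear_entw_inv in \<open>simp_all add: clinear_on_def\<close>)

lemma entw_entw_inv:
  assumes t: "t \<in> P \<otimes>\<^sub>s UNIV"
  shows "entw (entw_inv t) = t"
proof (rule tensor_set_eqI[of "\<lambda>t. entw (entw_inv t)" "\<lambda>t. t", OF _ _ _ t])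
  fix p c assume p: "p \<in> P"
  have "entw (entw_inv (p \<otimes> c)) = tsum (R p) (\<lambda>q k. tsum (R q) (\<lambda>r m. r \<otimes> \<pi> (i (\<pi> (i c * Si k)) * m)))"
    by (simp add: entw_def entw_inv_def tsum_tsum tsum_pure linearity_simps slin)
  also have "\<dots> = tsum (R p) (\<lambda>q k. tsum (R q) (\<lambda>r m. r \<otimes> \<pi> (i c * (Si k * m))))"
    by (intro R_cong p) (simp_all add: \<pi>_mult H_rules i_mem mult.assoc)
  also have "\<dots> = tsum (R p) (\<lambda>r w. tsum (\<Delta> w) (\<lambda>m k. r \<otimes> \<pi> (i c * (Si k * m))))"
    by (rule R_coassoc[OF p]) (simp add: trilinear_def linearity_simps slin)
  also have "\<dots> = tsum (R p) (\<lambda>r w. r \<otimes> \<pi> (i c * tsum (\<Delta> w) (\<lambda>m k. Si k * m)))"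
    by (simp add: tsum_push[OF lin_\<pi>(1)] flip: tsum_tensor_left tsum_mult_left)
  also have "\<dots> = tsum (R p) (\<lambda>r w. \<epsilon> w *\<^sub>C (r \<otimes> c))"
    by (rule R_cong[OF p]) (simp add: antipode_inv_l slin \<pi>_i tensor_scaleC_right)
  also have "\<dots> = p \<otimes> c"
    by (rule R_counit_sum[OF p]) (simp add: linearity_simps)
  finally show "entw (entw_inv (p \<otimes> c)) = p \<otimes> c" .
qed (use clinear_entw clinear_entw_inv in \<open>simp_all add: clinear_on_def\<close>)

lemma entw_inv_mem: "t \<in> P \<otimes>\<^sub>s UNIV \<Longrightarrow> entw_inv t \<in> UNIV \<otimes>\<^sub>s P"
proof (rule clinear_image_tensor_set[OF clinear_entw_inv _ csubspace_tensor_set])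
  fix p c assume p: "p \<in> P"
  have "entw_inv (p \<otimes> c) = tsum (R p) (\<lambda>q k. \<pi> (i c * Si k) \<otimes> q)"
    by (simp add: entw_inv_def tsum_pure linearity_simps slin)
  also have "\<dots> \<in> UNIV \<otimes>\<^sub>s P"
    by (intro tsum_mem[OF P_rules(1) H_rules(1) R_mem[OF p] csubspace_tensor_set]) (auto intro: tensor_mem)
  finally show "entw_inv (p \<otimes> c) \<in> UNIV \<otimes>\<^sub>s P" .
qed

lemma entw_mem: "t \<in> UNIV \<otimes>\<^sub>s P \<Longrightarrow> entw t \<in> P \<otimes>\<^sub>s UNIV"
proof (rule clinear_image_tensor_set[OF clinear_entw _ csubspace_tensor_set])
  fix c p assume p: "p \<in> P"
  have "entw (c \<otimes> p) = tsum (R p) (\<lambda>q k. q \<otimes> \<pi> (i c * k))"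
    by (simp add: entw_def tsum_pure linearity_simps slin)
  also have "\<dots> \<in> P \<otimes>\<^sub>s UNIV"
    by (intro tsum_mem[OF P_rules(1) H_rules(1) R_mem[OF p] csubspace_tensor_set]) (auto intro: tensor_mem)
  finally show "entw (c \<otimes> p) \<in> P \<otimes>\<^sub>s UNIV" .
qed

lemma entwining_bij: "bij_betw (entwining P \<rho>) (UNIV \<otimes>\<^sub>s P) (P \<otimes>\<^sub>s UNIV)"
  by (rule bij_betw_byWitness[of _ entw_inv])
    (auto simp: entwining_eq entw_inv_entw entw_entw_inv entw_mem entw_inv_mem)

text \<open>\<open>i (\<pi> 1)\<close> acts as \<open>1\<close> after projection to
  \<open>C\<close>. The result is the shape of the left coaction given through the inverse
  antipode.\<close>

lemma induced_left:
  assumes p: "p \<in> P"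
  shows "induced_left_coaction P \<rho> (\<pi> 1) p = tsum (R p) (\<lambda>q k. \<pi> (Si k) \<otimes> q)"
proof -
  have m: "p \<otimes> \<pi> 1 \<in> P \<otimes>\<^sub>s UNIV" using p by (auto intro: tensor_mem)
  have "induced_left_coaction P \<rho> (\<pi> 1) p = entw_inv (p \<otimes> \<pi> 1)"
    unfolding induced_left_coaction_def
    using entwining_bij m entw_inv_mem[OF m] entw_entw_inv[OF m]
    by (intro inv_into_f_eq) (auto simp: bij_betw_def entwining_eq)
  also have "\<dots> = tsum (R p) (\<lambda>q k. \<pi> (i (\<pi> 1) * Si k) \<otimes> q)"
    by (simp add: entw_inv_def tsum_pure linearity_simps slin)
  also have "\<dots> = tsum (R p) (\<lambda>q k. \<pi> (Si k) \<otimes> q)"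
    by (rule R_cong[OF p]) (simp add: \<pi>_mult H_rules)
  finally show ?thesis .
qed

text \<open>Three regroupings: right colinearity of \<open>L\<close> moves the coaction to the
  coproduct of \<open>i (\<pi> h)\<close>, right colinearity of \<open>i\<close> replaces that by
  the coproduct of \<open>h\<close>, and coassociativity of \<open>R\<close> moves it to the
  coaction of \<open>p\<close>.\<close>

lemma splitting_colinear:
  assumes p: "p \<in> P"
  shows "tensor_assoc (tsum (splitting p) (\<lambda>a b. a \<otimes> \<rho> b)) = tsum (\<rho> p) (\<lambda>q c. splitting q \<otimes> c)"
proof -
  have "tensor_assoc (tsum (splitting p) (\<lambda>a b. a \<otimes> \<rho> b)) =
      tsum (R p) (\<lambda>q h. tsum (L (i (\<pi> h))) (\<lambda>a b. tsum (R b) (\<lambda>r k. ((q * a) \<otimes> r) \<otimes> \<pi> k)))"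
    by (simp add: \<rho>_def splitting_def tensor_assoc_eq_tsum tsum_tsum tsum_pure linearity_simps slin)
  also have "\<dots> = tsum (R p) (\<lambda>q h. tsum (\<Delta> (i (\<pi> h))) (\<lambda>x y. tsum (L x) (\<lambda>a b. ((q * a) \<otimes> b) \<otimes> \<pi> y)))"
    by (subst L_right[OF i_mem]) (simp_all add: trilinear_def linearity_simps slin)
  also have "\<dots> = tsum (R p) (\<lambda>q h. tsum (\<Delta> h) (\<lambda>x y. tsum (L (i (\<pi> x))) (\<lambda>a b. ((q * a) \<otimes> b) \<otimes> \<pi> y)))"
    by (intro R_cong[OF p] colinear_right) (simp_all add: linearity_simps slin)
  also have "\<dots> = tsum (R p) (\<lambda>q h. tsum (R q) (\<lambda>r x. tsum (L (i (\<pi> x))) (\<lambda>a b. ((r * a) \<otimes> b) \<otimes> \<pi> h)))"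
    by (rule R_coassoc[OF p, symmetric]) (simp add: trilinear_def linearity_simps slin)
  also have "\<dots> = tsum (\<rho> p) (\<lambda>q c. splitting q \<otimes> c)"
    by (simp add: \<rho>_def tsum_tsum tsum_pure linearity_simps slin clin, simp add: splitting_def tsum_tensor_right)
  finally show ?thesis .
qed

lemma strong_splitting: "strong_splitting P \<rho> splitting"
  unfolding strong_splitting_def Let_def
proof (intro conjI ballI)
  show "clinear_on P splitting" using clinear_splitting by (simp add: clinear_on_def)
  show "splitting ` P \<subseteq> B \<otimes>\<^sub>s P" using splitting_mem by blast
next
  fix p assume p: "p \<in> P"
  show "tensor_lift_on B P (*) (splitting p) = p"
    using tensor_lift_on_eq[OF csubspace_B P_rules(1) splitting_mem[OF p], of "(*)" "(*)"]
    by (simp add: splitting_mult[OF p] linearity_simps)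
  have "tensor_map_on B P id \<rho> (splitting p) = tsum (splitting p) (\<lambda>a b. a \<otimes> \<rho> b)"
    unfolding tensor_map_on_def
    by (rule tensor_lift_on_eq[OF csubspace_B P_rules(1) splitting_mem[OF p]]) (simp_all add: linearity_simps clin)
  moreover have "tensor_map_on P UNIV splitting id (\<rho> p) = tsum (\<rho> p) (\<lambda>q c. splitting q \<otimes> c)"
    unfolding tensor_map_on_def
    by (rule tensor_lift_on_eq[OF P_rules(1) complex_vector.subspace_UNIV \<rho>_mem[OF p]]) (simp_all add: linearity_simps clin)
  ultimately show "tensor_assoc (tensor_map_on B P id \<rho> (splitting p)) = tensor_map_on P UNIV splitting id (\<rho> p)"
    using splitting_colinear[OF p] by simp
next
  \<comment> \<open>In \<open>can_inv (\<rho> p)\<close> both factors respect \<open>b\<close>: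
    \<rho> by the definition of the coinvariants, and \<open>can_inv\<close> because it multiplies
    first legs from the left.\<close>
  fix b p assume b: "b \<in> B" and p: "p \<in> P"
  show "splitting (b * p) = tensor_map (\<lambda>q. b * q) id (splitting p)"
    by (simp add: splitting_eq coinvariantD(2)[OF b p] can_inv_def tensor_map_mult_left tsum_tsum tsum_pure
        linearity_simps slin)
qed

theorem principal: "principal_comodule P \<delta> (\<lambda>c. \<epsilon> (i c)) \<rho> (\<pi> 1)"
  unfolding principal_comodule_def
  using subalg_P coalgebra_quotient right_coaction_\<rho> group_like_quotient can_bij \<rho>_1 entwining_bij strong_splitting
  by blast

end

section \<open>A strong connection from two colinear maps\<close>

text \<open>
  Let \<open>G1, G2 : H \<rightarrow> P\<close> be colinear and write \<open>E\<^sub>k = \<epsilon> - (G\<^sub>k \<circ> S) * G\<^sub>k\<close> (convolution). If \<open>E\<^sub>1 * E\<^sub>2 = 0\<close>, then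
  \<open>(G\<^sub>1 \<circ> S) * G\<^sub>1 + (E\<^sub>1 * (G\<^sub>2 \<circ> S)) * G\<^sub>2 = \<epsilon>\<close>, and replacing the last convolution in each summand
  by a tensor product gives a strong connection.
\<close>

locale two_colinear_maps = comodule_algebra H \<Delta> \<epsilon> S Si \<pi> i P R
  for H :: "'a::complex_algebra_1 set" and \<Delta> \<epsilon> S Si and \<pi> :: "'a \<Rightarrow> 'c::complex_vector" and i
    and P :: "'p::complex_algebra_1 set" and R +
  fixes G1 G2 :: "'a \<Rightarrow> 'p"
  assumes lin_G: "clinear G1" "clinear G2"
    and G_mem: "h \<in> H \<Longrightarrow> G1 h \<in> P" "h \<in> H \<Longrightarrow> G2 h \<in> P"
    and G1_colinear: "h \<in> H \<Longrightarrow> R (G1 h) = tsum (\<Delta> h) (\<lambda>x y. G1 x \<otimes> y)"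
    and G2_colinear: "h \<in> H \<Longrightarrow> R (G2 h) = tsum (\<Delta> h) (\<lambda>x y. G2 x \<otimes> y)"
    and G_cross: "h \<in> H \<Longrightarrow> tsum (\<Delta> h) (\<lambda>x y. (\<epsilon> x *\<^sub>C 1 - tsum (\<Delta> x) (\<lambda>a b. G1 (S a) * G1 b)) *
        (\<epsilon> y *\<^sub>C 1 - tsum (\<Delta> y) (\<lambda>a b. G2 (S a) * G2 b))) = 0"
begin

lemmas glin = plin lin_G[THEN clinear_add] lin_G[THEN clinear_scaleC]

definition M1 :: "'a \<Rightarrow> 'p" where "M1 h = tsum (\<Delta> h) (\<lambda>a b. G1 (S a) * G1 b)"

definition M2 :: "'a \<Rightarrow> 'p" where "M2 h = tsum (\<Delta> h) (\<lambda>a b. G2 (S a) * G2 b)"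

text \<open>\<open>V\<close> is the convolution \<open>G1 * (G2 \<circ> S)\<close> and
  \<open>Q\<close> is \<open>(G1 \<circ> S) * V\<close>. By associativity \<open>Q\<close> equals
  \<open>M1 * (G2 \<circ> S)\<close>; the bracketing through \<open>V\<close> exposes a coinvariant
  factor.\<close>

definition V :: "'a \<Rightarrow> 'p" where "V h = tsum (\<Delta> h) (\<lambda>a b. G1 a * G2 (S b))"

definition Q :: "'a \<Rightarrow> 'p" where "Q h = tsum (\<Delta> h) (\<lambda>x y. G1 (S x) * V y)"

lemma lin_V: "clinear V" and lin_Q: "clinear Q" and lin_M: "clinear M1" "clinear M2"
  by (simp_all add: V_def Q_def M1_def M2_def linearity_simps glin)

lemmas vlin = glin lin_V[THEN clinear_add] lin_V[THEN clinear_scaleC]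
  lin_Q[THEN clinear_add] lin_Q[THEN clinear_scaleC] lin_M[THEN clinear_add] lin_M[THEN clinear_scaleC]

lemma V_mem: "h \<in> H \<Longrightarrow> V h \<in> P" and Q_mem: "h \<in> H \<Longrightarrow> Q h \<in> P"
proof -
  show v: "h \<in> H \<Longrightarrow> V h \<in> P" for h
    unfolding V_def by (rule \<Delta>_sum_mem[OF _ P_rules(1)]) (auto intro!: P_rules G_mem H_rules)
  show "h \<in> H \<Longrightarrow> Q h \<in> P"
    unfolding Q_def by (rule \<Delta>_sum_mem[OF _ P_rules(1)]) (auto intro!: P_rules G_mem H_rules v)
qed

text \<open>The antipode reverses the coproduct, so the first leg becomes the one carried by the
  coaction.\<close>

lemma R_GS:
  assumes G: "clinear G" "\<And>h. h \<in> H \<Longrightarrow> R (G h) = tsum (\<Delta> h) (\<lambda>x y. G x \<otimes> y)" and h: "h \<in> H"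
  shows "R (G (S h)) = tsum (\<Delta> h) (\<lambda>x y. G (S y) \<otimes> S x)"
  by (simp add: G(2) S_mem h \<Delta>_S tsum_tsum tsum_pure linearity_simps clinear_add[OF G(1)] clinear_scaleC[OF G(1)])

text \<open>The coaction produces four legs whose inner two meet as \<open>b * S c\<close> in the
  \<open>H\<close>-factor and cancel.\<close>

lemma R_V:
  assumes h: "h \<in> H"
  shows "R (V h) = V h \<otimes> 1"
proof -
  have "R (V h) = tsum (\<Delta> h) (\<lambda>x y. R (G1 x * G2 (S y)))"
    unfolding V_def by (rule tsum_push[OF lin_R])
  also have "\<dots> = tsum (\<Delta> h) (\<lambda>x y. tsum (\<Delta> x) (\<lambda>a b. tsum (\<Delta> y) (\<lambda>c d. (G1 a * G2 (S d)) \<otimes> (b * S c))))"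
    by (rule \<Delta>_cong[OF h])
      (simp add: R_mult G_mem H_rules G1_colinear R_GS[OF lin_G(2) G2_colinear] times_tensor_eq_tsum
        tsum_tsum tsum_pure linearity_simps glin)
  also have "\<dots> = tsum (\<Delta> h) (\<lambda>a r. tsum (\<Delta> r) (\<lambda>b y. tsum (\<Delta> y) (\<lambda>c d. (G1 a * G2 (S d)) \<otimes> (b * S c))))"
    by (rule coassoc[OF h]) (simp add: trilinear_def linearity_simps glin)
  also have "\<dots> = tsum (\<Delta> h) (\<lambda>a r. (G1 a * G2 (S r)) \<otimes> 1)"
  proof (rule \<Delta>_cong[OF h])
    fix a r assume r: "r \<in> H"
    have "tsum (\<Delta> r) (\<lambda>b y. tsum (\<Delta> y) (\<lambda>c d. (G1 a * G2 (S d)) \<otimes> (b * S c))) =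
        tsum (\<Delta> r) (\<lambda>w d. tsum (\<Delta> w) (\<lambda>b c. (G1 a * G2 (S d)) \<otimes> (b * S c)))"
      by (rule coassoc[OF r, symmetric]) (simp add: trilinear_def linearity_simps glin)
    also have "\<dots> = tsum (\<Delta> r) (\<lambda>w d. \<epsilon> w *\<^sub>C ((G1 a * G2 (S d)) \<otimes> 1))"
      by (rule \<Delta>_cong[OF r]) (simp add: tsum_tensor_left antipode_r tensor_scaleC_right)
    also have "\<dots> = (G1 a * G2 (S r)) \<otimes> 1"
      by (rule counit_left[OF r]) (simp add: linearity_simps glin)
    finally show "tsum (\<Delta> r) (\<lambda>b y. tsum (\<Delta> y) (\<lambda>c d. (G1 a * G2 (S d)) \<otimes> (b * S c))) = (G1 a * G2 (S r)) \<otimes> 1" .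
  qed
  also have "\<dots> = V h \<otimes> 1"
    by (simp add: V_def tsum_tensor_right)
  finally show ?thesis .
qed

text \<open>As \<open>V\<close> is coinvariant, only the factor \<open>G1 (S x)\<close> contributes
  to the coaction.\<close>

lemma R_Q:
  assumes h: "h \<in> H"
  shows "R (Q h) = tsum (\<Delta> h) (\<lambda>x y. Q y \<otimes> S x)"
proof -
  have "R (Q h) = tsum (\<Delta> h) (\<lambda>x y. R (G1 (S x) * V y))"
    unfolding Q_def by (rule tsum_push[OF lin_R])
  also have "\<dots> = tsum (\<Delta> h) (\<lambda>x y. tsum (\<Delta> x) (\<lambda>a b. (G1 (S b) * V y) \<otimes> S a))"
    by (rule \<Delta>_cong[OF h])
      (simp add: R_mult G_mem V_mem H_rules R_V R_GS[OF lin_G(1) G1_colinear] times_tensor_eq_tsum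
        tsum_tsum tsum_pure linearity_simps vlin)
  also have "\<dots> = tsum (\<Delta> h) (\<lambda>a x. tsum (\<Delta> x) (\<lambda>b y. (G1 (S b) * V y) \<otimes> S a))"
    by (rule coassoc[OF h]) (simp add: trilinear_def linearity_simps vlin)
  also have "\<dots> = tsum (\<Delta> h) (\<lambda>x y. Q y \<otimes> S x)"
    by (simp add: Q_def tsum_tensor_right)
  finally show ?thesis .
qed

text \<open>The convolution of the first defect with \<open>G2 \<circ> S\<close>, since
  \<open>Q\<close> is \<open>M1 * (G2 \<circ> S)\<close>.\<close>

definition A2 :: "'a \<Rightarrow> 'p" where "A2 h = G2 (S h) - Q h"

definition conn :: "'a \<Rightarrow> ('p, 'p) tensor" where
  "conn h = tsum (\<Delta> h) (\<lambda>x y. G1 (S x) \<otimes> G1 y) + tsum (\<Delta> h) (\<lambda>x y. A2 x \<otimes> G2 y)"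

lemma lin_A2: "clinear A2"
  by (rule clinearI) (simp_all add: A2_def vlin complex_vector.scale_right_diff_distrib)

lemma A2_mem: "h \<in> H \<Longrightarrow> A2 h \<in> P"
  by (simp add: A2_def P_rules G_mem H_rules Q_mem)

lemma R_A2: "h \<in> H \<Longrightarrow> R (A2 h) = tsum (\<Delta> h) (\<lambda>x y. A2 y \<otimes> S x)"
  by (simp add: A2_def clinear_diff[OF lin_R] R_Q R_GS[OF lin_G(2) G2_colinear] tensor_diff_left tsum_diff_fun)

text \<open>Right colinearity of \<open>h \<mapsto> A(h1) \<otimes> G(h2)\<close> involves the
  coaction on \<open>G\<close>, left colinearity only that on \<open>A\<close>; each is
  coassociativity. Both summands of \<open>conn\<close> have this form.\<close>

lemma colinear_pair:
  assumes A: "clinear A" and G: "clinear G" and h: "h \<in> H"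
  shows "(\<And>h. h \<in> H \<Longrightarrow> R (G h) = tsum (\<Delta> h) (\<lambda>x y. G x \<otimes> y)) \<Longrightarrow>
      tsum (tsum (\<Delta> h) (\<lambda>x y. A x \<otimes> G y)) (\<lambda>p q. p \<otimes> R q) =
      tsum (\<Delta> h) (\<lambda>x y. tsum (tsum (\<Delta> x) (\<lambda>x y. A x \<otimes> G y)) (\<lambda>p q. p \<otimes> (q \<otimes> y)))"
    and "(\<And>h. h \<in> H \<Longrightarrow> R (A h) = tsum (\<Delta> h) (\<lambda>x y. A y \<otimes> S x)) \<Longrightarrow>
      tsum (tsum (\<Delta> h) (\<lambda>x y. A x \<otimes> G y)) (\<lambda>p q. R p \<otimes> q) =
      tsum (\<Delta> h) (\<lambda>x y. tsum (tsum (\<Delta> y) (\<lambda>x y. A x \<otimes> G y)) (\<lambda>p q. (p \<otimes> S x) \<otimes> q))"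
proof -
  note L = linearity_simps glin A[THEN clinear_add] A[THEN clinear_scaleC] G[THEN clinear_add] G[THEN clinear_scaleC]
  assume Gc: "\<And>h. h \<in> H \<Longrightarrow> R (G h) = tsum (\<Delta> h) (\<lambda>x y. G x \<otimes> y)"
  have "tsum (tsum (\<Delta> h) (\<lambda>x y. A x \<otimes> G y)) (\<lambda>p q. p \<otimes> R q) = tsum (\<Delta> h) (\<lambda>x y. A x \<otimes> R (G y))"
    by (simp add: tsum_tsum tsum_pure L)
  also have "\<dots> = tsum (\<Delta> h) (\<lambda>x y. tsum (\<Delta> y) (\<lambda>a b. A x \<otimes> (G a \<otimes> b)))"
    by (rule \<Delta>_cong[OF h]) (simp add: Gc tsum_tensor_left)
  also have "\<dots> = tsum (\<Delta> h) (\<lambda>x y. tsum (\<Delta> x) (\<lambda>a b. A a \<otimes> (G b \<otimes> y)))"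
    by (rule coassoc[OF h, symmetric]) (simp add: trilinear_def L)
  also have "\<dots> = tsum (\<Delta> h) (\<lambda>x y. tsum (tsum (\<Delta> x) (\<lambda>x y. A x \<otimes> G y)) (\<lambda>p q. p \<otimes> (q \<otimes> y)))"
    by (simp add: tsum_tsum tsum_pure L)
  finally show "tsum (tsum (\<Delta> h) (\<lambda>x y. A x \<otimes> G y)) (\<lambda>p q. p \<otimes> R q) =
      tsum (\<Delta> h) (\<lambda>x y. tsum (tsum (\<Delta> x) (\<lambda>x y. A x \<otimes> G y)) (\<lambda>p q. p \<otimes> (q \<otimes> y)))" .
next
  note L = linearity_simps glin A[THEN clinear_add] A[THEN clinear_scaleC] G[THEN clinear_add] G[THEN clinear_scaleC]
  assume Ac: "\<And>h. h \<in> H \<Longrightarrow> R (A h) = tsum (\<Delta> h) (\<lambda>x y. A y \<otimes> S x)"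
  have "tsum (tsum (\<Delta> h) (\<lambda>x y. A x \<otimes> G y)) (\<lambda>p q. R p \<otimes> q) = tsum (\<Delta> h) (\<lambda>x y. R (A x) \<otimes> G y)"
    by (simp add: tsum_tsum tsum_pure L)
  also have "\<dots> = tsum (\<Delta> h) (\<lambda>x y. tsum (\<Delta> x) (\<lambda>a b. (A b \<otimes> S a) \<otimes> G y))"
    by (rule \<Delta>_cong[OF h]) (simp add: Ac tsum_tensor_right)
  also have "\<dots> = tsum (\<Delta> h) (\<lambda>x y. tsum (\<Delta> y) (\<lambda>a b. (A a \<otimes> S x) \<otimes> G b))"
    by (rule coassoc[OF h]) (simp add: trilinear_def L)
  also have "\<dots> = tsum (\<Delta> h) (\<lambda>x y. tsum (tsum (\<Delta> y) (\<lambda>x y. A x \<otimes> G y)) (\<lambda>p q. (p \<otimes> S x) \<otimes> q))"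
    by (simp add: tsum_tsum tsum_pure L)
  finally show "tsum (tsum (\<Delta> h) (\<lambda>x y. A x \<otimes> G y)) (\<lambda>p q. R p \<otimes> q) =
      tsum (\<Delta> h) (\<lambda>x y. tsum (tsum (\<Delta> y) (\<lambda>x y. A x \<otimes> G y)) (\<lambda>p q. (p \<otimes> S x) \<otimes> q))" .
qed

text \<open>The product of the legs is \<open>M1 + M2 - M1 * M2\<close> in convolution, that is,
  \<epsilon> minus the convolution of the two defects, and the latter is zero.\<close>

lemma conn_split:
  assumes h: "h \<in> H"
  shows "tsum (conn h) (*) = \<epsilon> h *\<^sub>C 1"
proof -
  have Q: "Q x = tsum (\<Delta> x) (\<lambda>z b. M1 z * G2 (S b))" if x: "x \<in> H" for x
  proof -
    have "Q x = tsum (\<Delta> x) (\<lambda>u w. tsum (\<Delta> w) (\<lambda>a b. G1 (S u) * (G1 a * G2 (S b))))"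
      by (simp add: Q_def V_def tsum_mult_left)
    also have "\<dots> = tsum (\<Delta> x) (\<lambda>z b. tsum (\<Delta> z) (\<lambda>u a. G1 (S u) * (G1 a * G2 (S b))))"
      by (rule coassoc[OF x, symmetric]) (simp add: trilinear_def linearity_simps glin)
    finally show ?thesis by (simp add: M1_def flip: tsum_mult_right mult.assoc)
  qed
  have "tsum (\<Delta> h) (\<lambda>x y. Q x * G2 y) = tsum (\<Delta> h) (\<lambda>x y. tsum (\<Delta> x) (\<lambda>z b. M1 z * (G2 (S b) * G2 y)))"
    by (rule \<Delta>_cong[OF h]) (simp add: Q flip: tsum_mult_right mult.assoc)
  also have "\<dots> = tsum (\<Delta> h) (\<lambda>z w. tsum (\<Delta> w) (\<lambda>b y. M1 z * (G2 (S b) * G2 y)))"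
    by (rule coassoc[OF h]) (simp add: trilinear_def linearity_simps vlin)
  also have "\<dots> = tsum (\<Delta> h) (\<lambda>z w. M1 z * M2 w)"
    by (simp add: M2_def tsum_mult_left)
  finally have QM: "tsum (\<Delta> h) (\<lambda>x y. Q x * G2 y) = tsum (\<Delta> h) (\<lambda>z w. M1 z * M2 w)" .
  \<comment> \<open>The scalars are kept outside the products so that the two counit laws apply term
    by term.\<close>
  have expand: "(a *\<^sub>C 1 - m) * (b *\<^sub>C 1 - n) = a *\<^sub>C (b *\<^sub>C 1 - n) - b *\<^sub>C m + m * n" for a b and m n :: 'p
    by (simp add: left_diff_distrib right_diff_distrib complex_vector.scale_right_diff_distrib mult.commute[of a b])
  have "0 = tsum (\<Delta> h) (\<lambda>x y. (\<epsilon> x *\<^sub>C 1 - M1 x) * (\<epsilon> y *\<^sub>C 1 - M2 y))"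
    using G_cross[OF h] by (simp add: M1_def M2_def)
  also have "\<dots> = tsum (\<Delta> h) (\<lambda>x y. \<epsilon> x *\<^sub>C (\<epsilon> y *\<^sub>C 1 - M2 y)) - tsum (\<Delta> h) (\<lambda>x y. \<epsilon> y *\<^sub>C M1 x)
      + tsum (\<Delta> h) (\<lambda>x y. M1 x * M2 y)"
    unfolding tsum_diff_fun[symmetric] tsum_add_fun[symmetric]
    by (simp only: expand)
  also have "tsum (\<Delta> h) (\<lambda>x y. \<epsilon> x *\<^sub>C (\<epsilon> y *\<^sub>C 1 - M2 y)) = \<epsilon> h *\<^sub>C 1 - M2 h"
    by (rule counit_left[OF h, of "\<lambda>y. \<epsilon> y *\<^sub>C 1 - M2 y"], rule clinearI)
      (simp_all add: linearity_simps vlin complex_vector.scale_right_diff_distrib)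
  also have "tsum (\<Delta> h) (\<lambda>x y. \<epsilon> y *\<^sub>C M1 x) = M1 h"
    by (rule counit_right[OF h lin_M(1)])
  finally have e: "\<epsilon> h *\<^sub>C 1 = M1 h + (M2 h - tsum (\<Delta> h) (\<lambda>x y. M1 x * M2 y))"
    by (simp add: algebra_simps)
  have "tsum (conn h) (*) = M1 h + tsum (\<Delta> h) (\<lambda>x y. A2 x * G2 y)"
    by (simp add: conn_def M1_def tsum_tsum tsum_pure linearity_simps)
  also have "tsum (\<Delta> h) (\<lambda>x y. A2 x * G2 y) = M2 h - tsum (\<Delta> h) (\<lambda>x y. M1 x * M2 y)"
    by (simp add: A2_def left_diff_distrib tsum_diff_fun QM M2_def)
  finally show ?thesis using e by simp
qed

sublocale strong_connection H \<Delta> \<epsilon> S Si \<pi> i P R conn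
proof
  show "clinear conn"
    by (simp add: conn_def linearity_simps glin lin_A2[THEN clinear_add] lin_A2[THEN clinear_scaleC] algebra_simps)
next
  fix h assume h: "h \<in> H"
  show "conn h \<in> P \<otimes>\<^sub>s P"
    unfolding conn_def
    by (intro complex_vector.subspace_add csubspace_tensor_set \<Delta>_sum_mem h)
      (auto intro!: tensor_mem G_mem A2_mem H_rules)
  show "tsum (conn h) (*) = \<epsilon> h *\<^sub>C 1" by (rule conn_split[OF h])
  have GS: "clinear (\<lambda>h. G1 (S h))" by (simp add: linearity_simps glin)
  show "tsum (conn h) (\<lambda>p q. p \<otimes> R q) = tsum (\<Delta> h) (\<lambda>x y. tsum (conn x) (\<lambda>p q. p \<otimes> (q \<otimes> y)))"
    using colinear_pair(1)[OF GS lin_G(1) h G1_colinear] colinear_pair(1)[OF lin_A2 lin_G(2) h G2_colinear]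
    by (simp add: conn_def tsum_add linearity_simps glin)
  show "tsum (conn h) (\<lambda>p q. R p \<otimes> q) = tsum (\<Delta> h) (\<lambda>x y. tsum (conn y) (\<lambda>p q. (p \<otimes> S x) \<otimes> q))"
    using colinear_pair(2)[OF GS lin_G(1) h R_GS[OF lin_G(1) G1_colinear]] colinear_pair(2)[OF lin_A2 lin_G(2) h R_A2]
    by (simp add: conn_def tsum_add linearity_simps glin)
qed

end

section \<open>The coaction on function algebras\<close>

definition inl :: "'a::complex_vector \<Rightarrow> 'a \<times> 'b::complex_vector" where "inl x = (x, 0)"

definition inr :: "'b::complex_vector \<Rightarrow> 'a::complex_vector \<times> 'b" where "inr y = (0, y)"

lemma clinear_inl: "clinear inl" and clinear_inr: "clinear inr"
  by (auto simp: inl_def inr_def clinear_on_def scaleC_prod_def)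

lemmas inl_inr_linear = clinear_inl[THEN clinear_add] clinear_inl[THEN clinear_scaleC] clinear_zero[OF clinear_inl]
  clinear_inr[THEN clinear_add] clinear_inr[THEN clinear_scaleC] clinear_zero[OF clinear_inr]

lemma inl_inr_mult:
  "inl x * inl y = inl (x * y)" "inr u * inr v = inr (u * v)" "inl x * inr v = 0" "inr v * inl x = 0"
  by (simp_all add: inl_def inr_def times_prod_def zero_prod_def)

lemma fst_snd_inl_inr [simp]:
  "fst (inl x) = x" "snd (inl x) = 0" "fst (inr y) = 0" "snd (inr y) = y"
  "fst (c *\<^sub>C p) = c *\<^sub>C fst p" "snd (c *\<^sub>C p) = c *\<^sub>C snd p"
  by (simp_all add: inl_def inr_def scaleC_prod_def)

lemma inl_plus_inr: "inl x + inr y = (x, y)"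
  by (simp add: inl_def inr_def)

lemma tensor_map_mult:
  assumes f: "clinear f" "\<And>x y. f (x * y) = f x * f y"
  shows "tensor_map f id (s * t) = tensor_map f id s * tensor_map f id t"
proof -
  note L = linearity_simps f(1)[THEN clinear_add] f(1)[THEN clinear_scaleC]
  have lid: "clinear id" by (simp add: clinear_on_def)
  show ?thesis
    unfolding tensor_map_eq_tsum[OF f(1) lid] times_tensor_eq_tsum by (simp add: tsum_tsum tsum_pure L f(2))
qed

definition const_fun :: "'b \<Rightarrow> 'x \<Rightarrow> 'b" where "const_fun x = (\<lambda>_. x)"

lemma const_linear:
  "const_fun (x + y :: 'a::complex_algebra_1) = const_fun x + const_fun y" "const_fun (c *\<^sub>C x) = c *\<^sub>C const_fun x"
  "const_fun (x * y) = const_fun x * const_fun y" "const_fun (1 :: 'a::complex_algebra_1) = 1"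
  by (simp_all add: fun_eq_iff scaleC_fun_def const_fun_def one_fun_def)

context hopf begin

definition RF :: "('f::complex_algebra_1, 'a) tensor \<Rightarrow> (('f, 'a) tensor, 'a) tensor" where
  "RF f = tsum f (\<lambda>a h. tsum (\<Delta> h) (\<lambda>b c. (a \<otimes> b) \<otimes> c))"

lemma clinear_RF: "clinear RF"
  by (simp add: RF_def linearity_simps hlin)

lemmas rlin = hlin clinear_RF[THEN clinear_add] clinear_RF[THEN clinear_scaleC]

lemma RF_pure: "RF (a \<otimes> h) = tsum (\<Delta> h) (\<lambda>b c. (a \<otimes> b) \<otimes> c)"
  by (simp add: RF_def tsum_pure linearity_simps hlin)

lemma RF_mem:
  assumes "f \<in> F \<otimes>\<^sub>s H"
  shows "RF f \<in> (F \<otimes>\<^sub>s H) \<otimes>\<^sub>s H"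
  by (rule clinear_image_tensor_set[OF clinear_RF assms csubspace_tensor_set])
    (auto simp: RF_pure intro!: \<Delta>_sum_mem csubspace_tensor_set tensor_mem)

text \<open>Stated for an arbitrary trilinear \<open>F\<close> rather than as an identity of
  tensors, so that the embeddings of the two components can be built into \<open>F\<close>.\<close>

lemma RF_coassoc:
  assumes f: "f \<in> UNIV \<otimes>\<^sub>s H" and F: "trilinear F"
  shows "tsum (RF f) (\<lambda>q h. tsum (RF q) (\<lambda>r k. F r k h)) = tsum (RF f) (\<lambda>q h. tsum (\<Delta> h) (\<lambda>k l. F q k l))"
proof -
  have F1: "bilinear_C (F x)" and F2: "bilinear_C (\<lambda>x y. F x y z)" for x z
    using F by (auto simp: trilinear_def)
  note fl = F1[unfolded bilinear_C_def clinear_on_def, simplified] F2[unfolded bilinear_C_def clinear_on_def, simplified]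
  have b1: "bilinear_C (\<lambda>q h. tsum (RF q) (\<lambda>r k. F r k h))"
    by (rule bilinear_CI) (simp_all add: tsum_add tsum_scaleC F2 fl tsum_add_fun tsum_scaleC_fun rlin)
  have b2: "bilinear_C (\<lambda>q h. tsum (\<Delta> h) (\<lambda>k l. F q k l))"
    by (rule bilinear_CI) (simp_all add: tsum_add tsum_scaleC F1 fl tsum_add_fun tsum_scaleC_fun rlin)
  have "tsum (RF f) (\<lambda>q h. tsum (RF q) (\<lambda>r k. F r k h)) =
      tsum f (\<lambda>a h. tsum (\<Delta> h) (\<lambda>b c. tsum (\<Delta> b) (\<lambda>x y. F (a \<otimes> x) y c)))"
    by (simp add: RF_def[of f] tsum_tsum[OF b1] tsum_pure[OF b1] RF_pure tsum_tsum[OF F2] tsum_pure[OF F2])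
  also have "\<dots> = tsum f (\<lambda>a h. tsum (\<Delta> h) (\<lambda>b c. tsum (\<Delta> c) (\<lambda>x y. F (a \<otimes> b) x y)))"
    by (rule tsum_cong[OF complex_vector.subspace_UNIV H_rules(1) f], rule coassoc)
      (simp_all add: trilinear_def linearity_simps fl)
  also have "\<dots> = tsum (RF f) (\<lambda>q h. tsum (\<Delta> h) (\<lambda>k l. F q k l))"
    by (simp add: RF_def[of f] tsum_tsum[OF b2] tsum_pure[OF b2])
  finally show ?thesis .
qed

lemma RF_counit:
  assumes f: "f \<in> UNIV \<otimes>\<^sub>s H"
  shows "tsum (RF f) (\<lambda>q h. \<epsilon> h *\<^sub>C q) = f"
proof -
  have "tsum (RF f) (\<lambda>q h. \<epsilon> h *\<^sub>C q) = tsum f (\<lambda>a h. tsum (\<Delta> h) (\<lambda>b c. \<epsilon> c *\<^sub>C (a \<otimes> b)))"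
    by (simp add: RF_def tsum_tsum tsum_pure linearity_simps hlin)
  also have "\<dots> = tsum f (\<lambda>a h. a \<otimes> h)"
    by (rule tsum_cong[OF complex_vector.subspace_UNIV H_rules(1) f], rule counit_right)
      (simp_all add: linearity_simps)
  finally show ?thesis by simp
qed

lemma RF_mult:
  assumes f: "f \<in> UNIV \<otimes>\<^sub>s H" and g: "g \<in> UNIV \<otimes>\<^sub>s H"
  shows "RF (f * g) = RF f * RF g"
proof (rule tensor_set_eqI[of "\<lambda>f. RF (f * g)" "\<lambda>f. RF f * RF g", OF _ _ _ f])
  fix a h assume h: "h \<in> H"
  show "RF ((a \<otimes> h) * g) = RF (a \<otimes> h) * RF g"
  proof (rule tensor_set_eqI[of "\<lambda>g. RF ((a \<otimes> h) * g)" "\<lambda>g. RF (a \<otimes> h) * RF g", OF _ _ _ g])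
    fix b k assume k: "k \<in> H"
    have "RF ((a \<otimes> h) * (b \<otimes> k)) = tsum (\<Delta> h) (\<lambda>x y. tsum (\<Delta> k) (\<lambda>z w. ((a * b) \<otimes> (x * z)) \<otimes> (y * w)))"
      by (simp add: RF_pure) (rule \<Delta>_mult_sum[OF h k], simp add: linearity_simps)
    also have "\<dots> = RF (a \<otimes> h) * RF (b \<otimes> k)"
      by (simp add: RF_pure times_tensor_eq_tsum[of "tsum _ _" "tsum _ _"] tsum_tsum tsum_pure linearity_simps)
    finally show "RF ((a \<otimes> h) * (b \<otimes> k)) = RF (a \<otimes> h) * RF (b \<otimes> k)" .
  qed (simp_all add: linearity_simps rlin)
qed (simp_all add: linearity_simps rlin)

lemma RF_1: "RF 1 = 1"
  by (simp add: one_tensor_def RF_pure \<Delta>_1 tsum_pure linearity_simps)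

section \<open>Colinear maps into function algebras\<close>

definition D :: "'a \<Rightarrow> ('x \<Rightarrow> 'a, 'a) tensor" where
  "D h = tsum (\<Delta> h) (\<lambda>x y. const_fun x \<otimes> y)"

lemma clinear_D: "clinear D"
  by (simp add: D_def linearity_simps const_linear hlin)

lemma D_1: "D 1 = 1"
  by (simp add: D_def \<Delta>_1 one_tensor_def tsum_pure linearity_simps const_linear)

lemma D_mult: "h \<in> H \<Longrightarrow> k \<in> H \<Longrightarrow> D (h * k) = D h * D k"
  unfolding D_def
  by (subst \<Delta>_mult_sum)
    (simp_all add: linearity_simps const_linear times_tensor_eq_tsum tsum_tsum tsum_pure)

lemma RF_D:
  assumes h: "h \<in> H"
  shows "RF (D h) = tsum (\<Delta> h) (\<lambda>x y. D x \<otimes> y)"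
proof -
  have "RF (D h) = tsum (\<Delta> h) (\<lambda>x y. tsum (\<Delta> y) (\<lambda>b c. (const_fun x \<otimes> b) \<otimes> c))"
    by (simp add: D_def RF_def tsum_tsum tsum_pure linearity_simps hlin)
  also have "\<dots> = tsum (\<Delta> h) (\<lambda>x y. tsum (\<Delta> x) (\<lambda>b c. (const_fun b \<otimes> c) \<otimes> y))"
    by (rule coassoc[OF h, symmetric]) (simp add: trilinear_def linearity_simps const_linear)
  finally show ?thesis by (simp add: D_def tsum_tensor_right)
qed

lemma D_mem:
  assumes "h \<in> H" "\<And>x. const_fun x \<in> F"
  shows "D h \<in> F \<otimes>\<^sub>s H"
  unfolding D_def using assms by (intro \<Delta>_sum_mem csubspace_tensor_set) (auto intro: tensor_mem)

text \<open>The coaction acts on the \<open>H\<close>-leg alone, so it commutes with multiplication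
  by an element of the function leg. This keeps interpolated maps colinear.\<close>

lemma RF_mult_left: "RF ((k \<otimes> 1) * f) = tsum (RF f) (\<lambda>q h. ((k \<otimes> 1) * q) \<otimes> h)"
  by (rule tensor_eqI) (simp_all add: linearity_simps rlin, simp add: RF_pure tsum_tsum tsum_pure linearity_simps)

text \<open>Applied with \<open>l = 1 - k\<close>: interpolation between \<open>X\<close> and
  \<open>Y\<close> with weight function \<open>k\<close>.\<close>

definition mix :: "'f \<Rightarrow> 'f \<Rightarrow> ('a \<Rightarrow> ('f::complex_algebra_1, 'a) tensor) \<Rightarrow> ('a \<Rightarrow> ('f, 'a) tensor) \<Rightarrow> 'a \<Rightarrow> ('f, 'a) tensor" where
  "mix k l X Y h = (k \<otimes> 1) * X h + (l \<otimes> 1) * Y h"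

lemma clinear_mix: "clinear X \<Longrightarrow> clinear Y \<Longrightarrow> clinear (mix k l X Y)"
  by (simp add: mix_def linearity_simps)

lemma RF_mix:
  assumes "RF (X h) = tsum (\<Delta> h) (\<lambda>x y. X x \<otimes> y)" "RF (Y h) = tsum (\<Delta> h) (\<lambda>x y. Y x \<otimes> y)"
  shows "RF (mix k l X Y h) = tsum (\<Delta> h) (\<lambda>x y. mix k l X Y x \<otimes> y)"
  unfolding mix_def clinear_add[OF clinear_RF] RF_mult_left assms
  by (simp add: tsum_tsum tsum_pure linearity_simps)

lemma RF_unit: "RF (1 \<otimes> h) = tsum (\<Delta> h) (\<lambda>x y. (1 \<otimes> x) \<otimes> y)"
  by (rule RF_pure)

section \<open>The coaction on pairs\<close>

definition R :: "('f::complex_algebra_1, 'a) tensor \<times> ('g::complex_algebra_1, 'a) tensor \<Rightarrow>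
    (('f, 'a) tensor \<times> ('g, 'a) tensor, 'a) tensor" where
  "R p = tsum (RF (fst p)) (\<lambda>q h. inl q \<otimes> h) + tsum (RF (snd p)) (\<lambda>q h. inr q \<otimes> h)"

lemma clinear_R: "clinear R"
  by (rule clinearI) (simp_all add: R_def linearity_simps inl_inr_linear rlin)

lemma tsum_R:
  assumes "bilinear_C F"
  shows "tsum (R p) F = tsum (RF (fst p)) (\<lambda>q h. F (inl q) h) + tsum (RF (snd p)) (\<lambda>q h. F (inr q) h)"
  by (simp add: R_def tsum_add tsum_tsum tsum_pure assms)

lemma R_inl: "R (inl q) = tsum (RF q) (\<lambda>r k. inl r \<otimes> k)"
  and R_inr: "R (inr q) = tsum (RF q) (\<lambda>r k. inr r \<otimes> k)"
  by (simp_all add: R_def clinear_zero[OF clinear_RF] tsum_zero linearity_simps inl_inr_linear)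

lemma R_coassoc_pair:
  assumes p: "fst p \<in> UNIV \<otimes>\<^sub>s H" "snd p \<in> UNIV \<otimes>\<^sub>s H"
  shows "tensor_map R id (R p) = tensor_assoc (tensor_map id \<Delta> (R p))"
proof -
  have lid: "clinear id" by (simp add: clinear_on_def)
  note L = linearity_simps inl_inr_linear rlin clinear_R[THEN clinear_add] clinear_R[THEN clinear_scaleC]
  have "tensor_map R id (R p) = tsum (RF (fst p)) (\<lambda>q h. R (inl q) \<otimes> h) + tsum (RF (snd p)) (\<lambda>q h. R (inr q) \<otimes> h)"
    by (simp add: tensor_map_eq_tsum clinear_R lid tsum_R L)
  also have "\<dots> = tsum (RF (fst p)) (\<lambda>q h. tsum (RF q) (\<lambda>r k. (inl r \<otimes> k) \<otimes> h)) +
      tsum (RF (snd p)) (\<lambda>q h. tsum (RF q) (\<lambda>r k. (inr r \<otimes> k) \<otimes> h))"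
    by (simp add: R_inl R_inr tsum_tensor_right)
  also have "tsum (RF (fst p)) (\<lambda>q h. tsum (RF q) (\<lambda>r k. (inl r \<otimes> k) \<otimes> h)) =
      tsum (RF (fst p)) (\<lambda>q h. tsum (\<Delta> h) (\<lambda>k l. (inl q \<otimes> k) \<otimes> l))"
    by (rule RF_coassoc[OF p(1)]) (simp add: trilinear_def L)
  also have "tsum (RF (snd p)) (\<lambda>q h. tsum (RF q) (\<lambda>r k. (inr r \<otimes> k) \<otimes> h)) =
      tsum (RF (snd p)) (\<lambda>q h. tsum (\<Delta> h) (\<lambda>k l. (inr q \<otimes> k) \<otimes> l))"
    by (rule RF_coassoc[OF p(2)]) (simp add: trilinear_def L)
  also have "tsum (RF (fst p)) (\<lambda>q h. tsum (\<Delta> h) (\<lambda>k l. (inl q \<otimes> k) \<otimes> l)) +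
      tsum (RF (snd p)) (\<lambda>q h. tsum (\<Delta> h) (\<lambda>k l. (inr q \<otimes> k) \<otimes> l)) = tensor_assoc (tensor_map id \<Delta> (R p))"
    by (simp add: tensor_map_eq_tsum lin lid tensor_assoc_eq_tsum tsum_tsum tsum_R tsum_pure L)
  finally show ?thesis .
qed

lemma R_counit_pair:
  assumes p: "fst p \<in> UNIV \<otimes>\<^sub>s H" "snd p \<in> UNIV \<otimes>\<^sub>s H"
  shows "tsum (R p) (\<lambda>q h. \<epsilon> h *\<^sub>C q) = p"
proof -
  have "tsum (R p) (\<lambda>q h. \<epsilon> h *\<^sub>C q) =
      inl (tsum (RF (fst p)) (\<lambda>q h. \<epsilon> h *\<^sub>C q)) + inr (tsum (RF (snd p)) (\<lambda>q h. \<epsilon> h *\<^sub>C q))"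
    by (simp add: tsum_R linearity_simps rlin inl_inr_linear tsum_push[OF clinear_inl] tsum_push[OF clinear_inr])
  then show ?thesis by (simp add: RF_counit p inl_plus_inr)
qed

text \<open>The embeddings of the two components are multiplicative and annihilate each other, so
  the mixed terms vanish.\<close>

lemma R_mult_pair:
  assumes p: "fst p \<in> UNIV \<otimes>\<^sub>s H" "snd p \<in> UNIV \<otimes>\<^sub>s H" and q: "fst q \<in> UNIV \<otimes>\<^sub>s H" "snd q \<in> UNIV \<otimes>\<^sub>s H"
  shows "R (p * q) = R p * R q"
proof -
  note L = linearity_simps inl_inr_linear
  have l: "tsum s (\<lambda>q h. inl q \<otimes> h) * tsum t (\<lambda>q h. inl q \<otimes> h) = tsum (s * t) (\<lambda>q h. inl q \<otimes> h)"
    and r: "tsum s' (\<lambda>q h. inr q \<otimes> h) * tsum t' (\<lambda>q h. inr q \<otimes> h) = tsum (s' * t') (\<lambda>q h. inr q \<otimes> h)"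
    and lr: "tsum s (\<lambda>q h. inl q \<otimes> h) * tsum t' (\<lambda>q h. inr q \<otimes> h) = 0"
    and rl: "tsum s' (\<lambda>q h. inr q \<otimes> h) * tsum t (\<lambda>q h. inl q \<otimes> h) = 0"
    for s t :: "(('f::complex_algebra_1, 'a) tensor, 'a) tensor" and s' t' :: "(('g::complex_algebra_1, 'a) tensor, 'a) tensor"
    by (simp_all add: times_tensor_eq_tsum[of "tsum _ _" "tsum _ _"] times_tensor_eq_tsum[of s t]
        times_tensor_eq_tsum[of s' t'] tsum_tsum tsum_pure L inl_inr_mult)
  show ?thesis
    unfolding R_def distrib_left distrib_right l r lr rl
    by (simp add: times_prod_def RF_mult p q)
qed

lemma R_1_pair: "R 1 = 1"
proof -
  have 1: "tsum 1 f = f 1 1" if "bilinear_C f" for f :: "'x::complex_algebra_1 \<Rightarrow> 'a \<Rightarrow> 'z::complex_vector"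
    unfolding one_tensor_def using that by (rule tsum_pure)
  have "R 1 = inl 1 \<otimes> 1 + inr 1 \<otimes> 1"
    by (simp add: R_def one_prod_def RF_1 1 linearity_simps inl_inr_linear)
  also have "\<dots> = (1, 1) \<otimes> 1"
    by (simp add: inl_plus_inr flip: tensor_add_left)
  finally show ?thesis
    by (simp only: one_tensor_def[symmetric] one_prod_def[symmetric])
qed

lemma R_pair_colinear:
  assumes "RF (X h) = tsum (\<Delta> h) (\<lambda>x y. X x \<otimes> y)" "RF (Y h) = tsum (\<Delta> h) (\<lambda>x y. Y x \<otimes> y)"
  shows "R (X h, Y h) = tsum (\<Delta> h) (\<lambda>x y. (X x, Y x) \<otimes> y)"
proof -
  have "R (X h, Y h) = tsum (\<Delta> h) (\<lambda>x y. inl (X x) \<otimes> y) + tsum (\<Delta> h) (\<lambda>x y. inr (Y x) \<otimes> y)"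
    by (simp add: R_def assms tsum_tsum tsum_pure linearity_simps inl_inr_linear)
  then show ?thesis
    by (simp add: inl_plus_inr flip: tsum_add_fun tensor_add_left)
qed

text \<open>Slices of the coaction are the operators \<open>id \<otimes> (id \<otimes> \<phi>)\<Delta>\<close>; these commute with evaluation, which
  is why the coaction restricts to subspaces cut out by boundary conditions.\<close>

definition T :: "('a \<Rightarrow> complex) \<Rightarrow> 'a \<Rightarrow> 'a" where
  "T \<phi> h = tsum (\<Delta> h) (\<lambda>b c. \<phi> c *\<^sub>C b)"

lemma clinear_T: "clinear \<phi> \<Longrightarrow> clinear (T \<phi>)"
  by (simp add: T_def linearity_simps hlin)

lemma T_mem: "h \<in> H \<Longrightarrow> T \<phi> h \<in> H"
  unfolding T_def by (rule \<Delta>_sum_mem[OF _ H_rules(1)]) (auto intro: H_rules)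

lemma slice_RF:
  assumes "clinear \<phi>"
  shows "slice_left \<phi> (RF f) = tsum f (\<lambda>a h. a \<otimes> T \<phi> h)"
proof -
  note L = linearity_simps clinear_add[OF assms] clinear_scaleC[OF assms]
  have "slice_left \<phi> (RF f) = tsum (RF f) (\<lambda>a b. \<phi> b *\<^sub>C a)"
    unfolding slice_left_def by (rule tsum_eq_lift) (simp add: L)
  also have "\<dots> = tsum f (\<lambda>a h. a \<otimes> T \<phi> h)"
    by (simp add: RF_def T_def tsum_tsum tsum_pure L flip: tsum_tensor_left)
  finally show ?thesis .
qed

lemma slice_R:
  assumes \<phi>: "clinear \<phi>"
  shows "slice_left \<phi> (R p) = (slice_left \<phi> (RF (fst p)), slice_left \<phi> (RF (snd p)))"
proof -
  note L = linearity_simps clinear_add[OF \<phi>] clinear_scaleC[OF \<phi>]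
  have sl: "slice_left \<phi> t = tsum t (\<lambda>a b. \<phi> b *\<^sub>C a)" for t :: "('z::complex_vector, 'a) tensor"
    unfolding slice_left_def by (rule tsum_eq_lift) (simp add: L)
  have "slice_left \<phi> (R p) = inl (slice_left \<phi> (RF (fst p))) + inr (slice_left \<phi> (RF (snd p)))"
    unfolding sl by (simp add: tsum_R L inl_inr_linear tsum_push[OF clinear_inl] tsum_push[OF clinear_inr])
  then show ?thesis by (simp add: inl_plus_inr)
qed

lemma slice_RF_mem:
  assumes "clinear \<phi>" "f \<in> F \<otimes>\<^sub>s H"
  shows "slice_left \<phi> (RF f) \<in> F \<otimes>\<^sub>s H"
  by (rule clinear_image_tensor_set[OF clinear_slice_left[OF assms(1)] RF_mem[OF assms(2)] csubspace_tensor_set])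
    (auto simp: slice_left_pure[OF assms(1)] intro: complex_vector.subspace_scale[OF csubspace_tensor_set])

lemma slice_RF_map:
  assumes \<phi>: "clinear \<phi>" and g: "clinear g"
  shows "tensor_map g id (slice_left \<phi> (RF f)) = tsum (tensor_map g id f) (\<lambda>a h. a \<otimes> T \<phi> h)"
proof -
  have lid: "clinear id" by (simp add: clinear_on_def)
  show ?thesis
    by (simp add: slice_RF[OF \<phi>] tensor_map_eq_tsum g lid tsum_tsum tsum_pure linearity_simps
        clinear_add[OF g] clinear_scaleC[OF g] clinear_add[OF clinear_T[OF \<phi>]] clinear_scaleC[OF clinear_T[OF \<phi>]])
qed

lemma T_\<Delta>:
  assumes \<phi>: "clinear \<phi>" and h: "h \<in> H"
  shows "tsum (\<Delta> h) (\<lambda>a k. a \<otimes> T \<phi> k) = \<Delta> (T \<phi> h)"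
proof -
  note L = linearity_simps hlin clinear_add[OF \<phi>] clinear_scaleC[OF \<phi>]
  have "tsum (\<Delta> h) (\<lambda>a k. a \<otimes> T \<phi> k) = tsum (\<Delta> h) (\<lambda>a k. tsum (\<Delta> k) (\<lambda>b c. \<phi> c *\<^sub>C (a \<otimes> b)))"
    by (simp add: T_def tensor_scaleC_right flip: tsum_tensor_left)
  also have "\<dots> = tsum (\<Delta> h) (\<lambda>x c. tsum (\<Delta> x) (\<lambda>a b. \<phi> c *\<^sub>C (a \<otimes> b)))"
    by (rule coassoc[OF h, symmetric]) (simp add: trilinear_def L)
  also have "\<dots> = \<Delta> (T \<phi> h)"
    by (simp add: T_def tsum_push[OF lin(1)] L)
  finally show ?thesis .
qed

end

section \<open>The pullback\<close>

lemma subalgebra_preimage: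
  assumes "subalgebra A" "subalgebra W" "clinear g" "\<And>x y. g (x * y) = g x * g y" "g 1 = 1"
  shows "subalgebra {a\<in>A. g a \<in> W}"
  using assms(1,2) subalgebraD[OF assms(1)] subalgebraD[OF assms(2)]
  by (auto simp: subalgebra_def complex_vector.subspace_def clinear_add[OF assms(3)] clinear_scaleC[OF assms(3)]
      clinear_zero[OF assms(3)] assms(4,5))

lemma subalgebra_equalizer:
  assumes A: "subalgebra A" "clinear g" "\<And>x y. g (x * y) = g x * g y" "g 1 = 1"
    and B: "subalgebra B" "clinear g'" "\<And>x y. g' (x * y) = g' x * g' y" "g' 1 = 1"
  shows "subalgebra {(p, q) \<in> A \<times> B. g p = g' q}"
  using subalgebraD[OF A(1)] subalgebraD[OF B(1)]
  by (auto simp: subalgebra_def complex_vector.subspace_def one_prod_def zero_prod_def times_prod_def scaleC_prod_def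
      A(3,4) B(3,4) clinear_add[OF A(2)] clinear_scaleC[OF A(2)] clinear_zero[OF A(2)]
      clinear_add[OF B(2)] clinear_scaleC[OF B(2)] clinear_zero[OF B(2)])

lemma subalgebra_scalars: "subalgebra (range (\<lambda>z. z *\<^sub>C (1 :: 'a::complex_algebra_1)))"
proof -
  have "\<exists>w. a *\<^sub>C (1 :: 'a) + b *\<^sub>C 1 = w *\<^sub>C 1" for a b by (metis scaleC_add_left)
  moreover have "\<exists>w. 0 = w *\<^sub>C (1 :: 'a)" by (metis complex_vector.scale_zero_left)
  moreover have "\<exists>w. 1 = w *\<^sub>C (1 :: 'a)" by (metis scaleC_one)
  ultimately show ?thesis
    by (auto simp: subalgebra_def complex_vector.subspace_def image_iff)
qed

text \<open>The properties common to all evaluation maps, so that the three boundary points on the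
  two halves are treated alike.\<close>

definition evaluation :: "(('x \<Rightarrow> 'a::complex_algebra_1) \<Rightarrow> 'a) \<Rightarrow> bool" where
  "evaluation e \<longleftrightarrow> clinear e \<and> (\<forall>f g. e (f * g) = e f * e g) \<and> (\<forall>x. e (const_fun x) = x)"

lemma evaluation_ev: "evaluation (ev_left t)" "evaluation (ev_right t)"
  by (simp_all add: evaluation_def clinear_on_def ev_left_def ev_right_def scaleC_fun_def const_fun_def)

lemma
  assumes e: "evaluation e"
  shows clinear_evaluation: "clinear e"
    and evaluation_mult: "tensor_map e id (f * g) = tensor_map e id f * tensor_map e id g"
    and evaluation_1: "tensor_map e id 1 = 1"
    and clinear_evaluation_map: "clinear (tensor_map e id)"
    and evaluation_pure: "tensor_map e id (a \<otimes> h) = e a \<otimes> h"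
    and evaluation_one: "e 1 = 1"
proof -
  have lid: "clinear id" by (simp add: clinear_on_def)
  show l: "clinear e" using e by (simp add: evaluation_def)
  show "tensor_map e id (f * g) = tensor_map e id f * tensor_map e id g"
    using e by (intro tensor_map_mult) (simp_all add: evaluation_def)
  show "clinear (tensor_map e id)" by (rule clinear_tensor_map[OF l lid])
  show p: "tensor_map e id (a \<otimes> h) = e a \<otimes> h" for a h using tensor_map_pure[OF l lid] by simp
  have "e (const_fun 1) = 1" using e by (simp add: evaluation_def)
  then show o: "e 1 = 1" by (simp add: const_fun_def one_fun_def)
  show "tensor_map e id 1 = 1" by (simp add: one_tensor_def p o)
qed

lemma C_left_subalgebra: "subalgebra (C_left :: (left_half \<Rightarrow> 'a::cstar_algebra) set)"
proof -
  have "continuous_on A (\<lambda>t. c *\<^sub>C f t)" if "continuous_on A f" for A :: "real set" and c and f :: "real \<Rightarrow> 'a"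
    using continuous_on_mult[OF continuous_on_const that, of "c *\<^sub>C 1"] by simp
  then show ?thesis
    by (auto simp: subalgebra_def complex_vector.subspace_def C_left_def zero_fun_def one_fun_def plus_fun_def
        times_fun_def scaleC_fun_def intro!: continuous_intros)
qed

lemma C_right_subalgebra: "subalgebra (C_right :: (right_half \<Rightarrow> 'a::cstar_algebra) set)"
proof -
  have "continuous_on A (\<lambda>t. c *\<^sub>C f t)" if "continuous_on A f" for A :: "real set" and c and f :: "real \<Rightarrow> 'a"
    using continuous_on_mult[OF continuous_on_const that, of "c *\<^sub>C 1"] by simp
  then show ?thesis
    by (auto simp: subalgebra_def complex_vector.subspace_def C_right_def zero_fun_def one_fun_def plus_fun_def
        times_fun_def scaleC_fun_def intro!: continuous_intros)
qed

lemma const_fun_continuous: "const_fun x \<in> C_left" "const_fun x \<in> C_right"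
  by (simp_all add: C_left_def C_right_def const_fun_def)

text \<open>The scalar function \<open>2t\<close>: \<open>0\<close> at the outer end and
  \<open>1\<close> at the gluing point. Its partner \<open>2 - 2t\<close> runs from \<open>1\<close>
  at the gluing point to \<open>0\<close> at the other outer end.\<close>

definition ramp_left :: "left_half \<Rightarrow> 'a::cstar_algebra" where
  "ramp_left = (\<lambda>t. (2 * Rep_left_half t) *\<^sub>R 1)"

definition ramp_right :: "right_half \<Rightarrow> 'a::cstar_algebra" where
  "ramp_right = (\<lambda>t. (2 - 2 * Rep_right_half t) *\<^sub>R 1)"

lemma ramp_continuous: "ramp_left \<in> C_left" "ramp_right \<in> C_right"
proof -
  have "continuous_on {0..1/2} (\<lambda>t. (2 * Rep_left_half (Abs_left_half t)) *\<^sub>R (1 :: 'a)) \<longleftrightarrow>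
      continuous_on {0..1/2} (\<lambda>t. (2 * t) *\<^sub>R (1 :: 'a))"
    by (rule continuous_on_cong) (simp_all add: Abs_left_half_inverse)
  then show "(ramp_left :: _ \<Rightarrow> 'a) \<in> C_left"
    by (simp add: C_left_def ramp_left_def continuous_intros)
  have "continuous_on {1/2..1} (\<lambda>t. (2 - 2 * Rep_right_half (Abs_right_half t)) *\<^sub>R (1 :: 'b)) \<longleftrightarrow>
      continuous_on {1/2..1} (\<lambda>t. (2 - 2 * t) *\<^sub>R (1 :: 'b))"
    by (rule continuous_on_cong) (simp_all add: Abs_right_half_inverse)
  then show "(ramp_right :: _ \<Rightarrow> 'b) \<in> C_right"
    by (simp add: C_right_def ramp_right_def continuous_intros)
qed

lemma ramp_values:
  "ev_left 0 ramp_left = 0" "ev_left (1/2) ramp_left = 1" "ev_right (1/2) ramp_right = 1" "ev_right 1 ramp_right = 0"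
  by (simp_all add: ev_left_def ev_right_def ramp_left_def ramp_right_def Abs_left_half_inverse Abs_right_half_inverse)

context hopf begin

lemma evaluation_D:
  assumes e: "evaluation e"
  shows "tensor_map e id (D h) = \<Delta> h"
  by (simp add: D_def tsum_push[OF clinear_evaluation_map[OF e]] evaluation_pure[OF e])
    (use e in \<open>simp add: evaluation_def\<close>)

lemma evaluation_mix:
  assumes e: "evaluation e"
  shows "tensor_map e id (mix k (1 - k) X Y h) =
    (e k \<otimes> 1) * tensor_map e id (X h) + ((1 - e k) \<otimes> 1) * tensor_map e id (Y h)"
  by (simp add: mix_def clinear_add[OF clinear_evaluation_map[OF e]] evaluation_mult[OF e] evaluation_pure[OF e]
      clinear_diff[OF clinear_evaluation[OF e]] evaluation_one[OF e])

lemma mix_mem: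
  assumes F: "subalgebra F" and "k \<in> F" "X h \<in> F \<otimes>\<^sub>s H" "Y h \<in> F \<otimes>\<^sub>s H"
  shows "mix k (1 - k) X Y h \<in> F \<otimes>\<^sub>s H"
  unfolding mix_def
  by (intro subalgebraD(3,4)[OF subalgebra_tensor_set[OF F subalg]] tensor_mem subalgebraD(2,7)[OF F] H_rules(2) assms)

end

locale pullback = hopf_quotient H \<Delta> \<epsilon> S Si \<pi> i
  for H :: "'a::cstar_algebra set" and \<Delta> \<epsilon> S Si and \<pi> :: "'a \<Rightarrow> 'c::complex_vector" and i
begin

text \<open>On the right half the weight is \<open>1\<close> at the gluing point, giving
  \<open>\<Delta> h\<close> as on the left half, and \<open>0\<close> at the end, giving
  \<open>1 \<otimes> h\<close> as the boundary condition demands.\<close>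

definition G1 :: "'a \<Rightarrow> (left_half \<Rightarrow> 'a, 'a) tensor \<times> (right_half \<Rightarrow> 'a, 'a) tensor" where
  "G1 h = (D h, mix ramp_right (1 - ramp_right) D ((\<otimes>) 1) h)"

text \<open>The mirror image: \<open>1 \<otimes> h\<close> at the gluing point,
  \<open>\<Delta> h\<close> at \<open>0\<close>.\<close>

definition G2 :: "'a \<Rightarrow> (left_half \<Rightarrow> 'a, 'a) tensor \<times> (right_half \<Rightarrow> 'a, 'a) tensor" where
  "G2 h = (mix ramp_left (1 - ramp_left) ((\<otimes>) 1) D h, 1 \<otimes> h)"

lemma pullback_memD:
  assumes "p \<in> P_pullback H \<Delta>"
  shows "fst p \<in> C_left \<otimes>\<^sub>s H" "snd p \<in> C_right \<otimes>\<^sub>s H"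
  using assms by (auto simp: P_pullback_def P_left_def P_right_def)

lemma tensor_set_UNIV_left: "f \<in> F \<otimes>\<^sub>s H \<Longrightarrow> f \<in> UNIV \<otimes>\<^sub>s H"
  using tensor_set_mono[of F UNIV H H] by blast

lemmas pullback_UNIV = pullback_memD[THEN tensor_set_UNIV_left]

lemma unit_tensor_mem: "subalgebra F \<Longrightarrow> h \<in> H \<Longrightarrow> 1 \<otimes> h \<in> F \<otimes>\<^sub>s H"
  by (auto intro: tensor_mem dest: subalgebraD)

lemma subalgebra_\<Delta>: "subalgebra (\<Delta> ` H)"
  unfolding subalgebra_def complex_vector.subspace_def
proof (intro conjI ballI allI)
  show "0 \<in> \<Delta> ` H" using H_rules clinear_zero[OF lin(1)] by (metis image_eqI)
  show "1 \<in> \<Delta> ` H" using H_rules \<Delta>_1 by (metis image_eqI)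
qed (auto simp: \<Delta>_mult[symmetric] hlin[symmetric] H_rules)

lemma subalgebra_pullback: "subalgebra (P_pullback H \<Delta>)"
proof -
  note ev = evaluation_ev[THEN clinear_evaluation_map] evaluation_ev[THEN evaluation_mult] evaluation_ev[THEN evaluation_1]
  have "subalgebra (P_left H \<Delta>)"
    unfolding P_left_def
    by (rule subalgebra_preimage[OF subalgebra_tensor_set[OF C_left_subalgebra subalg] subalgebra_\<Delta>]) (rule ev)+
  moreover have "subalgebra (P_right H)"
    unfolding P_right_def
    by (rule subalgebra_preimage[OF subalgebra_tensor_set[OF C_right_subalgebra subalg]
          subalgebra_tensor_set[OF subalgebra_scalars subalg]]) (rule ev)+
  ultimately show ?thesis
    unfolding P_pullback_def by (intro subalgebra_equalizer) (assumption | rule ev)+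
qed

text \<open>It suffices that every slice of \<open>R p\<close> lies in the pullback. Slicing applies
  \<open>T \<phi>\<close> to the \<open>H\<close>-leg; this commutes with evaluation, so it respects
  the gluing and the condition at \<open>1\<close>, and the condition at \<open>0\<close> is
  preserved by coassociativity.\<close>

lemma R_mem_pullback:
  assumes p: "p \<in> P_pullback H \<Delta>"
  shows "R p \<in> P_pullback H \<Delta> \<otimes>\<^sub>s H"
proof (rule tensor_set_slices)
  show "csubspace H" by (rule H_rules)
  have RF_mem': "tsum (RF f) (\<lambda>q h. g q \<otimes> h) \<in> UNIV \<otimes>\<^sub>s H" if "f \<in> UNIV \<otimes>\<^sub>s H"
    for f :: "('f::complex_algebra_1, 'a) tensor" and g :: "_ \<Rightarrow> 'q::complex_vector"
    by (rule tsum_mem[OF csubspace_tensor_set H_rules(1) RF_mem[OF that] csubspace_tensor_set]) (auto intro: tensor_mem)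
  show "R p \<in> UNIV \<otimes>\<^sub>s H"
    unfolding R_def by (intro complex_vector.subspace_add csubspace_tensor_set RF_mem' pullback_UNIV[OF p])
next
  fix \<phi> :: "'a \<Rightarrow> complex" assume \<phi>: "clinear \<phi>"
  obtain h where h: "h \<in> H" "tensor_map (ev_left 0) id (fst p) = \<Delta> h"
    using p by (auto simp: P_pullback_def P_left_def)
  have "tensor_map (ev_left 0) id (slice_left \<phi> (RF (fst p))) = \<Delta> (T \<phi> h)"
    by (simp add: slice_RF_map[OF \<phi>] clinear_evaluation[OF evaluation_ev(1)] h T_\<Delta>[OF \<phi> h(1)])
  moreover have "tensor_map (ev_right 1) id (slice_left \<phi> (RF (snd p))) \<in> range (\<lambda>z. z *\<^sub>C 1) \<otimes>\<^sub>s H"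
  proof -
    have "tensor_map (ev_right 1) id (snd p) \<in> range (\<lambda>z. z *\<^sub>C 1) \<otimes>\<^sub>s H"
      using p by (auto simp: P_pullback_def P_right_def)
    then show ?thesis
      unfolding slice_RF_map[OF \<phi> clinear_evaluation[OF evaluation_ev(2)]]
      by (rule tsum_mem[OF subalgebraD(1)[OF subalgebra_scalars] H_rules(1) _ csubspace_tensor_set])
        (auto intro!: tensor_mem T_mem)
  qed
  moreover have "tensor_map (ev_left (1/2)) id (slice_left \<phi> (RF (fst p))) =
      tensor_map (ev_right (1/2)) id (slice_left \<phi> (RF (snd p)))"
    using p by (auto simp: P_pullback_def slice_RF_map[OF \<phi>] clinear_evaluation[OF evaluation_ev(1)]
        clinear_evaluation[OF evaluation_ev(2)])
  ultimately show "slice_left \<phi> (R p) \<in> P_pullback H \<Delta>"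
    using slice_RF_mem[OF \<phi> pullback_memD(1)[OF p]] slice_RF_mem[OF \<phi> pullback_memD(2)[OF p]] T_mem[OF h(1)]
    by (auto simp: slice_R[OF \<phi>] P_pullback_def P_left_def P_right_def)
qed

lemma G_mem_pullback:
  assumes h: "h \<in> H"
  shows "G1 h \<in> P_pullback H \<Delta>" "G2 h \<in> P_pullback H \<Delta>"
proof -
  note mem = D_mem[OF h const_fun_continuous(1)] D_mem[OF h const_fun_continuous(2)]
    unit_tensor_mem[OF C_left_subalgebra h] unit_tensor_mem[OF C_right_subalgebra h]
  have 1: "(1 :: 'a) \<otimes> (1 :: 'a) = 1" by (simp add: one_tensor_def)
  have sc: "(1 :: 'a) \<otimes> h \<in> range (\<lambda>z. z *\<^sub>C 1) \<otimes>\<^sub>s H"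
    using h subalgebraD(2)[OF subalgebra_scalars] by (auto intro: tensor_mem)
  note ev = evaluation_D[OF evaluation_ev(1)] evaluation_D[OF evaluation_ev(2)]
    evaluation_mix[OF evaluation_ev(1)] evaluation_mix[OF evaluation_ev(2)]
    evaluation_pure[OF evaluation_ev(1)] evaluation_pure[OF evaluation_ev(2)]
    evaluation_one[OF evaluation_ev(1)] evaluation_one[OF evaluation_ev(2)]
  show "G1 h \<in> P_pullback H \<Delta>" "G2 h \<in> P_pullback H \<Delta>"
    using h mem sc
    by (auto simp: G1_def G2_def P_pullback_def P_left_def P_right_def ev ramp_values 1
        intro!: mix_mem C_left_subalgebra C_right_subalgebra ramp_continuous)
qed

sublocale two_colinear_maps H \<Delta> \<epsilon> S Si \<pi> i "P_pullback H \<Delta>" R G1 G2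
proof
  show "subalgebra (P_pullback H \<Delta>)" by (rule subalgebra_pullback)
  show "clinear R" by (rule clinear_R)
  show "R 1 = 1" by (rule R_1_pair)
  have unit: "clinear ((\<otimes>) 1)" by (simp add: linearity_simps)
  have pair: "clinear (\<lambda>h. (X h, Y h))" if "clinear X" "clinear Y"
    for X :: "'a \<Rightarrow> 'f::complex_vector" and Y :: "'a \<Rightarrow> 'g::complex_vector"
    using that by (auto simp: clinear_on_def scaleC_prod_def)
  show "clinear G1" "clinear G2"
    unfolding G1_def[abs_def] G2_def[abs_def] by (intro pair clinear_D clinear_mix unit)+
next
  fix p assume p: "p \<in> P_pullback H \<Delta>"
  note pU = pullback_UNIV[OF p]
  show "R p \<in> P_pullback H \<Delta> \<otimes>\<^sub>s H" by (rule R_mem_pullback[OF p])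
  show "tensor_map R id (R p) = tensor_assoc (tensor_map id \<Delta> (R p))" by (rule R_coassoc_pair[OF pU])
  show "tsum (R p) (\<lambda>q h. \<epsilon> h *\<^sub>C q) = p" by (rule R_counit_pair[OF pU])
  fix q assume "q \<in> P_pullback H \<Delta>"
  then show "R (p * q) = R p * R q" by (intro R_mult_pair pU pullback_UNIV)
next
  fix h assume h: "h \<in> H"
  show "G1 h \<in> P_pullback H \<Delta>" "G2 h \<in> P_pullback H \<Delta>" using G_mem_pullback[OF h] by auto
  show "R (G1 h) = tsum (\<Delta> h) (\<lambda>x y. G1 x \<otimes> y)" "R (G2 h) = tsum (\<Delta> h) (\<lambda>x y. G2 x \<otimes> y)"
    unfolding G1_def G2_def by (intro R_pair_colinear RF_D[OF h] RF_mix RF_unit)+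
  \<comment> \<open>\<open>D\<close> is a unital algebra map, so \<open>D \<circ> S\<close> is its
    convolution inverse and the defect of \<open>G1\<close> vanishes on the left half. On the right
    half \<open>G2\<close> is an algebra map, and the same holds there.\<close>
  have 1: "tsum (\<Delta> x) (\<lambda>a b. D (S a) * D b) = \<epsilon> x *\<^sub>C 1" if x: "x \<in> H" for x
  proof -
    have "tsum (\<Delta> x) (\<lambda>a b. D (S a) * D b) = tsum (\<Delta> x) (\<lambda>a b. D (S a * b))"
      by (rule \<Delta>_cong[OF x]) (simp add: D_mult H_rules)
    also have "\<dots> = D (tsum (\<Delta> x) (\<lambda>a b. S a * b))"
      by (rule tsum_push[OF clinear_D, symmetric])
    finally show ?thesis by (simp add: antipode_l[OF x] clinear_scaleC[OF clinear_D] D_1)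
  qed
  have "fst (\<epsilon> x *\<^sub>C 1 - tsum (\<Delta> x) (\<lambda>a b. G1 (S a) * G1 b)) = 0" if x: "x \<in> H" for x
  proof -
    have "clinear (fst :: _ \<Rightarrow> (left_half \<Rightarrow> 'a, 'a) tensor)" by (simp add: clinear_on_def)
    then have "fst (tsum (\<Delta> x) (\<lambda>a b. G1 (S a) * G1 b)) = tsum (\<Delta> x) (\<lambda>a b. D (S a) * D b)"
      by (subst tsum_push) (simp_all add: G1_def times_prod_def)
    then show ?thesis by (simp add: 1[OF x] one_prod_def scaleC_prod_def)
  qed
  moreover have "snd (\<epsilon> x *\<^sub>C 1 - tsum (\<Delta> x) (\<lambda>a b. G2 (S a) * G2 b)) = 0" if x: "x \<in> H" for x
  proof -
    have "clinear (snd :: _ \<Rightarrow> (right_half \<Rightarrow> 'a, 'a) tensor)" by (simp add: clinear_on_def)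
    then have "snd (tsum (\<Delta> x) (\<lambda>a b. G2 (S a) * G2 b)) = tsum (\<Delta> x) (\<lambda>a b. 1 \<otimes> (S a * b))"
      by (subst tsum_push) (simp_all add: G2_def times_prod_def)
    also have "\<dots> = 1 \<otimes> tsum (\<Delta> x) (\<lambda>a b. S a * b)" by (simp only: tsum_tensor_left)
    finally show ?thesis
      by (simp add: antipode_l[OF x] one_prod_def scaleC_prod_def one_tensor_def tensor_scaleC_right)
  qed
  \<comment> \<open>In each summand the first factor has zero left component and the second factor
    zero right component.\<close>
  ultimately have "tsum (\<Delta> h) (\<lambda>x y. (\<epsilon> x *\<^sub>C 1 - tsum (\<Delta> x) (\<lambda>a b. G1 (S a) * G1 b)) *
      (\<epsilon> y *\<^sub>C 1 - tsum (\<Delta> y) (\<lambda>a b. G2 (S a) * G2 b))) = tsum (\<Delta> h) (\<lambda>x y. 0)"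
    by (intro \<Delta>_cong[OF h]) (simp add: times_prod_def zero_prod_def)
  then show "tsum (\<Delta> h) (\<lambda>x y. (\<epsilon> x *\<^sub>C 1 - tsum (\<Delta> x) (\<lambda>a b. G1 (S a) * G1 b)) *
      (\<epsilon> y *\<^sub>C 1 - tsum (\<Delta> y) (\<lambda>a b. G2 (S a) * G2 b))) = 0" by simp
qed

end

section \<open>Passing from total maps to maps on the Hopf algebra\<close>

lemma tensor_lift_on_cong:
  assumes "\<And>u v. u \<in> U \<Longrightarrow> v \<in> V \<Longrightarrow> f u v = g u v"
  shows "tensor_lift_on U V f = tensor_lift_on U V g"
proof -
  have "(\<Sum>(u, v)\<leftarrow>xs. f u v) = (\<Sum>(u, v)\<leftarrow>xs. g u v)" if "set xs \<subseteq> U \<times> V" for xs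
    using that assms by (intro arg_cong[where f=sum_list] map_cong) auto
  then have "(set xs \<subseteq> U \<times> V \<and> t = pure_sum xs \<and> y = (\<Sum>(u, v)\<leftarrow>xs. f u v)) =
      (set xs \<subseteq> U \<times> V \<and> t = pure_sum xs \<and> y = (\<Sum>(u, v)\<leftarrow>xs. g u v))" for t xs y by auto
  then show ?thesis unfolding tensor_lift_on_def by (intro ext) simp
qed

lemma coaction_cong:
  assumes P: "subalgebra P" and eq: "\<And>p. p \<in> P \<Longrightarrow> \<rho>' p = \<rho> p"
  shows "coinvariants P \<rho>' = coinvariants P \<rho>" "can_map P \<rho>' = can_map P \<rho>" "entwining P \<rho>' = entwining P \<rho>"
proof -
  show co: "coinvariants P \<rho>' = coinvariants P \<rho>"
    using subalgebraD(3)[OF P] by (auto simp: coinvariants_def eq)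
  show can: "can_map P \<rho>' = can_map P \<rho>"
    unfolding can_map_def by (subst tensor_lift_on_cong[where g="\<lambda>p q. tensor_map (\<lambda>r. p * r) id (\<rho> q)"]) (simp_all add: eq)
  show "entwining P \<rho>' = entwining P \<rho>"
    by (simp add: entwining_def co can)
qed

text \<open>The componentwise coaction and the locale's \<rho> are known to agree only on
  \<open>P\<close>; every clause evaluates the coaction only there.\<close>

lemma principal_comodule_cong:
  assumes p: "principal_comodule P \<delta> \<epsilon> \<rho> e" and eq: "\<And>p. p \<in> P \<Longrightarrow> \<rho>' p = \<rho> p"
  shows "principal_comodule P \<delta> \<epsilon> \<rho>' e"
proof -
  have P: "subalgebra P" using p by (simp add: principal_comodule_def)
  have tm: "tensor_map_on P UNIV \<rho>' id = tensor_map_on P UNIV \<rho> id"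
    unfolding tensor_map_on_def by (rule tensor_lift_on_cong) (simp add: eq)
  have B: "coinvariants P \<rho> \<subseteq> P" by (auto simp: coinvariants_def)
  have tm': "tensor_map_on (coinvariants P \<rho>) P id \<rho>' = tensor_map_on (coinvariants P \<rho>) P id \<rho>"
    unfolding tensor_map_on_def by (rule tensor_lift_on_cong) (simp add: eq)
  have "right_coaction P \<delta> \<epsilon> \<rho>' = right_coaction P \<delta> \<epsilon> \<rho>"
    using subalgebraD(4,5)[OF P] by (auto simp: right_coaction_def clinear_on_def eq tm)
  moreover have "strong_splitting P \<rho>' s = strong_splitting P \<rho> s" for s
    by (simp add: strong_splitting_def Let_def coaction_cong(1)[OF P eq] tm' eq)
  ultimately show ?thesis
    using p subalgebraD(2)[OF P] by (simp add: principal_comodule_def coaction_cong[OF P eq] eq)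
qed

context hopf_quotient begin

text \<open>Primed names here stand for the maps given on \<open>H\<close>, the locale's own names
  for total linear maps with the same values on \<open>H\<close>.\<close>

lemma right_H_coaction_eq:
  assumes F: "csubspace F" and f: "f \<in> F \<otimes>\<^sub>s H" and eq: "\<forall>h\<in>H. \<Delta>' h = \<Delta> h"
  shows "right_H_coaction F H \<Delta>' f = RF f"
proof -
  have "tensor_map_on F H id \<Delta>' f = tsum f (\<lambda>a h. a \<otimes> \<Delta> h)"
    unfolding tensor_map_on_def
    by (rule tensor_lift_on_eq[OF F H_rules(1) f]) (simp_all add: eq linearity_simps hlin)
  then show ?thesis
    by (simp add: right_H_coaction_def tensor_assoc_eq_tsum RF_def tsum_tsum tsum_pure linearity_simps hlin)
qed

lemma rho_R_eq:
  assumes "csubspace F" "f \<in> F \<otimes>\<^sub>s H" "\<forall>h\<in>H. \<Delta>' h = \<Delta> h" "\<forall>h\<in>H. \<pi>' h = \<pi> h"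
  shows "rho_R F H \<Delta>' \<pi>' f = tsum (RF f) (\<lambda>q h. q \<otimes> \<pi> h)"
  unfolding rho_R_def right_H_coaction_eq[OF assms(1-3)] tensor_map_on_def
  by (rule tensor_lift_on_eq[OF csubspace_tensor_set H_rules(1) RF_mem[OF assms(2)]])
    (simp_all add: assms(4) linearity_simps qlin)

lemma rho_L_eq:
  assumes F: "csubspace F" and f: "f \<in> F \<otimes>\<^sub>s H" and eq: "\<forall>h\<in>H. \<Delta>' h = \<Delta> h" "\<forall>h\<in>H. \<pi>' h = \<pi> h"
    "\<forall>h\<in>H. inv_into H S' h = Si h"
  shows "rho_L F H \<Delta>' S' \<pi>' f = tsum (RF f) (\<lambda>q h. \<pi> (Si h) \<otimes> q)"
proof -
  have fl: "tsum (RF f) (\<lambda>q h. h \<otimes> q) \<in> H \<otimes>\<^sub>s (F \<otimes>\<^sub>s H)"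
    by (rule tsum_mem[OF csubspace_tensor_set H_rules(1) RF_mem[OF f] csubspace_tensor_set]) (rule tensor_mem)
  have sm: "tsum (RF f) (\<lambda>q h. Si h \<otimes> q) \<in> H \<otimes>\<^sub>s (F \<otimes>\<^sub>s H)"
    by (rule tsum_mem[OF csubspace_tensor_set H_rules(1) RF_mem[OF f] csubspace_tensor_set]) (intro tensor_mem Si_mem)
  have "left_H_coaction F H \<Delta>' S' f = tsum (tsum (RF f) (\<lambda>q h. h \<otimes> q)) (\<lambda>h q. Si h \<otimes> q)"
    unfolding left_H_coaction_def right_H_coaction_eq[OF F f eq(1)] tensor_flip_eq_tsum tensor_map_on_def
    by (rule tensor_lift_on_eq[OF H_rules(1) csubspace_tensor_set fl]) (simp_all add: eq(3) linearity_simps qlin)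
  also have "\<dots> = tsum (RF f) (\<lambda>q h. Si h \<otimes> q)"
    by (simp add: tsum_tsum tsum_pure linearity_simps qlin)
  finally have "rho_L F H \<Delta>' S' \<pi>' f = tsum (tsum (RF f) (\<lambda>q h. Si h \<otimes> q)) (\<lambda>h q. \<pi> h \<otimes> q)"
    unfolding rho_L_def tensor_map_on_def
    by (simp, intro tensor_lift_on_eq[OF H_rules(1) csubspace_tensor_set sm]) (simp_all add: eq(2) linearity_simps qlin)
  then show ?thesis
    by (simp add: tsum_tsum tsum_pure linearity_simps qlin)
qed

end

lemma inl_inr_eta: "(\<lambda>x. (x, 0)) = inl" "(\<lambda>y. (0, y)) = inr"
  by (simp_all add: fun_eq_iff inl_def inr_def)

context pullback begin

lemma pullback_rho_R_eq:
  assumes "p \<in> P_pullback H \<Delta>" "\<forall>h\<in>H. \<Delta>' h = \<Delta> h" "\<forall>h\<in>H. \<pi>' h = \<pi> h"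
  shows "pullback_rho_R H \<Delta>' \<pi>' p = \<rho> p"
proof -
  have lid: "clinear id" by (simp add: clinear_on_def)
  have l: "rho_R C_left H \<Delta>' \<pi>' (fst p) = tsum (RF (fst p)) (\<lambda>q h. q \<otimes> \<pi> h)"
    by (rule rho_R_eq) (use assms C_left_subalgebra pullback_memD[OF assms(1)] in \<open>auto dest: subalgebraD(1)\<close>)
  have r: "rho_R C_right H \<Delta>' \<pi>' (snd p) = tsum (RF (snd p)) (\<lambda>q h. q \<otimes> \<pi> h)"
    by (rule rho_R_eq) (use assms C_right_subalgebra pullback_memD[OF assms(1)] in \<open>auto dest: subalgebraD(1)\<close>)
  show ?thesis
    unfolding pullback_rho_R_def inl_inr_eta tensor_map_eq_tsum[OF clinear_inl lid] tensor_map_eq_tsum[OF clinear_inr lid] l r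
    by (simp add: \<rho>_def tsum_R tsum_tsum tsum_pure linearity_simps inl_inr_linear qlin)
qed

lemma pullback_rho_L_eq:
  assumes "p \<in> P_pullback H \<Delta>" "\<forall>h\<in>H. \<Delta>' h = \<Delta> h" "\<forall>h\<in>H. \<pi>' h = \<pi> h"
    "\<forall>h\<in>H. inv_into H S' h = Si h"
  shows "pullback_rho_L H \<Delta>' S' \<pi>' p = tsum (R p) (\<lambda>q h. \<pi> (Si h) \<otimes> q)"
proof -
  have lid: "clinear id" by (simp add: clinear_on_def)
  have l: "rho_L C_left H \<Delta>' S' \<pi>' (fst p) = tsum (RF (fst p)) (\<lambda>q h. \<pi> (Si h) \<otimes> q)"
    by (rule rho_L_eq) (use assms C_left_subalgebra pullback_memD[OF assms(1)] in \<open>auto dest: subalgebraD(1)\<close>)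
  have r: "rho_L C_right H \<Delta>' S' \<pi>' (snd p) = tsum (RF (snd p)) (\<lambda>q h. \<pi> (Si h) \<otimes> q)"
    by (rule rho_L_eq) (use assms C_right_subalgebra pullback_memD[OF assms(1)] in \<open>auto dest: subalgebraD(1)\<close>)
  show ?thesis
    unfolding pullback_rho_L_def inl_inr_eta tensor_map_eq_tsum[OF lid clinear_inl] tensor_map_eq_tsum[OF lid clinear_inr] l r
    by (simp add: tsum_R tsum_tsum tsum_pure linearity_simps inl_inr_linear qlin)
qed

end

text \<open>Composition with a projection onto \<open>H\<close> does not change values on
  \<open>H\<close>, so each axiom for lifts on \<open>H\<close> becomes the corresponding Sweedler
  identity for total maps.\<close>

lemma hopf_total:
  assumes hopf: "hopf_star_algebra H \<Delta> \<epsilon> S" and bij: "bij_betw S H H"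
    and p: "range p \<subseteq> H" "clinear p" "\<And>h. h \<in> H \<Longrightarrow> p h = h"
  shows "hopf H (\<lambda>x. \<Delta> (p x)) (\<lambda>x. \<epsilon> (p x)) (\<lambda>x. S (p x)) (\<lambda>x. inv_into H S (p x))"
proof -
  have subalg: "subalgebra H" and co: "coalgebra H \<Delta> \<epsilon>" and linS: "clinear_on H S" and S_mem: "S ` H \<subseteq> H"
    using hopf by (auto simp: hopf_star_algebra_def)
  have H: "csubspace H" by (rule subalgebraD[OF subalg])
  have mem: "p x \<in> H" for x using p(1) by blast
  have l\<Delta>: "clinear_on H \<Delta>" and l\<epsilon>: "clinear_on H \<epsilon>" and \<Delta>m: "h \<in> H \<Longrightarrow> \<Delta> h \<in> H \<otimes>\<^sub>s H" for h
    using co by (auto simp: coalgebra_def)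
  have bS: "inv_into H S (S h) = h" "S (inv_into H S h) = h" "inv_into H S h \<in> H" if "h \<in> H" for h
    using that bij by (auto simp: bij_betw_def intro: inv_into_f_f f_inv_into_f inv_into_into)
  \<comment> \<open>Linearity of the inverse is checked after applying \<open>S\<close>, which is
    linear and injective on \<open>H\<close>.\<close>
  have linSi: "clinear_on H (inv_into H S)"
    unfolding clinear_on_def
  proof (intro conjI ballI allI)
    fix x y assume "x \<in> H" "y \<in> H"
    then have "S (inv_into H S x + inv_into H S y) = x + y" "inv_into H S x + inv_into H S y \<in> H"
      using linS bS subalgebraD[OF subalg] by (auto simp: clinear_on_def)
    then show "inv_into H S (x + y) = inv_into H S x + inv_into H S y" using bS(1) by metis
  next
    fix c x assume "x \<in> H"
    then have "S (c *\<^sub>C inv_into H S x) = c *\<^sub>C x" "c *\<^sub>C inv_into H S x \<in> H"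
      using linS bS subalgebraD[OF subalg] by (auto simp: clinear_on_def)
    then show "inv_into H S (c *\<^sub>C x) = c *\<^sub>C inv_into H S x" using bS(1) by metis
  qed
  have tot: "clinear (\<lambda>x. f (p x))" if "clinear_on H f" for f :: "_ \<Rightarrow> 'z::complex_vector"
    using that p(2) mem by (simp add: clinear_on_def)
  note lins = tot[OF l\<Delta>] tot[OF l\<epsilon>] tot[OF linS] tot[OF linSi]
  note L = linearity_simps lins[THEN clinear_add] lins[THEN clinear_scaleC] p(3)
  have lid: "clinear id" by (simp add: clinear_on_def)
  have lift: "tensor_lift_on H H f (\<Delta> h) = tsum (\<Delta> h) g"
    if "h \<in> H" "bilinear_C g" "\<And>u v. u \<in> H \<Longrightarrow> v \<in> H \<Longrightarrow> f u v = g u v" for h f and g :: "_ \<Rightarrow> _ \<Rightarrow> 'z::complex_vector"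
    by (rule tensor_lift_on_eq[OF H H \<Delta>m]) (use that in auto)
  show ?thesis
  proof
    show "subalgebra H" by fact
    show "clinear (\<lambda>x. \<Delta> (p x))" "clinear (\<lambda>x. \<epsilon> (p x))" "clinear (\<lambda>x. S (p x))" "clinear (\<lambda>x. inv_into H S (p x))"
      by (rule lins)+
    show "\<Delta> (p 1) = 1" "\<epsilon> (p 1) = 1"
      using hopf p(3) subalgebraD(2)[OF subalg] by (auto simp: hopf_star_algebra_def)
  next
    fix h assume h: "h \<in> H"
    show "\<Delta> (p h) \<in> H \<otimes>\<^sub>s H" by (rule \<Delta>m[OF mem])
    have "tensor_map_on H H \<Delta> id (\<Delta> h) = tensor_assoc (tensor_map_on H H id \<Delta> (\<Delta> h))"
      using co h by (simp add: coalgebra_def)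
    also have "tensor_map_on H H \<Delta> id (\<Delta> h) = tsum (\<Delta> h) (\<lambda>u v. \<Delta> (p u) \<otimes> v)"
      unfolding tensor_map_on_def by (rule lift[OF h]) (simp_all add: L)
    also have "tensor_map_on H H id \<Delta> (\<Delta> h) = tsum (\<Delta> h) (\<lambda>u v. u \<otimes> \<Delta> (p v))"
      unfolding tensor_map_on_def by (rule lift[OF h]) (simp_all add: L)
    finally show "tensor_map (\<lambda>x. \<Delta> (p x)) id (\<Delta> (p h)) = tensor_assoc (tensor_map id (\<lambda>x. \<Delta> (p x)) (\<Delta> (p h)))"
      by (simp add: tensor_map_eq_tsum[OF lins(1) lid] tensor_map_eq_tsum[OF lid lins(1)] p(3)[OF h])
    have "tensor_lift_on H H (\<lambda>y z. \<epsilon> y *\<^sub>C z) (\<Delta> h) = tsum (\<Delta> h) (\<lambda>x y. \<epsilon> (p x) *\<^sub>C y)"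
      by (rule lift[OF h]) (simp_all add: L)
    then show "tsum (\<Delta> (p h)) (\<lambda>x y. \<epsilon> (p x) *\<^sub>C y) = h"
      using co h by (simp add: coalgebra_def p(3))
    have "tensor_lift_on H H (\<lambda>y z. \<epsilon> z *\<^sub>C y) (\<Delta> h) = tsum (\<Delta> h) (\<lambda>x y. \<epsilon> (p y) *\<^sub>C x)"
      by (rule lift[OF h]) (simp_all add: L)
    then show "tsum (\<Delta> (p h)) (\<lambda>x y. \<epsilon> (p y) *\<^sub>C x) = h"
      using co h by (simp add: coalgebra_def p(3))
    have "tensor_lift_on H H (\<lambda>y z. S y * z) (\<Delta> h) = tsum (\<Delta> h) (\<lambda>x y. S (p x) * y)"
      by (rule lift[OF h]) (simp_all add: L)
    then show "tsum (\<Delta> (p h)) (\<lambda>x y. S (p x) * y) = \<epsilon> (p h) *\<^sub>C 1"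
      using hopf h by (simp add: hopf_star_algebra_def p(3))
    have "tensor_lift_on H H (\<lambda>y z. y * S z) (\<Delta> h) = tsum (\<Delta> h) (\<lambda>x y. x * S (p y))"
      by (rule lift[OF h]) (simp_all add: L)
    then show "tsum (\<Delta> (p h)) (\<lambda>x y. x * S (p y)) = \<epsilon> (p h) *\<^sub>C 1"
      using hopf h by (simp add: hopf_star_algebra_def p(3))
    show "S (p h) \<in> H" "inv_into H S (p h) \<in> H" "S (p (inv_into H S (p h))) = h" "inv_into H S (p (S (p h))) = h"
      using h bS S_mem by (auto simp: p(3))
    fix k assume k: "k \<in> H"
    show "\<Delta> (p (h * k)) = \<Delta> (p h) * \<Delta> (p k)" "\<epsilon> (p (h * k)) = \<epsilon> (p h) * \<epsilon> (p k)"
      using hopf h k subalgebraD(3)[OF subalg h k] by (auto simp: hopf_star_algebra_def p(3))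
  qed
qed

text \<open>The coideal property lets comultiplication and counit descend to the quotient,
  independently of representatives; the right ideal property gives the action of \<open>H\<close> on
  it.\<close>

lemma (in hopf) quotient_total:
  fixes \<pi>' :: "'a \<Rightarrow> 'c::complex_vector"
  assumes agree: "\<forall>h\<in>H. \<Delta>' h = \<Delta> h" "\<forall>h\<in>H. \<epsilon>' h = \<epsilon> h" "\<forall>h\<in>H. \<pi>' h = \<pi> h"
    and lin_\<pi>: "clinear \<pi>"
    and J: "coideal_right_ideal H \<Delta>' \<epsilon>' J" and q: "quotient_space_map H J \<pi>'"
    and i: "bicolinear_unital_splitting H \<Delta>' \<pi>' i"
  shows "hopf_quotient H \<Delta> \<epsilon> S Si \<pi> i"
    and "h \<in> H \<Longrightarrow> quotient_comult H \<Delta>' \<pi>' (\<pi> h) = tsum (\<Delta> h) (\<lambda>x y. \<pi> x \<otimes> \<pi> y)"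
    and "h \<in> H \<Longrightarrow> quotient_counit H \<epsilon>' \<pi>' (\<pi> h) = \<epsilon> h"
proof -
  note eq = agree[THEN bspec]
  note L = linearity_simps hlin clinear_add[OF lin_\<pi>] clinear_scaleC[OF lin_\<pi>]
  have lift: "tensor_lift_on H H f (\<Delta>' h) = tsum (\<Delta> h) g"
    if "h \<in> H" "bilinear_C g" "\<And>u v. u \<in> H \<Longrightarrow> v \<in> H \<Longrightarrow> f u v = g u v" for h f and g :: "_ \<Rightarrow> _ \<Rightarrow> 'z::complex_vector"
    unfolding eq(1)[OF that(1)] by (rule tensor_lift_on_eq[OF H_rules(1) H_rules(1) \<Delta>_mem]) (use that in auto)
  have JH: "x \<in> H" "\<pi> x = 0" "\<epsilon> x = 0" if "x \<in> J" for x
    using that J q eq by (auto simp: coideal_right_ideal_def quotient_space_map_def)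
  have JI: "x \<in> J" if "x \<in> H" "\<pi> x = 0" for x
    using that q eq by (auto simp: quotient_space_map_def)
  \<comment> \<open>\<open>\<pi> \<otimes> \<pi>\<close>, which kills \<open>J \<otimes> H\<close>
    and \<open>H \<otimes> J\<close>, hence the coproduct of \<open>J\<close>.\<close>
  define PP where "PP t = tsum t (\<lambda>x y. \<pi> x \<otimes> \<pi> y)" for t
  have lPP: "clinear PP" by (simp add: PP_def L)
  have PP_J: "PP (\<Delta> x) = 0" if x: "x \<in> J" for x
  proof -
    have "\<Delta>' x \<in> {s + t |s t. s \<in> J \<otimes>\<^sub>s H \<and> t \<in> H \<otimes>\<^sub>s J}"
      using J x by (auto simp: coideal_right_ideal_def)
    then obtain s t where st: "\<Delta> x = s + t" "s \<in> J \<otimes>\<^sub>s H" "t \<in> H \<otimes>\<^sub>s J"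
      using eq(1)[OF JH(1)[OF x]] by auto
    have "PP s \<in> {0}"
      by (rule clinear_image_tensor_set[OF lPP st(2)]) (simp_all add: PP_def tsum_pure L JH)
    moreover have "PP t \<in> {0}"
      by (rule clinear_image_tensor_set[OF lPP st(3)]) (simp_all add: PP_def tsum_pure L JH)
    ultimately show ?thesis by (simp add: st(1) clinear_add[OF lPP])
  qed
  have diff_J: "x - y \<in> J" if "x \<in> H" "y \<in> H" "\<pi> x = \<pi> y" for x y
    using that by (intro JI) (simp_all add: H_rules clinear_diff[OF lin_\<pi>])
  have PP_eq: "PP (\<Delta> x) = PP (\<Delta> y)" if "x \<in> H" "y \<in> H" "\<pi> x = \<pi> y" for x y
    using PP_J[OF diff_J[OF that]] by (simp add: clinear_diff[OF lin(1)] clinear_diff[OF lPP])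
  have \<epsilon>_eq: "\<epsilon> x = \<epsilon> y" if "x \<in> H" "y \<in> H" "\<pi> x = \<pi> y" for x y
    using JH(3)[OF diff_J[OF that]] by (simp add: clinear_diff[OF lin(2)])
  have inv: "inv_into H \<pi>' c \<in> H" "\<pi> (inv_into H \<pi>' c) = c" for c
  proof -
    have c: "c \<in> \<pi>' ` H" using q by (auto simp: quotient_space_map_def)
    show "inv_into H \<pi>' c \<in> H" by (rule inv_into_into[OF c])
    then show "\<pi> (inv_into H \<pi>' c) = c" using f_inv_into_f[OF c] eq(3) by metis
  qed
  show qc: "quotient_comult H \<Delta>' \<pi>' (\<pi> h) = tsum (\<Delta> h) (\<lambda>x y. \<pi> x \<otimes> \<pi> y)" if h: "h \<in> H" for h
  proof -
    have "quotient_comult H \<Delta>' \<pi>' (\<pi> h) = PP (\<Delta> (inv_into H \<pi>' (\<pi> h)))"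
      unfolding quotient_comult_def tensor_map_on_def PP_def by (rule lift[OF inv(1)]) (simp_all add: L eq)
    also have "\<dots> = PP (\<Delta> h)" by (rule PP_eq) (simp_all add: inv h)
    finally show ?thesis by (simp add: PP_def)
  qed
  show "quotient_counit H \<epsilon>' \<pi>' (\<pi> h) = \<epsilon> h" if h: "h \<in> H" for h
    unfolding quotient_counit_def eq(2)[OF inv(1)] by (rule \<epsilon>_eq) (simp_all add: inv h)
  have lid: "clinear id" by (simp add: clinear_on_def)
  have lin_i: "clinear i" and i_mem: "i c \<in> H" and \<pi>_i: "\<pi> (i c) = c"
    and ir: "tensor_map_on H H id \<pi>' (\<Delta>' (i c)) = tensor_map i id (quotient_comult H \<Delta>' \<pi>' c)"
    and il: "tensor_map_on H H \<pi>' id (\<Delta>' (i c)) = tensor_map id i (quotient_comult H \<Delta>' \<pi>' c)" for c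
    using i eq(3) by (auto simp: bicolinear_unital_splitting_def) (metis range_subsetD)+
  show "hopf_quotient H \<Delta> \<epsilon> S Si \<pi> i"
  proof
    show "clinear \<pi>" "clinear i" "\<And>c. i c \<in> H" "\<And>c. \<pi> (i c) = c" by fact+
  next
    fix h k assume h: "h \<in> H" and k: "k \<in> H"
    \<comment> \<open>\<open>i (\<pi> h)\<close> and \<open>h\<close> have the same class, so their
      difference lies in \<open>J\<close>, which absorbs \<open>k\<close> on the right.\<close>
    have "(i (\<pi> h) - h) * k \<in> J"
      using J k diff_J[OF i_mem h, of "\<pi> h"] by (auto simp: coideal_right_ideal_def \<pi>_i)
    then have "\<pi> (i (\<pi> h) * k - h * k) = 0" by (simp add: JH left_diff_distrib)
    then show "\<pi> (i (\<pi> h) * k) = \<pi> (h * k)" by (simp add: clinear_diff[OF lin_\<pi>])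
  next
    fix h assume h: "h \<in> H"
    show "\<epsilon> (i (\<pi> h)) = \<epsilon> h" by (rule \<epsilon>_eq) (simp_all add: i_mem h \<pi>_i)
    have "tsum (\<Delta> (i (\<pi> h))) (\<lambda>x y. x \<otimes> \<pi> y) = tensor_map_on H H id \<pi>' (\<Delta>' (i (\<pi> h)))"
      unfolding tensor_map_on_def by (rule lift[OF i_mem, symmetric]) (simp_all add: L eq)
    also have "\<dots> = tsum (\<Delta> h) (\<lambda>x y. i (\<pi> x) \<otimes> \<pi> y)"
      by (simp add: ir qc[OF h] tensor_map_eq_tsum[OF lin_i lid] tsum_tsum tsum_pure L
          clinear_add[OF lin_i] clinear_scaleC[OF lin_i])
    finally show "tsum (\<Delta> (i (\<pi> h))) (\<lambda>x y. x \<otimes> \<pi> y) = tsum (\<Delta> h) (\<lambda>x y. i (\<pi> x) \<otimes> \<pi> y)" .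
    have "tsum (\<Delta> (i (\<pi> h))) (\<lambda>x y. \<pi> x \<otimes> y) = tensor_map_on H H \<pi>' id (\<Delta>' (i (\<pi> h)))"
      unfolding tensor_map_on_def by (rule lift[OF i_mem, symmetric]) (simp_all add: L eq)
    also have "\<dots> = tsum (\<Delta> h) (\<lambda>x y. \<pi> x \<otimes> i (\<pi> y))"
      by (simp add: il qc[OF h] tensor_map_eq_tsum[OF lid lin_i] tsum_tsum tsum_pure L
          clinear_add[OF lin_i] clinear_scaleC[OF lin_i])
    finally show "tsum (\<Delta> (i (\<pi> h))) (\<lambda>x y. \<pi> x \<otimes> y) = tsum (\<Delta> h) (\<lambda>x y. \<pi> x \<otimes> i (\<pi> y))" .
  qed
qed

theorem theorem4p3:
  fixes j :: "('a::cstar_algebra, 'a) tensor \<Rightarrow> 't::cstar_algebra"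
    and jl :: "('t, 'a) tensor \<Rightarrow> 'u::cstar_algebra"
    and jr :: "('a, 't) tensor \<Rightarrow> 'u"
    and \<Phi> :: "'a \<Rightarrow> 't"
    and H J :: "'a set"
    and \<Delta> :: "'a \<Rightarrow> ('a, 'a) tensor"
    and \<epsilon> :: "'a \<Rightarrow> complex"
    and S :: "'a \<Rightarrow> 'a"
    and \<pi> :: "'a \<Rightarrow> 'c::complex_vector"
  assumes "compact_quantum_group j jl jr \<Phi>"
    and "peter_weyl_hopf_algebra j \<Phi> H \<Delta> \<epsilon> S"
    and "coideal_right_ideal H \<Delta> \<epsilon> J"
    and "quotient_space_map H J \<pi>"
    and "\<exists>i. bicolinear_unital_splitting H \<Delta> \<pi> i"
  shows "principal_comodule (P_pullback H \<Delta>) (quotient_comult H \<Delta> \<pi>) (quotient_counit H \<epsilon> \<pi>)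
           (pullback_rho_R H \<Delta> \<pi>) (\<pi> 1) \<and>
         (\<forall>p \<in> P_pullback H \<Delta>.
           pullback_rho_L H \<Delta> S \<pi> p = induced_left_coaction (P_pullback H \<Delta>) (pullback_rho_R H \<Delta> \<pi>) (\<pi> 1) p)"
proof -
  have hopf: "hopf_star_algebra H \<Delta> \<epsilon> S" and bij: "bij_betw S H H"
    using assms(2) by (auto simp: peter_weyl_hopf_algebra_def)
  have subalg: "subalgebra H" using hopf by (simp add: hopf_star_algebra_def)
  obtain p where p: "range p \<subseteq> H" "clinear p" "\<And>h. h \<in> H \<Longrightarrow> p h = h"
    using subspace_projection[OF subalgebraD(1)[OF subalg]] by metis
  obtain i where i: "bicolinear_unital_splitting H \<Delta> \<pi> i" using assms(5) by blast
  \<comment> \<open>The primes now mark the total extensions; they are the parameters with which the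
    locales are interpreted.\<close>
  define \<Delta>' \<epsilon>' S' Si' \<pi>' where defs: "\<Delta>' = (\<lambda>x. \<Delta> (p x))" "\<epsilon>' = (\<lambda>x. \<epsilon> (p x))" "S' = (\<lambda>x. S (p x))"
    "Si' = (\<lambda>x. inv_into H S (p x))" "\<pi>' = (\<lambda>x. \<pi> (p x))"
  have eq: "\<forall>h\<in>H. \<Delta> h = \<Delta>' h" "\<forall>h\<in>H. \<epsilon> h = \<epsilon>' h" "\<forall>h\<in>H. \<pi> h = \<pi>' h" "\<forall>h\<in>H. inv_into H S h = Si' h"
    by (simp_all add: defs p(3))
  interpret hopf H \<Delta>' \<epsilon>' S' Si'
    unfolding defs by (rule hopf_total[OF hopf bij p])
  have lin_\<pi>: "clinear \<pi>'"
    using assms(4) p(1,2) by (auto simp: defs quotient_space_map_def clinear_on_def range_subsetD)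
  note quot = quotient_total[OF eq(1-3) lin_\<pi> assms(3,4) i]
  interpret hopf_quotient H \<Delta>' \<epsilon>' S' Si' \<pi>' i by (rule quot(1))
  interpret pullback H \<Delta>' \<epsilon>' S' Si' \<pi>' i ..
  have P: "P_pullback H \<Delta> = P_pullback H \<Delta>'"
    using eq(1) by (simp add: P_pullback_def P_left_def cong: image_cong)
  \<comment> \<open>The quotient structure is defined with an arbitrary representative;
    \<open>i c\<close> is another one, and the result does not depend on it.\<close>
  have "quotient_comult H \<Delta> \<pi> = \<delta>"
    using quot(2)[OF i_mem] by (simp add: fun_eq_iff \<delta>_def \<pi>_i)
  moreover have "quotient_counit H \<epsilon> \<pi> = (\<lambda>c. \<epsilon>' (i c))"
    using quot(3)[OF i_mem] by (simp add: fun_eq_iff \<pi>_i)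
  moreover have "\<pi> 1 = \<pi>' 1" by (simp add: eq H_rules)
  moreover note pullback_rho_R_eq[OF _ eq(1,3)]
  moreover have "pullback_rho_L H \<Delta> S \<pi> q = induced_left_coaction (P_pullback H \<Delta>') \<rho> (\<pi>' 1) q"
    if "q \<in> P_pullback H \<Delta>'" for q
    using pullback_rho_L_eq[OF that eq(1,3,4)] induced_left[OF that] by simp
  \<comment> \<open>The induced left coaction sees the right one only through the entwining, which
    depends on values on \<open>P\<close> alone.\<close>
  moreover have "induced_left_coaction (P_pullback H \<Delta>') (pullback_rho_R H \<Delta> \<pi>) (\<pi>' 1) =
      induced_left_coaction (P_pullback H \<Delta>') \<rho> (\<pi>' 1)"
    unfolding induced_left_coaction_def[abs_def]
    using coaction_cong(3)[OF subalgebra_pullback pullback_rho_R_eq[OF _ eq(1,3)]] by simp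
  ultimately show ?thesis
    unfolding P using principal_comodule_cong[OF principal pullback_rho_R_eq[OF _ eq(1,3)]] by simp
qed

end
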